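(* Let $M$ be a Riemannian surface with constant Gaussian curvature $\kappa(M)$, isometric to one of the model surfaces $\mathbb R^2$, $\mathbb S_r$ ($r>0$), or $\mathbb H_k$ ($k>0$) described in the context. Let $P(I(X)=1)$ denote the Buffon probability for $M$ with a geodesic needle of length $2L$ and a grating of spacing $2L$, as defined in the context. Then \[\lim_{L\to 0^+}\frac{9\pi}{2}\cdot\frac{P(I(X)=1) - \frac{2}{\pi}}{L^2} = \kappa(M),\] where $L$ tends to $0$ through its admissible values.
   Context: Model surfaces: $\mathbb R^2$ is the Euclidean plane; $\mathbb S_r$ is the round sphere of radius $r>0$ in $\mathbb R^3$ with its geodesic distance; $\mathbb H_k$ ($k>0$) is the open unit disk with the Riemannian metric ${\rm d}s^2=\frac{4k^2}{(1-(x^2+y^2))^2}({\rm d}x\otimes {\rm d}x+{\rm d}y\otimes {\rm d}y)$. Admissible $L$: any $L>0$ if $M$ is $\mathbb R^2$ or $\mathbb H_k$; $L=\frac{\pi r}{2n}$ with $n$ a natural number greater than $1$ if $M$ is $\mathbb S_r$. (So for $\mathbb S_r$, $L\to0^+$ means $L=\frac{\pi r}{2n}$ with $n\to\infty$.) Equators and gratings: an equator $\mathcal E$ for $M$ is a directed (complete) geodesic of $M$. For $x\in\mathcal E$ and a real number $z$ (taken mod $2\pi r$ for $\mathbb S_r$), $p_x(z)$ is the point of $\mathcal E$ at signed distance $z$ from $x$ along $\mathcal E$. A grating line for $\mathcal E$ is a (complete) geodesic that meets $\mathcal E$ at a right angle. A grating $G(L)$ with equator $\mathcal E$ and spacing $2L$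 is a set of grating lines for $\mathcal E$ whose points of intersection with $\mathcal E$ form an evenly spaced set with smallest spacing $2L$, extending along all of $\mathcal E$; that is, for any point $x_0$ in $G(L)\cap\mathcal E$, $G(L)\cap\mathcal E=\{p_{x_0}(2mL)\colon m\in\mathbb Z\}$. Needle and Buffon probability: a needle is a geodesic segment of length $2L$ with a marked endpoint (its tip). For $x\in\mathcal E$, let $X$ be uniformly distributed on $[-L,L]$; given $X=z$, the needle has midpoint $p_x(z)$ and its tip is uniformly distributed, with respect to arc length, on the geodesic circle of radius $L$ centered at $p_x(z)$. Let $I_x(X)$ be the random variable equal to $1$ if the needle intersects (some line of) $G(L)$ and $0$ otherwise. Write $I(X)=I_{x_0}(X)$, where $\mathcal E$ is an equator, $G(L)$ is a grating with equator $\mathcal E$ and spacing $2L$, and $x_0\in G(L)\cap\mathcal E$. The Buffon probability is $P(I(X)=1)$. *)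

theory Defs
  imports "HOL-Analysis.Analysis"
begin

section \<open>Riemannian surfaces\<close>

definition partial :: "2 \<Rightarrow> (real^2 \<Rightarrow> 'b::real_normed_vector) \<Rightarrow> real^2 \<Rightarrow> 'b" where
  "partial i f u = frechet_derivative f (at u) (axis i 1)"

text \<open>Class \<open>C\<^sup>n\<close> and class \<open>C\<close>-infinity on an open set \<open>W\<close>.\<close>

primrec C_on :: "nat \<Rightarrow> (real^2) set \<Rightarrow> (real^2 \<Rightarrow> 'b::real_normed_vector) \<Rightarrow> bool" where
  "C_on 0 W f \<longleftrightarrow> continuous_on W f"
| "C_on (Suc n) W f \<longleftrightarrow> (\<forall>u\<in>W. f differentiable (at u)) \<and> (\<forall>i. C_on n W (partial i f))"

definition smooth_on :: "(real^2) set \<Rightarrow> (real^2 \<Rightarrow> 'b::real_normed_vector) \<Rightarrow> bool" where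
  "smooth_on W f \<longleftrightarrow> (\<forall>n. C_on n W f)"

text \<open>
  Charts are written as local parametrizations, from an open set of coordinates into the surface,
  and carry the matrix of the metric tensor in these coordinates. Outside \<open>cdom\<close> the values of
  \<open>cmap\<close> and \<open>cmet\<close> are irrelevant.
\<close>

datatype 'a chart =
  Chart (cdom: "(real^2) set") (cmap: "real^2 \<Rightarrow> 'a") (cmet: "real^2 \<Rightarrow> real^2^2")

abbreviation cimage :: "'a chart \<Rightarrow> 'a set" where
  "cimage c \<equiv> cmap c ` cdom c"

definition coords :: "'a chart \<Rightarrow> 'a \<Rightarrow> real^2" where
  "coords c p = inv_into (cdom c) (cmap c) p"

definition riemannian_chart :: "'a chart \<Rightarrow> bool" where
  "riemannian_chart c \<longleftrightarrow>
     open (cdom c) \<and> inj_on (cmap c) (cdom c) \<and> smooth_on (cdom c) (cmet c) \<and>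
     (\<forall>u\<in>cdom c. transpose (cmet c u) = cmet c u \<and> (\<forall>v. v \<noteq> 0 \<longrightarrow> v \<bullet> (cmet c u *v v) > 0))"

definition overlap :: "'a chart \<Rightarrow> 'a chart \<Rightarrow> (real^2) set" where
  "overlap c d = {u \<in> cdom c. cmap c u \<in> cimage d}"

definition transition :: "'a chart \<Rightarrow> 'a chart \<Rightarrow> real^2 \<Rightarrow> real^2" where
  "transition c d u = coords d (cmap c u)"

definition jacobian :: "(real^2 \<Rightarrow> real^2) \<Rightarrow> real^2 \<Rightarrow> real^2^2" where
  "jacobian \<phi> u = matrix (frechet_derivative \<phi> (at u))"

definition metric_transition :: "'a chart \<Rightarrow> 'a chart \<Rightarrow> bool" where
  "metric_transition c d \<longleftrightarrow>
     open (overlap c d) \<and> smooth_on (overlap c d) (transition c d) \<and>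
     (\<forall>u\<in>overlap c d.
        cmet c u =
          transpose (jacobian (transition c d) u) ** cmet d (transition c d u)
            ** jacobian (transition c d) u)"

definition compatible :: "'a chart \<Rightarrow> 'a chart \<Rightarrow> bool" where
  "compatible c d \<longleftrightarrow> metric_transition c d \<and> metric_transition d c"

datatype 'a surface = Surface (points: "'a set") (charts: "'a chart set")

definition surface_topology :: "'a surface \<Rightarrow> 'a topology" where
  "surface_topology M =
     topology (\<lambda>U. U \<subseteq> points M \<and> (\<forall>c\<in>charts M. open {u \<in> cdom c. cmap c u \<in> U}))"

text \<open>The atlas is maximal; \<open>surface_of_atlas\<close> below generates one from any atlas.\<close>

definition riemannian_surface :: "'a surface \<Rightarrow> bool" where
  "riemannian_surface M \<longleftrightarrow>
     points M = (\<Union>c\<in>charts M. cimage c) \<and>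
     (\<forall>c\<in>charts M. riemannian_chart c) \<and>
     (\<forall>c\<in>charts M. \<forall>d\<in>charts M. compatible c d) \<and>
     (\<forall>c. riemannian_chart c \<and> cimage c \<subseteq> points M \<and> (\<forall>d\<in>charts M. compatible c d)
          \<longrightarrow> c \<in> charts M) \<and>
     Hausdorff_space (surface_topology M) \<and> second_countable (surface_topology M)"

definition surface_of_atlas :: "'a set \<Rightarrow> 'a chart set \<Rightarrow> 'a surface" where
  "surface_of_atlas P A =
     Surface P {c. riemannian_chart c \<and> cimage c \<subseteq> P \<and> (\<forall>d\<in>A. compatible c d)}"

text \<open>
  A Riemannian isometry: in all charts, \<open>f\<close> and its inverse are smooth, and \<open>f\<close> pulls the metric of
  \<open>N\<close> back to that of \<open>M\<close>. Indeed the transition from the transported chart to \<open>d\<close> is the coordinate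
  expression of \<open>f\<close> in the charts \<open>c\<close> and \<open>d\<close>.
\<close>

definition isometry :: "('a \<Rightarrow> 'b) \<Rightarrow> 'a surface \<Rightarrow> 'b surface \<Rightarrow> bool" where
  "isometry f M N \<longleftrightarrow>
     bij_betw f (points M) (points N) \<and>
     (\<forall>c\<in>charts M. \<forall>d\<in>charts N. compatible (Chart (cdom c) (f \<circ> cmap c) (cmet c)) d)"

definition isometric :: "'a surface \<Rightarrow> 'b surface \<Rightarrow> bool" where
  "isometric M N \<longleftrightarrow> (\<exists>f. isometry f M N)"


section \<open>Curvature\<close>

definition christoffel :: "(real^2 \<Rightarrow> real^2^2) \<Rightarrow> 2 \<Rightarrow> 2 \<Rightarrow> 2 \<Rightarrow> real^2 \<Rightarrow> real" where
  "christoffel g k i j u =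
     (\<Sum>l\<in>UNIV. matrix_inv (g u) $ k $ l *
        (partial i (\<lambda>v. g v $ j $ l) u + partial j (\<lambda>v. g v $ i $ l) u
           - partial l (\<lambda>v. g v $ i $ j) u)) / 2"

text \<open>The \<open>l\<close>-th component of \<open>R(\<partial>\<^sub>i, \<partial>\<^sub>j) \<partial>\<^sub>k\<close>, where \<open>R(X,Y) = [\<nabla>\<^sub>X, \<nabla>\<^sub>Y] - \<nabla>\<^bsub>[X,Y]\<^esub>\<close>.\<close>

definition riemann :: "(real^2 \<Rightarrow> real^2^2) \<Rightarrow> 2 \<Rightarrow> 2 \<Rightarrow> 2 \<Rightarrow> 2 \<Rightarrow> real^2 \<Rightarrow> real" where
  "riemann g l i j k u =
     partial i (christoffel g l j k) u - partial j (christoffel g l i k) u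
     + (\<Sum>m\<in>UNIV. christoffel g l i m u * christoffel g m j k u
                   - christoffel g l j m u * christoffel g m i k u)"

text \<open>\<open>\<langle>R(\<partial>\<^sub>1, \<partial>\<^sub>2) \<partial>\<^sub>2, \<partial>\<^sub>1\<rangle> / det g\<close>.\<close>

definition gauss_curvature :: "(real^2 \<Rightarrow> real^2^2) \<Rightarrow> real^2 \<Rightarrow> real" where
  "gauss_curvature g u = (\<Sum>l\<in>UNIV. g u $ 1 $ l * riemann g l 1 2 2 u) / det (g u)"

definition constant_curvature :: "'a surface \<Rightarrow> real \<Rightarrow> bool" where
  "constant_curvature M \<kappa> \<longleftrightarrow> (\<forall>c\<in>charts M. \<forall>u\<in>cdom c. gauss_curvature (cmet c) u = \<kappa>)"


section \<open>The model surfaces\<close>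

definition plane :: "(real^2) surface" where
  "plane = surface_of_atlas UNIV {Chart UNIV id (\<lambda>_. mat 1)}"

definition induced_metric :: "(real^2 \<Rightarrow> real^3) \<Rightarrow> real^2 \<Rightarrow> real^2^2" where
  "induced_metric x u = (\<chi> i j. partial i x u \<bullet> partial j x u)"

text \<open>Inverse stereographic projections from the poles \<open>(0, 0, r)\<close> (\<open>\<epsilon> = 1\<close>) and \<open>(0, 0, -r)\<close>
  (\<open>\<epsilon> = -1\<close>).\<close>

definition stereo :: "real \<Rightarrow> real \<Rightarrow> real^2 \<Rightarrow> real^3" where
  "stereo r \<epsilon> u = (r / (1 + (norm u)\<^sup>2)) *\<^sub>R vector [2 * u$1, 2 * u$2, \<epsilon> * ((norm u)\<^sup>2 - 1)]"

definition round_sphere :: "real \<Rightarrow> (real^3) surface" where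
  "round_sphere r =
     surface_of_atlas (sphere 0 r)
       ((\<lambda>\<epsilon>. Chart UNIV (stereo r \<epsilon>) (induced_metric (stereo r \<epsilon>))) ` {1, -1})"

definition hyperbolic_disk :: "real \<Rightarrow> (real^2) surface" where
  "hyperbolic_disk k =
     surface_of_atlas (ball 0 1)
       {Chart (ball 0 1) id (\<lambda>u. (4 * k\<^sup>2 / (1 - ((u$1)\<^sup>2 + (u$2)\<^sup>2))\<^sup>2) *\<^sub>R mat 1)}"

datatype model = Plane | Sphere real | Disk real

fun isometric_to_model :: "'a surface \<Rightarrow> model \<Rightarrow> bool" where
  "isometric_to_model M Plane \<longleftrightarrow> isometric M plane"
| "isometric_to_model M (Sphere r) \<longleftrightarrow> r > 0 \<and> isometric M (round_sphere r)"
| "isometric_to_model M (Disk k) \<longleftrightarrow> k > 0 \<and> isometric M (hyperbolic_disk k)"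

fun admissible :: "model \<Rightarrow> real \<Rightarrow> bool" where
  "admissible Plane L \<longleftrightarrow> L > 0"
| "admissible (Sphere r) L \<longleftrightarrow> (\<exists>n::nat. n > 1 \<and> L = pi * r / (2 * real n))"
| "admissible (Disk k) L \<longleftrightarrow> L > 0"


section \<open>Curves and geodesics\<close>

definition velocity :: "'a chart \<Rightarrow> (real \<Rightarrow> 'a) \<Rightarrow> real \<Rightarrow> real^2" where
  "velocity c \<gamma> t = vector_derivative (\<lambda>s. coords c (\<gamma> s)) (at t)"

text \<open>\<open>C\<^sup>1\<close> curves parametrized by arc length.\<close>

definition unit_speed_curve :: "'a surface \<Rightarrow> (real \<Rightarrow> 'a) \<Rightarrow> bool" where
  "unit_speed_curve M \<gamma> \<longleftrightarrow>
     continuous_map euclideanreal (surface_topology M) \<gamma> \<and>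
     (\<forall>c\<in>charts M.
        continuous_on (\<gamma> -` cimage c) (velocity c \<gamma>) \<and>
        (\<forall>t \<in> \<gamma> -` cimage c.
           (\<lambda>s. coords c (\<gamma> s)) differentiable (at t) \<and>
           velocity c \<gamma> t \<bullet> (cmet c (coords c (\<gamma> t)) *v velocity c \<gamma> t) = 1))"

text \<open>Complete unit speed geodesics, by the geodesic equation in every chart.\<close>

definition geodesic :: "'a surface \<Rightarrow> (real \<Rightarrow> 'a) \<Rightarrow> bool" where
  "geodesic M \<gamma> \<longleftrightarrow>
     unit_speed_curve M \<gamma> \<and>
     (\<forall>c\<in>charts M. \<forall>t \<in> \<gamma> -` cimage c.
        (velocity c \<gamma> has_vector_derivative
           (\<chi> k. - (\<Sum>i\<in>UNIV. \<Sum>j\<in>UNIV.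
                      christoffel (cmet c) k i j (coords c (\<gamma> t))
                        * velocity c \<gamma> t $ i * velocity c \<gamma> t $ j)))
        (at t))"

definition meet_at_right_angle ::
    "'a surface \<Rightarrow> (real \<Rightarrow> 'a) \<Rightarrow> real \<Rightarrow> (real \<Rightarrow> 'a) \<Rightarrow> real \<Rightarrow> bool" where
  "meet_at_right_angle M \<gamma> t \<eta> s \<longleftrightarrow>
     \<gamma> t = \<eta> s \<and>
     (\<forall>c\<in>charts M. \<gamma> t \<in> cimage c \<longrightarrow>
        velocity c \<gamma> t \<bullet> (cmet c (coords c (\<gamma> t)) *v velocity c \<eta> s) = 0)"

definition geodesic_circle :: "'a surface \<Rightarrow> 'a \<Rightarrow> real \<Rightarrow> 'a set" where
  "geodesic_circle M p \<rho> = {\<sigma> \<rho> |\<sigma>. geodesic M \<sigma> \<and> \<sigma> 0 = p}"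

text \<open>\<open>c\<close> parametrizes the simple closed curve \<open>C\<close> of length \<open>l\<close> by arc length.\<close>

definition arclength_param :: "'a surface \<Rightarrow> 'a set \<Rightarrow> real \<Rightarrow> (real \<Rightarrow> 'a) \<Rightarrow> bool" where
  "arclength_param M C l c \<longleftrightarrow>
     l > 0 \<and> unit_speed_curve M c \<and> (\<forall>s. c (s + l) = c s) \<and> bij_betw c {0..<l} C"

definition surface_borel :: "'a surface \<Rightarrow> 'a measure" where
  "surface_borel M = sigma (points M) {U. openin (surface_topology M) U}"

text \<open>The uniform distribution with respect to arc length on a simple closed curve \<open>C\<close>. It does not
  depend on the chosen parametrization, since any two differ by a shift and possibly a reversal.\<close>

definition uniform_on_curve :: "'a surface \<Rightarrow> 'a set \<Rightarrow> 'a measure" where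
  "uniform_on_curve M C =
     (case (SOME (l, c). arclength_param M C l c) of
        (l, c) \<Rightarrow> distr (uniform_measure lborel {0..<l}) (surface_borel M) c)"


section \<open>Gratings and the Buffon probability\<close>

text \<open>An equator, being directed, is given by a unit speed parametrization \<open>\<gamma>\<close>; the point at signed
  distance \<open>z\<close> from \<open>\<gamma> a\<close> along it is \<open>\<gamma> (a + z)\<close>.\<close>

definition equator :: "'a surface \<Rightarrow> (real \<Rightarrow> 'a) \<Rightarrow> bool" where
  "equator M \<gamma> \<longleftrightarrow> geodesic M \<gamma>"

definition grating_line :: "'a surface \<Rightarrow> (real \<Rightarrow> 'a) \<Rightarrow> 'a set \<Rightarrow> bool" where
  "grating_line M \<gamma> l \<longleftrightarrow>
     (\<exists>\<eta> t s. geodesic M \<eta> \<and> l = range \<eta> \<and> meet_at_right_angle M \<gamma> t \<eta> s)"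

text \<open>A grating with equator \<open>\<gamma>\<close> and spacing \<open>2 * L\<close>.\<close>

definition grating :: "'a surface \<Rightarrow> (real \<Rightarrow> 'a) \<Rightarrow> real \<Rightarrow> 'a set set \<Rightarrow> bool" where
  "grating M \<gamma> L G \<longleftrightarrow>
     G \<noteq> {} \<and> (\<forall>l\<in>G. grating_line M \<gamma> l) \<and>
     (\<forall>a. \<gamma> a \<in> \<Union>G \<longrightarrow> \<Union>G \<inter> range \<gamma> = {\<gamma> (a + 2 * of_int m * L) |m::int. True})"

definition needle :: "'a surface \<Rightarrow> real \<Rightarrow> 'a \<Rightarrow> 'a \<Rightarrow> 'a set \<Rightarrow> bool" where
  "needle M L p q N \<longleftrightarrow>
     (\<exists>\<sigma>. geodesic M \<sigma> \<and> \<sigma> 0 = p \<and> \<sigma> L = q \<and> N = \<sigma> ` {-L..L})"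

text \<open>The tips \<open>q\<close> for which the needle of length \<open>2 * L\<close> with midpoint \<open>p\<close> intersects the grating.\<close>

definition hitting_tips :: "'a surface \<Rightarrow> 'a set set \<Rightarrow> real \<Rightarrow> 'a \<Rightarrow> 'a set" where
  "hitting_tips M G L p = {q \<in> points M. \<exists>N. needle M L p q N \<and> N \<inter> \<Union>G \<noteq> {}}"

text \<open>The probability of \<open>I(X) = 1\<close> for \<open>x\<^sub>0 = \<gamma> a\<close>: the integrand is the conditional probability given
  \<open>X = z\<close>.\<close>

definition buffon_probability ::
    "'a surface \<Rightarrow> (real \<Rightarrow> 'a) \<Rightarrow> 'a set set \<Rightarrow> real \<Rightarrow> real \<Rightarrow> real" where
  "buffon_probability M \<gamma> G a L =
     (LINT z|uniform_measure lborel {-L..L}.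
        measure (uniform_on_curve M (geodesic_circle M (\<gamma> (a + z)) L))
          (hitting_tips M G L (\<gamma> (a + z))))"

end

(*
In each model the surface is embedded in R^3 as a quadric dual_form K x x = 1 that carries the
restriction of the bilinear form "form K": a round sphere, the affine plane x$3 = 1, or a sheet of a
hyperboloid. By Gauss' formula a curve is a geodesic iff its embedded acceleration is normal to the
surface, that is, iff X'' = - K X, so every geodesic is cs K s P + sn K s V, where cs and sn solve
f'' = - K f. Moving the equator into a standard position by a linear isometry, a needle with midpoint at
distance |z| < L from a grating line hits the grating iff tn K |z| <= tn K L * |cos theta|, where tn = sn / cs
and theta is the angle with the equator. The conditional probability is thus
2 / pi * arccos (tn K |z| / tn K L), and exchanging the order of integration turns the Buffon
probability into 2 / (pi L) times the integral of arctn K (tn K L * cos theta) over [0, pi/2]. Since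
arctn K u = u - K u^3 / 3 + O(u^5) and L = arctn K (tn K L), this integral is
L + K / 9 * (tn K L)^3 + O(L^5).
*)
theory Submission
  imports Defs
begin

section \<open>Calculus of the classes \<open>C_on\<close>\<close>

text \<open>Two choices left open by the definitions shape the work. The charts of \<open>M\<close>
  are arbitrary members of a maximal atlas, so every property of a curve is transferred to its image
  in R^3 and back; and \<open>uniform_on_curve\<close> selects an arc length parametrization by
  \<open>SOME\<close>, so each such parametrization of a geodesic circle has to be recognized as a
  uniform rotation. All signs of the curvature are handled at once by writing the third component of
  a tangent vector as \<open>K * w\<close>: then \<open>form\<close> stays meaningful at
  \<open>K = 0\<close>, although it is degenerate on R^3 there. On the sphere the grating lines are
  great circles with common poles, so a line far along the equator could come back to the needle;
  the admissible spacings make 2 L divide half the length of a great circle, so such a line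
  coincides with one already present. The constants: the cubic terms of both expansions combine to K
  / 3 * (1 - 2 / 3) = K / 9, since cos and cos^3 have integrals 1 and 2 / 3, and 9 pi / 2 is the
  inverse of the resulting factor 2 / pi * 1 / 9.\<close>

lemma partial_eq:
  "(f has_derivative f') (at u) \<Longrightarrow> partial i f u = f' (axis i 1)"
  unfolding partial_def by (metis frechet_derivative_at)

lemma has_derivative_partial:
  fixes f :: "real^2 \<Rightarrow> 'b::real_normed_vector"
  assumes "f differentiable (at u)"
  shows "(f has_derivative (\<lambda>h. \<Sum>i\<in>UNIV. h $ i *\<^sub>R partial i f u)) (at u)"
proof -
  have d: "(f has_derivative frechet_derivative f (at u)) (at u)"
    using assms by (simp add: frechet_derivative_works)
  have lin: "linear (frechet_derivative f (at u))"
    using d has_derivative_linear by blast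
  have "frechet_derivative f (at u) h = (\<Sum>i\<in>UNIV. h $ i *\<^sub>R partial i f u)" for h
  proof -
    have "frechet_derivative f (at u) (\<Sum>i\<in>UNIV. h $ i *s axis i 1)
        = (\<Sum>i\<in>UNIV. h $ i *\<^sub>R partial i f u)"
      by (simp add: linear_sum[OF lin] linear_scale[OF lin] partial_def scalar_mult_eq_scaleR)
    then show ?thesis by (simp add: basis_expansion)
  qed
  with d show ?thesis by (metis (no_types, lifting) ext)
qed

lemma partial_cong:
  assumes "open W" "u \<in> W" "\<And>v. v \<in> W \<Longrightarrow> f v = g v"
  shows "partial i f u = partial i g u"
proof -
  have "(f has_derivative D) (at u) \<longleftrightarrow> (g has_derivative D) (at u)" for D
    using assms has_derivative_transform_within_open[of f D u UNIV W g]
      has_derivative_transform_within_open[of g D u UNIV W f] by auto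
  then show ?thesis unfolding partial_def frechet_derivative_def by simp
qed

lemma C_on_cong:
  assumes "open W" "\<And>u. u \<in> W \<Longrightarrow> f u = g u" "C_on n W f"
  shows "C_on n W g"
  using assms(2,3)
proof (induction n arbitrary: f g)
  case 0
  then show ?case by (simp cong: continuous_on_cong)
next
  case (Suc n)
  have "g differentiable (at u)" if "u \<in> W" for u
  proof -
    obtain D where "(f has_derivative D) (at u)"
      using Suc.prems \<open>u \<in> W\<close> by (auto simp: differentiable_def)
    then have "(g has_derivative D) (at u)"
      using has_derivative_transform_within_open[of f D u UNIV W g] assms(1) Suc.prems(1) that
      by auto
    then show ?thesis by (auto simp: differentiable_def)
  qed
  moreover have "C_on n W (partial i g)" for i
    by (rule Suc.IH[of "partial i f"]) (use Suc.prems assms(1) in \<open>auto intro: partial_cong\<close>)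
  ultimately show ?case by simp
qed

lemma C_on_subset: "C_on n W f \<Longrightarrow> V \<subseteq> W \<Longrightarrow> C_on n V f"
  by (induction n arbitrary: f) (auto intro: continuous_on_subset)

lemma C_on_local:
  assumes "\<And>u. u \<in> W \<Longrightarrow> \<exists>V. open V \<and> u \<in> V \<and> C_on n V f"
  shows "C_on n W f"
  using assms
proof (induction n arbitrary: f)
  case 0
  show ?case
    unfolding C_on.simps continuous_on_eq_continuous_within
  proof
    fix u assume "u \<in> W"
    then obtain V where "open V" "u \<in> V" "continuous_on V f"
      using 0 by auto
    then have "isCont f u" by (simp add: continuous_on_eq_continuous_at)
    then show "continuous (at u within W) f" by (rule continuous_at_imp_continuous_at_within)
  qed
next
  case (Suc n)
  have "C_on n W (partial i f)" for i
    by (rule Suc.IH) (use Suc.prems in fastforce)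
  then show ?case using Suc.prems by fastforce
qed

lemma C_on_Suc_D: "C_on (Suc n) W f \<Longrightarrow> C_on n W f"
proof (induction n arbitrary: f)
  case 0
  then show ?case
    by (auto intro!: differentiable_imp_continuous_on differentiable_at_imp_differentiable_on)
next
  case (Suc n)
  then show ?case by (metis C_on.simps(2))
qed

lemma C_on_le: "C_on n W f \<Longrightarrow> m \<le> n \<Longrightarrow> C_on m W f"
  by (induction n) (auto dest: C_on_Suc_D simp: le_Suc_eq simp del: C_on.simps)

text \<open>Any derivative \<open>F\<close> may be supplied, which avoids computing
  \<open>frechet_derivative\<close>; openness of \<open>W\<close> lets the partial derivatives be
  replaced by \<open>F\<close> on all of \<open>W\<close> before differentiating further.\<close>

lemma C_on_SucI:
  assumes "open W"
    and "\<And>u. u \<in> W \<Longrightarrow> (f has_derivative F u) (at u)"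
    and "\<And>i. C_on n W (\<lambda>u. F u (axis i 1))"
  shows "C_on (Suc n) W f"
proof -
  have "C_on n W (partial i f)" for i
    by (rule C_on_cong[OF assms(1) _ assms(3)[of i]])
       (metis assms(2) partial_eq)
  then show ?thesis using assms(2) by (auto simp: differentiable_def)
qed

lemma C_on_const: "open W \<Longrightarrow> C_on n W (\<lambda>_. c)"
proof (induction n arbitrary: c)
  case (Suc n)
  show ?case by (rule C_on_SucI[where F="\<lambda>_ _. 0"]) (use Suc in \<open>auto intro: derivative_eq_intros\<close>)
qed simp

lemma C_on_bounded_linear:
  assumes "open W" "bounded_linear T" "C_on n W f"
  shows "C_on n W (\<lambda>u. T (f u))"
  using assms(3)
proof (induction n arbitrary: f)
  case 0
  then show ?case using assms(2) by (simp add: bounded_linear.continuous_on)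
next
  case (Suc n)
  show ?case
  proof (rule C_on_SucI[OF assms(1)])
    fix u assume "u \<in> W"
    then have "(f has_derivative frechet_derivative f (at u)) (at u)"
      using Suc.prems by (auto simp flip: frechet_derivative_works)
    then show "((\<lambda>u. T (f u)) has_derivative (\<lambda>h. T (frechet_derivative f (at u) h))) (at u)"
      by (rule bounded_linear.has_derivative[OF assms(2)])
  next
    fix i show "C_on n W (\<lambda>u. T (frechet_derivative f (at u) (axis i 1)))"
      using Suc by (auto simp: partial_def[abs_def])
  qed
qed

lemma C_on_component: "open W \<Longrightarrow> C_on n W (\<lambda>u. u $ i)"
proof (cases n)
  case (Suc m)
  assume "open W"
  show ?thesis unfolding Suc
    by (rule C_on_SucI[where F="\<lambda>_ h. h $ i"])
       (use \<open>open W\<close> in \<open>auto intro: C_on_const bounded_linear.has_derivative[OF bounded_linear_vec_nth]\<close>)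
qed (auto intro: continuous_intros)

lemma C_on_add:
  assumes "open W" "C_on n W f" "C_on n W g"
  shows "C_on n W (\<lambda>u. f u + g u)"
  using assms(2,3)
proof (induction n arbitrary: f g)
  case (Suc n)
  show ?case
  proof (rule C_on_SucI[OF assms(1)])
    fix u assume "u \<in> W"
    then have "(f has_derivative frechet_derivative f (at u)) (at u)"
       "(g has_derivative frechet_derivative g (at u)) (at u)"
      using Suc.prems by (auto simp flip: frechet_derivative_works)
    then show "((\<lambda>u. f u + g u) has_derivative
        (\<lambda>h. frechet_derivative f (at u) h + frechet_derivative g (at u) h)) (at u)"
      by (rule has_derivative_add)
  next
    fix i show "C_on n W (\<lambda>u. frechet_derivative f (at u) (axis i 1) +
        frechet_derivative g (at u) (axis i 1))"
      using Suc by (auto simp: partial_def[abs_def])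
  qed
qed (auto intro: continuous_intros)

lemma C_on_sum:
  assumes "open W" "finite I" "\<And>i. i \<in> I \<Longrightarrow> C_on n W (f i)"
  shows "C_on n W (\<lambda>u. \<Sum>i\<in>I. f i u)"
  using assms(2,3)
  by (induction I) (auto intro: C_on_add assms(1) C_on_const[OF assms(1)])

text \<open>The product rule puts an undifferentiated factor next to a partial derivative;
  \<open>C_on_Suc_D\<close> lowers the class of the former, so that the induction hypothesis applies
  to both products.\<close>

lemma C_on_bilinear:
  assumes "open W" "bounded_bilinear P" "C_on n W f" "C_on n W g"
  shows "C_on n W (\<lambda>u. P (f u) (g u))"
  using assms(3,4)
proof (induction n arbitrary: f g)
  case 0
  then show ?case using bounded_bilinear.continuous_on[OF assms(2)] by auto
next
  case (Suc n)
  show ?case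
  proof (rule C_on_SucI[OF assms(1)])
    fix u assume "u \<in> W"
    then have "(f has_derivative frechet_derivative f (at u)) (at u)"
       "(g has_derivative frechet_derivative g (at u)) (at u)"
      using Suc.prems by (auto simp flip: frechet_derivative_works)
    then show "((\<lambda>u. P (f u) (g u)) has_derivative
        (\<lambda>h. P (f u) (frechet_derivative g (at u) h) + P (frechet_derivative f (at u) h) (g u))) (at u)"
      by (rule bounded_bilinear.FDERIV[OF assms(2)])
  next
    fix i
    have "C_on n W (\<lambda>u. P (f u) (partial i g u) + P (partial i f u) (g u))"
      by (intro C_on_add assms(1) Suc.IH) (use Suc.prems C_on_Suc_D in auto)
    then show "C_on n W (\<lambda>u. P (f u) (frechet_derivative g (at u) (axis i 1)) +
        P (frechet_derivative f (at u) (axis i 1)) (g u))"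
      by (simp add: partial_def)
  qed
qed

lemmas C_on_mult = C_on_bilinear[OF _ bounded_bilinear_mult]
lemmas C_on_scaleR = C_on_bilinear[OF _ bounded_bilinear_scaleR]

text \<open>The derivative of the inverse contains the inverse itself, to which the induction
  hypothesis applies one order lower.\<close>

lemma C_on_inverse:
  fixes f :: "real^2 \<Rightarrow> real"
  assumes "open W" "C_on n W f" "\<And>u. u \<in> W \<Longrightarrow> f u \<noteq> 0"
  shows "C_on n W (\<lambda>u. inverse (f u))"
  using assms(2)
proof (induction n)
  case 0
  then show ?case using assms(3) by (auto intro!: continuous_intros)
next
  case (Suc n)
  show ?case
  proof (rule C_on_SucI[OF assms(1)])
    fix u assume "u \<in> W"
    then have "(f has_derivative frechet_derivative f (at u)) (at u)"
      using Suc.prems by (auto simp flip: frechet_derivative_works)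
    then show "((\<lambda>u. inverse (f u)) has_derivative
        (\<lambda>h. - (inverse (f u) * frechet_derivative f (at u) h * inverse (f u)))) (at u)"
      using assms(3)[OF \<open>u \<in> W\<close>] by (auto intro: has_derivative_inverse)
  next
    fix i
    have "C_on n W (\<lambda>u. - (inverse (f u) * partial i f u * inverse (f u)))"
      by (intro C_on_bounded_linear[OF assms(1) bounded_linear_minus[OF bounded_linear_ident]]
            C_on_mult assms(1) Suc.IH) (use Suc.prems C_on_Suc_D in auto)
    then show "C_on n W (\<lambda>u. - (inverse (f u) * frechet_derivative f (at u) (axis i 1) * inverse (f u)))"
      by (simp add: partial_def)
  qed
qed

lemma C_on_divide:
  fixes f g :: "real^2 \<Rightarrow> real"
  assumes "open W" "C_on n W f" "C_on n W g" "\<And>u. u \<in> W \<Longrightarrow> g u \<noteq> 0"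
  shows "C_on n W (\<lambda>u. f u / g u)"
  unfolding divide_inverse by (intro C_on_mult C_on_inverse assms)

lemma C_on_vec:
  fixes f :: "real^2 \<Rightarrow> real^'m"
  assumes "open W" "\<And>i. C_on n W (\<lambda>u. f u $ i)"
  shows "C_on n W f"
proof -
  have "C_on n W (\<lambda>u. \<Sum>i\<in>UNIV. f u $ i *\<^sub>R axis i (1::real))"
    by (intro C_on_sum C_on_scaleR assms C_on_const finite)
  moreover have "(\<Sum>i\<in>UNIV. f u $ i *\<^sub>R axis i (1::real)) = f u" for u
    using basis_expansion[of "f u"] by (simp add: scalar_mult_eq_scaleR)
  ultimately show ?thesis by simp
qed

lemma has_derivative_compose_partial:
  fixes f :: "real^2 \<Rightarrow> 'b::real_normed_vector" and \<tau> :: "real^2 \<Rightarrow> real^2"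
  assumes "\<tau> differentiable (at u)" "f differentiable (at (\<tau> u))"
  shows "((\<lambda>v. f (\<tau> v)) has_derivative
     (\<lambda>h. \<Sum>j\<in>UNIV. frechet_derivative \<tau> (at u) h $ j *\<^sub>R partial j f (\<tau> u))) (at u)"
  using has_derivative_compose[OF iffD1[OF frechet_derivative_works assms(1)]
      has_derivative_partial[OF assms(2)]] .

lemma partial_compose:
  fixes f :: "real^2 \<Rightarrow> 'b::real_normed_vector" and \<tau> :: "real^2 \<Rightarrow> real^2"
  assumes "\<tau> differentiable (at u)" "f differentiable (at (\<tau> u))"
  shows "partial i (\<lambda>v. f (\<tau> v)) u = (\<Sum>j\<in>UNIV. partial i \<tau> u $ j *\<^sub>R partial j f (\<tau> u))"
  using partial_eq[OF has_derivative_compose_partial[OF assms]] by (simp add: partial_def)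

text \<open>By the chain rule a partial derivative of the composite is a sum of products of partial
  derivatives of \<open>\<tau>\<close> with functions \<open>partial j f\<close> composed with
  \<open>\<tau>\<close>; the induction keeps \<open>\<tau>\<close> fixed and varies \<open>f\<close>
  to cover these.\<close>

lemma C_on_compose:
  fixes f :: "real^2 \<Rightarrow> 'b::real_normed_vector" and \<tau> :: "real^2 \<Rightarrow> real^2"
  assumes "open W" "\<tau> ` W \<subseteq> V" "C_on n W \<tau>" "C_on n V f"
  shows "C_on n W (\<lambda>u. f (\<tau> u))"
  using assms(3,4)
proof (induction n arbitrary: f)
  case 0
  then show ?case using continuous_on_compose2[of V f W \<tau>] assms(2) by auto
next
  case (Suc n)
  show ?case
  proof (rule C_on_SucI[OF assms(1)])
    fix u assume "u \<in> W"
    then show "((\<lambda>v. f (\<tau> v)) has_derivative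
     (\<lambda>h. \<Sum>j\<in>UNIV. frechet_derivative \<tau> (at u) h $ j *\<^sub>R partial j f (\<tau> u))) (at u)"
      using Suc.prems assms(2) by (intro has_derivative_compose_partial) auto
  next
    fix i
    have "C_on n W (\<lambda>u. \<Sum>j\<in>UNIV. partial i \<tau> u $ j *\<^sub>R partial j f (\<tau> u))"
    proof (intro C_on_sum C_on_scaleR assms(1) finite)
      fix j
      show "C_on n W (\<lambda>u. partial i \<tau> u $ j)"
        using C_on_bounded_linear[OF assms(1) bounded_linear_vec_nth, of n "partial i \<tau>" j] Suc.prems
        by auto
      show "C_on n W (\<lambda>u. partial j f (\<tau> u))"
        by (intro Suc.IH) (use Suc.prems C_on_Suc_D in auto)
    qed
    then show "C_on n W (\<lambda>u. \<Sum>j\<in>UNIV. frechet_derivative \<tau> (at u) (axis i 1) $ j *\<^sub>R partial j f (\<tau> u))"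
      by (simp add: partial_def)
  qed
qed

section \<open>Symmetry of second partial derivatives\<close>

lemma DERIV_along_axis:
  fixes f :: "real^2 \<Rightarrow> real"
  assumes "f differentiable (at (u + t *\<^sub>R axis i 1))"
  shows "((\<lambda>t. f (u + t *\<^sub>R axis i 1)) has_real_derivative partial i f (u + t *\<^sub>R axis i 1)) (at t)"
proof -
  have "((\<lambda>t. u + t *\<^sub>R axis i 1) has_derivative (\<lambda>h. h *\<^sub>R axis i 1)) (at t)"
    by (auto intro!: derivative_eq_intros)
  from has_derivative_compose[OF this has_derivative_partial[OF assms]]
  have "((\<lambda>t. f (u + t *\<^sub>R axis i 1)) has_derivative
      (\<lambda>h. \<Sum>j\<in>UNIV. (h *\<^sub>R axis i 1) $ j *\<^sub>R partial j f (u + t *\<^sub>R axis i 1))) (at t)" .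
  moreover have "(\<Sum>j\<in>UNIV. (h *\<^sub>R axis i 1) $ j *\<^sub>R partial j f v) = partial i f v * h"
    for h v
  proof -
    have "(\<Sum>j\<in>UNIV. (h *\<^sub>R axis i 1) $ j *\<^sub>R partial j f v)
        = (\<Sum>j\<in>UNIV. if j = i then h * partial i f v else 0)"
      by (rule sum.cong) (auto simp: axis_def)
    then show ?thesis by simp
  qed
  ultimately show ?thesis by (simp add: has_field_derivative_def)
qed

text \<open>Two applications of the mean value theorem, first in direction \<open>i\<close> and then
  in direction \<open>j\<close>. The second difference over the square is symmetric in
  \<open>i\<close> and \<open>j\<close>, so the lemma evaluates one number by both mixed
  derivatives.\<close>

lemma second_difference:
  fixes f :: "real^2 \<Rightarrow> real"
  assumes "C_on 2 W f" "s > 0"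
    and W: "\<And>x y. 0 \<le> x \<Longrightarrow> x \<le> s \<Longrightarrow> 0 \<le> y \<Longrightarrow> y \<le> s \<Longrightarrow> u + x *\<^sub>R axis i 1 + y *\<^sub>R axis j 1 \<in> W"
  shows "\<exists>x y. 0 < x \<and> x < s \<and> 0 < y \<and> y < s \<and>
    f (u + s *\<^sub>R axis i 1 + s *\<^sub>R axis j 1) - f (u + s *\<^sub>R axis i 1) - f (u + s *\<^sub>R axis j 1) + f u
      = s\<^sup>2 * partial j (partial i f) (u + x *\<^sub>R axis i 1 + y *\<^sub>R axis j 1)"
proof -
  have d1: "f differentiable (at v)" and d2: "partial i f differentiable (at v)" if "v \<in> W" for v
    using assms(1) that by (auto simp: numeral_2_eq_2)
  define \<phi> where "\<phi> t = f ((u + s *\<^sub>R axis j 1) + t *\<^sub>R axis i 1) - f (u + t *\<^sub>R axis i 1)" for t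
  have "(\<phi> has_real_derivative partial i f ((u + s *\<^sub>R axis j 1) + t *\<^sub>R axis i 1)
      - partial i f (u + t *\<^sub>R axis i 1)) (at t)" if "0 \<le> t" "t \<le> s" for t
    unfolding \<phi>_def
    by (intro DERIV_diff DERIV_along_axis d1)
       (use W[of t s] W[of t 0] that in \<open>auto simp: algebra_simps\<close>)
  from MVT2[OF \<open>s > 0\<close> this] obtain x where x: "0 < x" "x < s"
    "\<phi> s - \<phi> 0 = s * (partial i f ((u + s *\<^sub>R axis j 1) + x *\<^sub>R axis i 1)
      - partial i f (u + x *\<^sub>R axis i 1))" by auto
  have "((\<lambda>t. partial i f ((u + x *\<^sub>R axis i 1) + t *\<^sub>R axis j 1)) has_real_derivative
     partial j (partial i f) ((u + x *\<^sub>R axis i 1) + t *\<^sub>R axis j 1)) (at t)" if "0 \<le> t" "t \<le> s" for t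
    by (intro DERIV_along_axis d2) (use W[of x t] that x in auto)
  from MVT2[OF \<open>s > 0\<close> this] obtain y where y: "0 < y" "y < s"
    "partial i f ((u + x *\<^sub>R axis i 1) + s *\<^sub>R axis j 1) - partial i f (u + x *\<^sub>R axis i 1)
      = s * partial j (partial i f) (u + x *\<^sub>R axis i 1 + y *\<^sub>R axis j 1)" by auto
  have "\<phi> s - \<phi> 0 = s\<^sup>2 * partial j (partial i f) (u + x *\<^sub>R axis i 1 + y *\<^sub>R axis j 1)"
    using x(3) y(3) by (simp add: power2_eq_square algebra_simps)
  moreover have "\<phi> s - \<phi> 0 = f (u + s *\<^sub>R axis i 1 + s *\<^sub>R axis j 1) - f (u + s *\<^sub>R axis i 1)
      - f (u + s *\<^sub>R axis j 1) + f u"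
    by (simp add: \<phi>_def algebra_simps)
  ultimately show ?thesis using x y by metis
qed

lemma partial_commute_real:
  fixes f :: "real^2 \<Rightarrow> real"
  assumes "C_on 2 W f" "open W" "u \<in> W"
  shows "partial i (partial j f) u = partial j (partial i f) u"
proof (rule ccontr)
  assume neq: "partial i (partial j f) u \<noteq> partial j (partial i f) u"
  \<comment> \<open>Half the gap: two numbers that lie within \<open>e\<close> of the respective
    sides cannot be equal.\<close>
  define e where "e = \<bar>partial i (partial j f) u - partial j (partial i f) u\<bar> / 2"
  have "e > 0" using neq by (simp add: e_def)
  have cont: "isCont (partial j (partial i f)) u" "isCont (partial i (partial j f)) u"
    using assms by (auto simp: numeral_2_eq_2 continuous_on_eq_continuous_at)
  obtain d1 where d1: "d1 > 0" "\<And>v. dist v u < d1 \<Longrightarrow> dist (partial j (partial i f) v) (partial j (partial i f) u) < e"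
    using cont(1) \<open>e > 0\<close> unfolding continuous_at_eps_delta by metis
  obtain d2 where d2: "d2 > 0" "\<And>v. dist v u < d2 \<Longrightarrow> dist (partial i (partial j f) v) (partial i (partial j f) u) < e"
    using cont(2) \<open>e > 0\<close> unfolding continuous_at_eps_delta by metis
  obtain d3 where d3: "d3 > 0" "ball u d3 \<subseteq> W"
    using assms open_contains_ball by blast
  define d where "d = min d1 (min d2 d3)"
  \<comment> \<open>The points of the square are at distance at most \<open>2 * s\<close> from
    \<open>u\<close>, hence inside the ball of radius \<open>d\<close>.\<close>
  define s where "s = d / 4"
  have d: "d > 0" "d \<le> d1" "d \<le> d2" "d \<le> d3" using d1 d2 d3 by (auto simp: d_def)
  then have "s > 0" by (simp add: s_def)
  have close: "dist (u + x *\<^sub>R axis k 1 + y *\<^sub>R axis l 1) u < d"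
    if "0 \<le> x" "x \<le> s" "0 \<le> y" "y \<le> s" for x y and k l :: 2
  proof -
    have "dist (u + x *\<^sub>R axis k 1 + y *\<^sub>R axis l 1) u = norm (x *\<^sub>R axis k 1 + y *\<^sub>R axis l (1::real))"
      by (simp add: dist_norm)
    also have "\<dots> \<le> norm (x *\<^sub>R axis k (1::real)) + norm (y *\<^sub>R axis l (1::real))"
      by (rule norm_triangle_ineq)
    also have "\<dots> \<le> s + s" using that by simp
    also have "\<dots> < d" using d by (simp add: s_def)
    finally show ?thesis .
  qed
  have inW: "u + x *\<^sub>R axis k 1 + y *\<^sub>R axis l 1 \<in> W"
    if "0 \<le> x" "x \<le> s" "0 \<le> y" "y \<le> s" for x y and k l :: 2
    using close[OF that, of k l] d3(2) d(4) by (auto simp: dist_commute subset_eq)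
  obtain x y where xy: "0 < x" "x < s" "0 < y" "y < s"
    "f (u + s *\<^sub>R axis i 1 + s *\<^sub>R axis j 1) - f (u + s *\<^sub>R axis i 1) - f (u + s *\<^sub>R axis j 1) + f u
      = s\<^sup>2 * partial j (partial i f) (u + x *\<^sub>R axis i 1 + y *\<^sub>R axis j 1)"
    using second_difference[OF assms(1) \<open>s > 0\<close>, of u i j] inW by blast
  obtain x' y' where xy': "0 < x'" "x' < s" "0 < y'" "y' < s"
    "f (u + s *\<^sub>R axis j 1 + s *\<^sub>R axis i 1) - f (u + s *\<^sub>R axis j 1) - f (u + s *\<^sub>R axis i 1) + f u
      = s\<^sup>2 * partial i (partial j f) (u + x' *\<^sub>R axis j 1 + y' *\<^sub>R axis i 1)"
    using second_difference[OF assms(1) \<open>s > 0\<close>, of u j i] inW by blast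
  have "s\<^sup>2 * partial j (partial i f) (u + x *\<^sub>R axis i 1 + y *\<^sub>R axis j 1)
      = s\<^sup>2 * partial i (partial j f) (u + x' *\<^sub>R axis j 1 + y' *\<^sub>R axis i 1)"
    unfolding xy(5)[symmetric] xy'(5)[symmetric] by (simp add: add_ac)
  then have "partial j (partial i f) (u + x *\<^sub>R axis i 1 + y *\<^sub>R axis j 1)
      = partial i (partial j f) (u + x' *\<^sub>R axis j 1 + y' *\<^sub>R axis i 1)"
    using \<open>s > 0\<close> by simp
  moreover have "dist (partial j (partial i f) (u + x *\<^sub>R axis i 1 + y *\<^sub>R axis j 1)) (partial j (partial i f) u) < e"
    using d1(2) close[of x y i j] xy d by auto
  moreover have "dist (partial i (partial j f) (u + x' *\<^sub>R axis j 1 + y' *\<^sub>R axis i 1)) (partial i (partial j f) u) < e"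
    using d2(2) close[of x' y' j i] xy' d by auto
  ultimately show False unfolding e_def dist_real_def by (auto simp: abs_if field_simps split: if_splits)
qed

lemma partial_bounded_linear:
  assumes "bounded_linear T" "f differentiable (at u)"
  shows "partial i (\<lambda>v. T (f v)) u = T (partial i f u)"
proof -
  have "(f has_derivative frechet_derivative f (at u)) (at u)"
    using assms(2) by (simp flip: frechet_derivative_works)
  from partial_eq[OF bounded_linear.has_derivative[OF assms(1) this]] show ?thesis
    by (simp add: partial_def)
qed

lemma partial_commute:
  fixes f :: "real^2 \<Rightarrow> real^'m"
  assumes "C_on 2 W f" "open W" "u \<in> W"
  shows "partial i (partial j f) u = partial j (partial i f) u"
proof -
  have "partial i (partial j f) u $ k = partial j (partial i f) u $ k" for k
  proof -
    have d: "f differentiable (at v)" "\<And>i. partial i f differentiable (at v)" if "v \<in> W" for v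
      using assms(1) that by (auto simp: numeral_2_eq_2)
    have 1: "partial i (partial j (\<lambda>v. f v $ k)) u = partial i (partial j f) u $ k" for i j
    proof -
      have "partial i (partial j (\<lambda>v. f v $ k)) u = partial i (\<lambda>v. partial j f v $ k) u"
        by (rule partial_cong[OF assms(2,3)])
           (rule partial_bounded_linear[OF bounded_linear_vec_nth d(1)])
      also have "\<dots> = partial i (partial j f) u $ k"
        by (rule partial_bounded_linear[OF bounded_linear_vec_nth d(2)[OF assms(3)]])
      finally show ?thesis .
    qed
    have "C_on 2 W (\<lambda>v. f v $ k)"
      by (rule C_on_bounded_linear[OF assms(2) bounded_linear_vec_nth assms(1)])
    from partial_commute_real[OF this assms(2,3)] show ?thesis unfolding 1 .
  qed
  then show ?thesis by (simp add: vec_eq_iff)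
qed

section \<open>Generalized trigonometric functions\<close>

text \<open>The solutions of \<open>f'' = - K f\<close> with \<open>(f 0, f' 0)\<close> equal to \<open>(1, 0)\<close> and \<open>(0, 1)\<close>.\<close>

definition cs :: "real \<Rightarrow> real \<Rightarrow> real" where
  "cs K t = (if K > 0 then cos (sqrt K * t) else if K = 0 then 1 else cosh (sqrt (-K) * t))"

definition sn :: "real \<Rightarrow> real \<Rightarrow> real" where
  "sn K t = (if K > 0 then sin (sqrt K * t) / sqrt K else if K = 0 then t
             else sinh (sqrt (-K) * t) / sqrt (-K))"

definition tn :: "real \<Rightarrow> real \<Rightarrow> real" where
  "tn K t = sn K t / cs K t"

definition arctn :: "real \<Rightarrow> real \<Rightarrow> real" where
  "arctn K u = (if K > 0 then arctan (sqrt K * u) / sqrt K else if K = 0 then u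
             else artanh (sqrt (-K) * u) / sqrt (-K))"

lemma sn_0 [simp]: "sn K 0 = 0" and cs_0 [simp]: "cs K 0 = 1"
  by (auto simp: sn_def cs_def)

lemma sn_minus [simp]: "sn K (- t) = - sn K t" and cs_minus [simp]: "cs K (- t) = cs K t"
  by (auto simp: sn_def cs_def)

lemma arctn_0 [simp]: "arctn K 0 = 0"
  by (simp add: arctn_def)

text \<open>With \<open>K\<close> equal to plus or minus \<open>k\<^sup>2\<close> the square roots
  disappear from the definitions, and each identity becomes one about ordinary, trivial or
  hyperbolic functions of \<open>k * t\<close>.\<close>

lemma K_cases:
  obtains (pos) k where "k > 0" "K = k\<^sup>2" | (zero) "K = (0::real)" | (neg) k where "k > 0" "K = - k\<^sup>2"
proof -
  consider "K > 0" | "K = 0" | "K < 0" by linarith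
  then show ?thesis
  proof cases
    case 1 then show ?thesis using pos[of "sqrt K"] by auto
  next
    case 2 then show ?thesis using zero by auto
  next
    case 3 then show ?thesis using neg[of "sqrt (-K)"] by auto
  qed
qed

lemma trig_pos:
  assumes "k > 0"
  shows "sn (k\<^sup>2) t = sin (k * t) / k" "cs (k\<^sup>2) t = cos (k * t)" "arctn (k\<^sup>2) t = arctan (k * t) / k"
  using assms by (auto simp: sn_def cs_def arctn_def)

lemma trig_zero: "sn 0 t = t" "cs 0 t = 1" "arctn 0 t = t"
  by (auto simp: sn_def cs_def arctn_def)

lemma trig_neg:
  assumes "k > 0"
  shows "sn (- k\<^sup>2) t = sinh (k * t) / k" "cs (- k\<^sup>2) t = cosh (k * t)" "arctn (- k\<^sup>2) t = artanh (k * t) / k"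
proof -
  have "\<not> - k\<^sup>2 > 0" "- k\<^sup>2 \<noteq> 0" "sqrt (- (- k\<^sup>2)) = k" using assms by auto
  then show "sn (- k\<^sup>2) t = sinh (k * t) / k" "cs (- k\<^sup>2) t = cosh (k * t)" "arctn (- k\<^sup>2) t = artanh (k * t) / k"
    by (auto simp: sn_def cs_def arctn_def)
qed

lemma DERIV_sn: "(sn K has_real_derivative cs K t) (at t)"
proof (cases K rule: K_cases)
  case (pos k)
  then show ?thesis unfolding pos trig_pos[OF pos(1), abs_def]
    by (auto intro!: derivative_eq_intros)
next
  case zero
  then show ?thesis unfolding zero trig_zero[abs_def] by (auto intro!: derivative_eq_intros)
next
  case (neg k)
  then show ?thesis unfolding neg trig_neg[OF neg(1), abs_def]
    by (auto intro!: derivative_eq_intros)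
qed

lemma DERIV_cs: "(cs K has_real_derivative - K * sn K t) (at t)"
proof (cases K rule: K_cases)
  case (pos k)
  then show ?thesis unfolding pos trig_pos[OF pos(1), abs_def]
    by (auto intro!: derivative_eq_intros simp: power2_eq_square)
next
  case zero
  then show ?thesis unfolding zero trig_zero[abs_def] by (auto intro!: derivative_eq_intros)
next
  case (neg k)
  then show ?thesis unfolding neg trig_neg[OF neg(1), abs_def]
    by (auto intro!: derivative_eq_intros simp: power2_eq_square)
qed

lemmas DERIV_sn_chain [derivative_intros] = DERIV_chain2[OF DERIV_sn]
lemmas DERIV_cs_chain [derivative_intros] = DERIV_chain2[OF DERIV_cs]

lemma continuous_on_sn [continuous_intros]:
  "continuous_on A f \<Longrightarrow> continuous_on A (\<lambda>x. sn K (f x))"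
  using continuous_on_compose2[of UNIV "sn K" A f] DERIV_sn
  by (meson DERIV_continuous_on UNIV_I has_field_derivative_at_within subset_UNIV)

lemma continuous_on_cs [continuous_intros]:
  "continuous_on A f \<Longrightarrow> continuous_on A (\<lambda>x. cs K (f x))"
  using continuous_on_compose2[of UNIV "cs K" A f] DERIV_cs
  by (meson DERIV_continuous_on UNIV_I has_field_derivative_at_within subset_UNIV)

lemma cs_sn_square: "(cs K t)\<^sup>2 + K * (sn K t)\<^sup>2 = 1"
  by (cases K rule: K_cases)
     (simp_all add: trig_pos trig_zero trig_neg power_divide cosh_square_eq)

lemma sn_add: "sn K (a + b) = sn K a * cs K b + cs K a * sn K b"
  by (cases K rule: K_cases)
     (simp_all add: trig_pos trig_zero trig_neg sin_add sinh_add distrib_left add_divide_distrib)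

lemma cs_add: "cs K (a + b) = cs K a * cs K b - K * sn K a * sn K b"
proof (cases K rule: K_cases)
  case (pos k)
  then show ?thesis unfolding pos(2) trig_pos[OF pos(1)]
    by (simp add: cos_add distrib_left power2_eq_square)
next
  case (neg k)
  then show ?thesis unfolding neg(2) trig_neg[OF neg(1)]
    by (simp add: cosh_add distrib_left power2_eq_square)
qed (simp add: trig_zero)

lemma sn_diff: "sn K (a - b) = sn K a * cs K b - cs K a * sn K b"
  using sn_add[of K a "-b"] by simp

lemma cs_diff: "cs K (a - b) = cs K a * cs K b + K * sn K a * sn K b"
  using cs_add[of K a "-b"] by simp

text \<open>The curve is an ellipse, a pair of lines or a hyperbola according to the sign of
  \<open>K\<close>; in the last two cases the condition \<open>c > 0\<close> selects the branch that
  \<open>(cs K, sn K)\<close> runs through.\<close>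

lemma cs_sn_surj:
  assumes "c\<^sup>2 + K * y\<^sup>2 = 1" "K \<le> 0 \<Longrightarrow> c > 0"
  obtains s where "cs K s = c" "sn K s = y"
proof (cases K rule: K_cases)
  case (pos k)
  have "c\<^sup>2 + (k * y)\<^sup>2 = 1" using assms pos by (simp add: power_mult_distrib)
  then obtain t where "c = cos t" "k * y = sin t" by (rule sincos_total_2pi)
  then show ?thesis using that[of "t / k"] pos by (simp add: trig_pos field_simps)
next
  case zero
  then show ?thesis using assms that[of y] by (auto simp: trig_zero power2_eq_1_iff)
next
  case (neg k)
  then have "c\<^sup>2 = (k * y)\<^sup>2 + 1" using assms by (simp add: power_mult_distrib)
  moreover have "c > 0" using assms neg by simp
  ultimately have "c = sqrt ((k * y)\<^sup>2 + 1)" by (metis abs_of_pos real_sqrt_abs)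
  then show ?thesis using that[of "arsinh (k * y) / k"] neg by (simp add: trig_neg cosh_arsinh_real)
qed

text \<open>For positive \<open>K\<close> the half-length \<open>L\<close> of the needle is less
  than a quarter of a great circle, which keeps \<open>cs K\<close> positive and \<open>tn K\<close>
  finite on \<open>{-L..L}\<close>.\<close>

definition small :: "real \<Rightarrow> real \<Rightarrow> bool" where
  "small K L \<longleftrightarrow> 0 < L \<and> (K > 0 \<longrightarrow> sqrt K * L < pi / 2)"

lemma small_pos:
  assumes "small (k\<^sup>2) L" "k > 0" "z \<le> L"
  shows "k * z < pi / 2"
proof -
  have "k * z \<le> k * L" using assms by (intro mult_left_mono) auto
  moreover have "k * L < pi / 2" using assms by (simp add: small_def)
  ultimately show ?thesis by linarith
qed

lemma cs_pos:
  assumes "small K L" "\<bar>z\<bar> \<le> L"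
  shows "cs K z > 0"
proof (cases K rule: K_cases)
  case (pos k)
  then have "\<bar>k * z\<bar> < pi / 2" using assms small_pos[of k L "\<bar>z\<bar>"] by (simp add: abs_mult)
  then show ?thesis using pos by (simp add: trig_pos cos_gt_zero_pi abs_less_iff)
qed (simp_all add: trig_zero trig_neg)

lemma sn_pos:
  assumes "small K L" "0 < z" "z \<le> L"
  shows "sn K z > 0"
proof (cases K rule: K_cases)
  case (pos k)
  then have "k * z < pi / 2" using assms small_pos[of k L z] by simp
  then have "k * z < pi" using pi_gt_zero by linarith
  then show ?thesis using pos assms by (simp add: trig_pos sin_gt_zero)
qed (use assms in \<open>simp_all add: trig_zero trig_neg\<close>)

text \<open>The difference of the two values is \<open>sn K (b - a) / (cs K a * cs K b)\<close>. The
  bound on \<open>b - a\<close> places the numerator in the range of \<open>sn_pos\<close>.\<close>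

lemma tn_strict_mono:
  assumes "small K L" "\<bar>a\<bar> \<le> L" "\<bar>b\<bar> \<le> L" "a < b" "b - a \<le> L"
  shows "tn K a < tn K b"
proof -
  have "cs K a > 0" "cs K b > 0" using assms cs_pos by auto
  moreover have "sn K (b - a) > 0" using sn_pos[OF assms(1)] assms by auto
  ultimately show ?thesis by (simp add: tn_def sn_diff field_simps)
qed

lemma arctn_tn:
  assumes "small K L" "\<bar>z\<bar> \<le> L"
  shows "arctn K (tn K z) = z"
proof (cases K rule: K_cases)
  case (pos k)
  then have "\<bar>k * z\<bar> < pi / 2" using assms small_pos[of k L "\<bar>z\<bar>"] by (simp add: abs_mult)
  moreover have "k * tn K z = tan (k * z)"
    using pos by (simp add: tn_def trig_pos tan_def)
  ultimately show ?thesis using pos by (simp add: trig_pos arctan_tan)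
next
  case (neg k)
  have "k * tn K z = tanh (k * z)"
    using neg by (simp add: tn_def trig_neg tanh_def)
  then show ?thesis using neg by (simp add: trig_neg artanh_tanh_real)
qed (simp add: tn_def trig_zero)

lemma DERIV_arctn:
  assumes "K * u\<^sup>2 > -1"
  shows "(arctn K has_real_derivative 1 / (1 + K * u\<^sup>2)) (at u)"
proof (cases K rule: K_cases)
  case (pos k)
  then show ?thesis unfolding pos trig_pos[OF pos(1), abs_def]
    by (auto intro!: derivative_eq_intros simp: divide_simps power_mult_distrib)
next
  case zero
  then show ?thesis unfolding zero trig_zero[abs_def] by (auto intro!: derivative_eq_intros)
next
  case (neg k)
  have "(k * u)\<^sup>2 < 1\<^sup>2" using assms neg by (simp add: power_mult_distrib)
  then have "\<bar>k * u\<bar> < 1" by (metis abs_le_square_iff abs_one not_less)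
  from artanh_real_has_field_derivative[OF this]
  have "(artanh has_real_derivative 1 / (1 - k\<^sup>2 * u\<^sup>2)) (at (k * u))"
    by (simp add: power_mult_distrib)
  from DERIV_chain2[where f=artanh and g="\<lambda>u. k * u" and x=u and s=UNIV, OF this DERIV_cmult_Id]
  have "((\<lambda>u. artanh (k * u)) has_real_derivative 1 / (1 - k\<^sup>2 * u\<^sup>2) * k) (at u)"
    by simp
  from DERIV_cdivide[OF this, of k] show ?thesis
    using neg(1) unfolding neg trig_neg[OF neg(1), abs_def] by simp
qed

text \<open>Since \<open>1 + K * (tn K z)\<^sup>2\<close> is the inverse square of
  \<open>cs K z\<close>. For negative \<open>K\<close> this keeps the argument of
  \<open>artanh\<close> inside its domain.\<close>

lemma tn_bound:
  assumes "small K L" "\<bar>z\<bar> \<le> L"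
  shows "K * (tn K z)\<^sup>2 > -1"
proof -
  have c: "cs K z > 0" using cs_pos assms by auto
  have "K * (tn K z)\<^sup>2 = 1 / (cs K z)\<^sup>2 - 1"
    using cs_sn_square[of K z] c by (simp add: tn_def power_divide field_simps)
  then show ?thesis using c by simp
qed

text \<open>The remainder vanishes at 0 and has the derivative
  \<open>K\<^sup>2 * x^4 / (1 + K * x\<^sup>2)\<close>, so a single mean value theorem gives sign
  and size. The factor 2 comes from \<open>1 + K * x\<^sup>2 \<ge> 1 / 2\<close>.\<close>

lemma arctn_remainder:
  assumes "0 \<le> u" "\<bar>K\<bar> * u\<^sup>2 \<le> 1 / 2"
  shows "0 \<le> arctn K u - u + K * u^3 / 3" "arctn K u - u + K * u^3 / 3 \<le> 2 * K\<^sup>2 * u^5"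
proof -
  have "0 \<le> arctn K u - u + K * u^3 / 3 \<and> arctn K u - u + K * u^3 / 3 \<le> 2 * K\<^sup>2 * u^5"
  proof (cases "u = 0")
    case True
    then show ?thesis by (simp add: arctn_def)
  next
    case False
    have half: "\<bar>K * x\<^sup>2\<bar> \<le> 1 / 2" if "0 \<le> x" "x \<le> u" for x
    proof -
      have "x\<^sup>2 \<le> u\<^sup>2" using that by (simp add: power_mono)
      then have "\<bar>K\<bar> * x\<^sup>2 \<le> \<bar>K\<bar> * u\<^sup>2" by (simp add: mult_left_mono)
      then show ?thesis using assms by (simp add: abs_mult)
    qed
    have "((\<lambda>u. arctn K u - u + K * u^3 / 3) has_real_derivative K\<^sup>2 * x^4 / (1 + K * x\<^sup>2)) (at x)"
      if "0 \<le> x" "x \<le> u" for x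
    proof -
      have "1 + K * x\<^sup>2 > 0" using half[OF that] by linarith
      then have "1 / (1 + K * x\<^sup>2) - 1 + K * x\<^sup>2 = K\<^sup>2 * x^4 / (1 + K * x\<^sup>2)"
        by (simp add: field_simps power2_eq_square power4_eq_xxxx)
      moreover have "((\<lambda>u. arctn K u - u + K * u^3 / 3) has_real_derivative 1 / (1 + K * x\<^sup>2) - 1 + K * x\<^sup>2) (at x)"
        using \<open>1 + K * x\<^sup>2 > 0\<close> by (auto intro!: derivative_eq_intros DERIV_arctn simp: power2_eq_square)
      ultimately show ?thesis by simp
    qed
    then have "\<exists>x>0. x < u \<and> (arctn K u - u + K * u^3 / 3) - (arctn K 0 - 0 + K * 0^3 / 3)
        = (u - 0) * (K\<^sup>2 * x^4 / (1 + K * x\<^sup>2))"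
      using False assms(1) by (intro MVT2) auto
    then obtain x where x: "0 < x" "x < u"
      "arctn K u - u + K * u^3 / 3 = u * (K\<^sup>2 * x^4 / (1 + K * x\<^sup>2))"
      by auto
    have *: "1 + K * x\<^sup>2 \<ge> 1 / 2" using half[of x] x by linarith
    have "K\<^sup>2 * x^4 / (1 + K * x\<^sup>2) \<le> K\<^sup>2 * x^4 / (1 / 2)"
      using * by (intro divide_left_mono) auto
    also have "\<dots> = 2 * K\<^sup>2 * x^4" by simp
    also have "\<dots> \<le> 2 * K\<^sup>2 * u^4" using x by (intro mult_left_mono power_mono) auto
    finally have "u * (K\<^sup>2 * x^4 / (1 + K * x\<^sup>2)) \<le> u * (2 * K\<^sup>2 * u^4)"
      using assms by (intro mult_left_mono) auto
    moreover have "u * (2 * K\<^sup>2 * u^4) = 2 * K\<^sup>2 * u^5" by (simp add: power_numeral_reduce)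
    moreover have "0 \<le> u * (K\<^sup>2 * x^4 / (1 + K * x\<^sup>2))" using assms * by simp
    ultimately show ?thesis unfolding x(3) by linarith
  qed
  then show "0 \<le> arctn K u - u + K * u^3 / 3" "arctn K u - u + K * u^3 / 3 \<le> 2 * K\<^sup>2 * u^5"
    by auto
qed

text \<open>The inequality \<open>le\<close> says that \<open>2 * m * L - z\<close> is within
  \<open>L\<close> of a zero of \<open>sn K\<close>. For \<open>K \<le> 0\<close> the only zero is
  0, which forces \<open>m = 0\<close>. For \<open>K > 0\<close> the zeros are the multiples of
  \<open>2 * n * L\<close>, which forces \<open>n\<close> to divide \<open>m\<close>. In geometric
  terms a grating line reached by the needle is the one through the nearest grating point.\<close>

lemma sn_multiple_eq_0:
  fixes m :: int
  assumes adm: "K > 0 \<Longrightarrow> \<exists>n::nat. n > 1 \<and> 2 * real n * sqrt K * L = pi"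
    and "L > 0" "\<bar>z\<bar> < L"
    and le: "\<bar>sn K (2 * of_int m * L - z)\<bar> * cs K L \<le> sn K L * \<bar>cs K (2 * of_int m * L - z)\<bar>"
  shows "sn K (2 * of_int m * L) = 0"
proof (cases "K > 0")
  case False
  define y where "y = 2 * of_int m * L - z"
  define d where "d = \<bar>y\<bar>"
  have small: "small K t" if "t > 0" for t using False that by (simp add: small_def)
  have sgn: "0 \<le> sn K t" if "0 \<le> t" for t
    using sn_pos[OF small[of t], of t] that by (cases "t = 0") auto
  have cpos: "0 < cs K t" for t using cs_pos[OF small[of "\<bar>t\<bar> + 1"], of t] by auto
  have 1: "\<bar>sn K y\<bar> = sn K d" "\<bar>cs K y\<bar> = cs K d"
    using sgn[of y] sgn[of "-y"] cpos[of y] by (auto simp: d_def abs_if)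
  \<comment> \<open>Cross-multiplied, \<open>le\<close> is exactly the addition theorem for
    \<open>sn K (d - L)\<close>, whose sign is that of \<open>d - L\<close>.\<close>
  have "sn K (d - L) \<le> 0" using le unfolding y_def[symmetric] 1 by (simp add: sn_diff mult.commute)
  then have "d \<le> L" using sn_pos[OF small[of "d - L"], of "d - L"] by fastforce
  then have "\<bar>of_int m * (2 * L)\<bar> < 2 * L" using \<open>\<bar>z\<bar> < L\<close> by (auto simp: d_def y_def)
  then have "\<bar>real_of_int m\<bar> < 1" using \<open>L > 0\<close> by (simp add: abs_mult)
  then have "m = 0" by linarith
  then show ?thesis by simp
next
  case True
  then obtain n :: nat where n: "n > 1" "2 * real n * sqrt K * L = pi" using adm by auto
  define k where "k = sqrt K"
  have k: "k > 0" "K = k\<^sup>2" using True by (auto simp: k_def)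
  have kL: "k * L = pi / (2 * n)" using n by (simp add: k_def field_simps)
  define y where "y = k * (2 * of_int m * L - z)"
  have "pi / (2 * n) \<le> pi / 2" using n by (intro divide_left_mono) auto
  then have kL2: "0 < k * L" "k * L \<le> pi / 2"
    unfolding kL[symmetric] using k \<open>L > 0\<close> by auto
  have c0: "cos (k * L) \<ge> 0" using kL2 by (intro cos_ge_zero) auto
  have s0: "sin (k * L) > 0" using kL2 pi_gt_zero by (intro sin_gt_zero) auto
  have "\<bar>sin y\<bar> * cos (k * L) \<le> sin (k * L) * \<bar>cos y\<bar>"
    using le k unfolding k(2) trig_pos[OF k(1)] y_def by (simp add: field_simps)
  then have "(\<bar>sin y\<bar> * cos (k * L))\<^sup>2 \<le> (sin (k * L) * \<bar>cos y\<bar>)\<^sup>2"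
    using c0 by (intro power_mono) auto
  then have "(sin y)\<^sup>2 * (1 - (sin (k * L))\<^sup>2) \<le> (sin (k * L))\<^sup>2 * (1 - (sin y)\<^sup>2)"
    by (simp add: power_mult_distrib cos_squared_eq)
  then have "(sin y)\<^sup>2 \<le> (sin (k * L))\<^sup>2" by (simp add: algebra_simps)
  then have sl: "\<bar>sin y\<bar> \<le> sin (k * L)" using s0 by (metis abs_le_square_iff abs_of_pos)
  \<comment> \<open>The nearest zero of the sine: the remaining distance is at most
    \<open>pi / 2\<close>, where the sine is increasing and can be compared with its value at
    \<open>k * L\<close>.\<close>
  define j where "j = round (y / pi)"
  have "\<bar>of_int j - y / pi\<bar> \<le> 1 / 2" unfolding j_def by (rule of_int_round_abs_le)
  then have "\<bar>of_int j - y / pi\<bar> * pi \<le> 1 / 2 * pi" by (intro mult_right_mono) auto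
  moreover have "\<bar>of_int j - y / pi\<bar> * pi = \<bar>y - of_int j * pi\<bar>"
    by (subst abs_of_pos[OF pi_gt_zero, symmetric], subst abs_mult[symmetric])
       (simp add: algebra_simps abs_minus_commute)
  ultimately have yj: "\<bar>y - of_int j * pi\<bar> \<le> pi / 2" by simp
  have "\<bar>sin y\<bar> = \<bar>sin (y - of_int j * pi)\<bar>"
    by (simp add: sin_diff abs_mult mult.commute[of _ pi] sin_npi_int cos_npi_int)
  also have "\<dots> = sin \<bar>y - of_int j * pi\<bar>"
  proof -
    have "\<bar>sin t\<bar> = sin \<bar>t\<bar>" if "\<bar>t\<bar> \<le> pi / 2" for t
      using that sin_ge_zero[of "\<bar>t\<bar>"] by (auto simp: abs_if split: if_splits)
    then show ?thesis using yj .
  qed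
  finally have "sin \<bar>y - of_int j * pi\<bar> \<le> sin (k * L)" using sl by simp
  then have le2: "\<bar>y - of_int j * pi\<bar> \<le> k * L"
    using sin_mono_le_eq[of "\<bar>y - of_int j * pi\<bar>" "k * L"] yj kL2 by auto
  have "\<bar>k * z\<bar> < k * L" using k \<open>\<bar>z\<bar> < L\<close> by (simp add: abs_mult)
  moreover have "y = of_int m * (2 * (k * L)) - k * z" by (simp add: y_def algebra_simps)
  ultimately have "\<bar>of_int m * (2 * (k * L)) - of_int j * pi\<bar> < 2 * (k * L)" using le2 by linarith
  moreover have "pi = n * (2 * (k * L))" using n by (simp add: k_def)
  moreover have "(of_int m - of_int j * n) * (2 * (k * L)) = of_int m * (2 * (k * L)) - of_int j * (n * (2 * (k * L)))"
    by (simp add: algebra_simps)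
  ultimately have "\<bar>(of_int m - of_int j * n) * (2 * (k * L))\<bar> < 2 * (k * L)"
    by simp
  then have "\<bar>real_of_int m - of_int j * n\<bar> < 1" using k \<open>L > 0\<close> by (simp add: abs_mult)
  then have "\<bar>real_of_int (m - j * int n)\<bar> < 1" by simp
  then have "m = j * int n" by linarith
  then have "k * (2 * of_int m * L) = pi * of_int j"
    using \<open>pi = n * (2 * (k * L))\<close> by (simp add: algebra_simps)
  then show ?thesis unfolding k(2) trig_pos[OF k(1)] by (simp add: sin_npi_int)
qed

section \<open>The integral of the conditional probability\<close>

lemma integral_cos: "((\<lambda>x. cos x) has_integral 1) {0..pi/2}"
  using fundamental_theorem_of_calculus[of 0 "pi/2" sin cos]
  by (simp add: has_field_derivative_at_within flip: has_real_derivative_iff_has_vector_derivative)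

lemma integral_cos_cube: "((\<lambda>x. (cos x)^3) has_integral (2/3)) {0..pi/2}"
proof -
  have "((\<lambda>x. sin x - (sin x)^3 / 3) has_real_derivative (cos x)^3) (at x within {0..pi/2})" for x
  proof -
    have "cos x - (sin x)\<^sup>2 * cos x = (cos x)^3"
      unfolding sin_squared_eq by (simp add: power3_eq_cube power2_eq_square algebra_simps)
    then show ?thesis by (auto intro!: derivative_eq_intros simp: mult.commute)
  qed
  then have "((\<lambda>x. (cos x)^3) has_integral ((sin (pi/2) - (sin (pi/2))^3 / 3) - (sin 0 - (sin 0)^3 / 3))) {0..pi/2}"
    by (intro fundamental_theorem_of_calculus) (auto simp flip: has_real_derivative_iff_has_vector_derivative)
  then show ?thesis by simp
qed

definition angle_integral :: "real \<Rightarrow> real \<Rightarrow> real" where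
  "angle_integral K L = integral {0..pi/2} (\<lambda>\<theta>. arctn K (tn K L * cos \<theta>))"

lemma continuous_arctn_cos:
  assumes "small K L"
  shows "continuous_on {0..pi/2} (\<lambda>\<theta>. arctn K (tn K L * cos \<theta>))"
proof -
  have "isCont (arctn K) (tn K L * c)" if "0 \<le> c" "c \<le> 1" for c
  proof -
    have "K * (tn K L * c)\<^sup>2 > -1"
    proof (cases "K \<ge> 0")
      case True
      then have "K * (tn K L * c)\<^sup>2 \<ge> 0" by simp
      then show ?thesis by linarith
    next
      case False
      have "c\<^sup>2 \<le> 1" using that by (simp add: power_le_one)
      then have "(tn K L)\<^sup>2 * c\<^sup>2 \<le> (tn K L)\<^sup>2 * 1" by (intro mult_left_mono) auto
      then have "K * ((tn K L)\<^sup>2 * 1) \<le> K * ((tn K L)\<^sup>2 * c\<^sup>2)"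
        by (rule mult_left_mono_neg) (use False in simp)
      then show ?thesis using tn_bound[OF assms, of L] assms by (simp add: power_mult_distrib small_def)
    qed
    from DERIV_arctn[OF this] show ?thesis by (rule DERIV_isCont)
  qed
  moreover have "0 \<le> cos \<theta>" if "\<theta> \<in> {0..pi/2}" for \<theta>
    using that pi_ge_zero by (intro cos_ge_zero) (auto intro: order_trans[of _ 0])
  ultimately have "continuous_on ((\<lambda>\<theta>. tn K L * cos \<theta>) ` {0..pi/2}) (arctn K)"
    by (intro continuous_at_imp_continuous_on) auto
  from continuous_on_compose2[OF this, of "{0..pi/2}" "\<lambda>\<theta>. tn K L * cos \<theta>"]
  show ?thesis by (simp add: continuous_intros)
qed

text \<open>Since \<open>cos\<close> has integral 1 and \<open>L = arctn K y\<close>, the linear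
  term is removed by subtracting \<open>cos \<theta> * L\<close> rather than
  \<open>cos \<theta> * y\<close>. What is left are the cubic terms of two expansions, with the
  coefficient \<open>K / 3 * y^3\<close> of \<open>cos \<theta> - (cos \<theta>)^3\<close>, and the
  difference of two remainders. Both remainders lie between 0 and
  \<open>2 * K\<^sup>2 * y^5\<close>, so the difference obeys the same bound; the length
  \<open>pi / 2\<close> of the interval turns 2 into \<open>pi\<close>.\<close>

lemma angle_integral_estimate:
  assumes "small K L" "\<bar>K\<bar> * (tn K L)\<^sup>2 \<le> 1 / 2"
  shows "\<bar>angle_integral K L - L - K / 9 * (tn K L)^3\<bar> \<le> pi * K\<^sup>2 * (tn K L)^5"
proof -
  define y where "y = tn K L"
  have y0: "y > 0" using assms(1) sn_pos[of K L L] cs_pos[of K L L] by (simp add: y_def tn_def small_def)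
  have Ly: "arctn K y = L" using arctn_tn[OF assms(1), of L] assms(1) by (simp add: y_def small_def)
  let ?g = "\<lambda>\<theta>. arctn K (y * cos \<theta>) - cos \<theta> * L - K / 3 * y^3 * (cos \<theta> - (cos \<theta>)^3)"
  have int: "(?g has_integral (angle_integral K L - 1 * L - K / 3 * y^3 * (1 - 2/3))) {0..pi/2}"
    unfolding angle_integral_def
    by (intro has_integral_diff has_integral_mult_right has_integral_mult_left integral_cos integral_cos_cube)
       (use integrable_continuous_interval[OF continuous_arctn_cos[OF assms(1)]] in
         \<open>auto simp: y_def intro: integrable_integral\<close>)
  have bound: "\<bar>?g \<theta>\<bar> \<le> 2 * K\<^sup>2 * y^5" if "\<theta> \<in> {0..pi/2}" for \<theta>
  proof -
    define c where "c = cos \<theta>"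
    have c: "0 \<le> c" "c \<le> 1" using that by (auto simp: c_def intro: cos_ge_zero)
    define R where "R u = arctn K u - u + K * u^3 / 3" for u
    have yc: "y * c \<le> y" "0 \<le> y * c" using y0 c by (auto simp: mult_le_cancel_left2)
    then have "(y * c)\<^sup>2 \<le> y\<^sup>2" by (intro power_mono) auto
    then have "\<bar>K\<bar> * (y * c)\<^sup>2 \<le> \<bar>K\<bar> * y\<^sup>2" by (intro mult_left_mono) auto
    then have "\<bar>K\<bar> * (y * c)\<^sup>2 \<le> 1 / 2" using assms(2) by (simp add: y_def)
    from arctn_remainder[OF yc(2) this] have R1: "0 \<le> R (y * c)" "R (y * c) \<le> 2 * K\<^sup>2 * (y * c)^5"
      by (auto simp: R_def)
    have "(y * c)^5 \<le> y^5" using yc by (intro power_mono) auto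
    then have "2 * K\<^sup>2 * (y * c)^5 \<le> 2 * K\<^sup>2 * y^5" by (intro mult_left_mono) auto
    then have R1': "R (y * c) \<le> 2 * K\<^sup>2 * y^5" using R1 by linarith
    have R2: "0 \<le> R y" "R y \<le> 2 * K\<^sup>2 * y^5"
      using arctn_remainder[of y K] y0 assms(2) by (auto simp: R_def y_def)
    then have R3: "0 \<le> c * R y" "c * R y \<le> 2 * K\<^sup>2 * y^5"
      using c mult_left_le_one_le[of "R y" c] by auto
    have "?g \<theta> = R (y * c) - c * R y"
      unfolding R_def Ly c_def[symmetric] by (simp add: field_simps power_mult_distrib power3_eq_cube)
    then show ?thesis using R1(1) R1' R3 by linarith
  qed
  have "norm (angle_integral K L - 1 * L - K / 3 * y^3 * (1 - 2/3)) \<le> (2 * K\<^sup>2 * y^5) * Henstock_Kurzweil_Integration.content (cbox 0 (pi/2))"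
    using int bound y0 by (intro has_integral_bound[of _ ?g]) auto
  then show ?thesis by (simp add: y_def algebra_simps)
qed

lemma tn_ratio_tendsto: "((\<lambda>L. tn K L / L) \<longlongrightarrow> 1) (at_right 0)"
proof -
  have "((\<lambda>L. sn K L / L) \<longlongrightarrow> 1) (at 0)"
    using DERIV_sn[of K 0] by (simp add: DERIV_def)
  moreover have "(cs K \<longlongrightarrow> 1) (at 0)"
    using DERIV_isCont[OF DERIV_cs[of K 0]] by (simp add: isCont_def)
  ultimately have "((\<lambda>L. sn K L / L / cs K L) \<longlongrightarrow> 1 / 1) (at 0)"
    by (intro tendsto_divide) auto
  then have "((\<lambda>L. tn K L / L) \<longlongrightarrow> 1) (at 0)"
    by (simp add: tn_def divide_divide_eq_left mult.commute)
  then show ?thesis by (rule tendsto_mono[rotated]) (simp add: at_le)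
qed

lemma eventually_small: "eventually (\<lambda>L. small K L) (at_right 0)"
proof -
  have "((\<lambda>L. sqrt K * L) \<longlongrightarrow> sqrt K * 0) (at_right 0)" by (intro tendsto_intros)
  then have "eventually (\<lambda>L. sqrt K * L < pi / 2) (at_right 0)"
    by (rule order_tendstoD) (simp add: pi_gt_zero)
  then show ?thesis using eventually_at_right_less[of 0]
    by eventually_elim (auto simp: small_def)
qed

lemma angle_integral_limit:
  "((\<lambda>L. 9 * pi / 2 * ((2 / (pi * L) * angle_integral K L - 2 / pi) / L\<^sup>2)) \<longlongrightarrow> K) (at_right 0)"
proof -
  let ?y = "\<lambda>L. tn K L"
  have id: "((\<lambda>L::real. L) \<longlongrightarrow> 0) (at_right 0)" by (rule tendsto_ident_at)
  have "((\<lambda>L. \<bar>K\<bar> * (tn K L / L * L)\<^sup>2) \<longlongrightarrow> \<bar>K\<bar> * (1 * 0)\<^sup>2) (at_right 0)"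
    by (intro tendsto_intros tn_ratio_tendsto id)
  then have "eventually (\<lambda>L. \<bar>K\<bar> * (tn K L / L * L)\<^sup>2 < 1/2) (at_right 0)"
    by (rule order_tendstoD) simp
  then have est: "eventually (\<lambda>L. \<bar>9 * pi / 2 * ((2 / (pi * L) * angle_integral K L - 2 / pi) / L\<^sup>2)
      - K * (tn K L / L)^3\<bar> \<le> 9 * pi * K\<^sup>2 * (tn K L / L)^5 * L\<^sup>2) (at_right 0)"
    using eventually_small[of K] eventually_at_right_less[of 0]
  proof eventually_elim
    case (elim L)
    then have "\<bar>angle_integral K L - L - K / 9 * (tn K L)^3\<bar> \<le> pi * K\<^sup>2 * (tn K L)^5"
      by (intro angle_integral_estimate) auto
    \<comment> \<open>The factor \<open>9 / L^3\<close> is \<open>9 * pi / 2\<close> times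
      \<open>2 / (pi * L)\<close>, divided by \<open>L\<^sup>2\<close>.\<close>
    then have "9 / L^3 * \<bar>angle_integral K L - L - K / 9 * (tn K L)^3\<bar>
        \<le> 9 / L^3 * (pi * K\<^sup>2 * (tn K L)^5)"
      using elim by (intro mult_left_mono) auto
    moreover have "9 / L^3 * \<bar>angle_integral K L - L - K / 9 * (tn K L)^3\<bar>
      = \<bar>9 / L^3 * (angle_integral K L - L - K / 9 * (tn K L)^3)\<bar>"
    proof -
      have "0 \<le> 9 / L^3" using elim by simp
      from abs_of_nonneg[OF this] show ?thesis unfolding abs_mult by simp
    qed
    moreover have "9 / L^3 * (angle_integral K L - L - K / 9 * (tn K L)^3)
      = 9 * pi / 2 * ((2 / (pi * L) * angle_integral K L - 2 / pi) / L\<^sup>2) - K * (tn K L / L)^3"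
      using elim by (simp add: field_simps power_numeral_reduce)
    moreover have "9 / L^3 * (pi * K\<^sup>2 * (tn K L)^5) = 9 * pi * K\<^sup>2 * (tn K L / L)^5 * L\<^sup>2"
      using elim by (simp add: field_simps power_numeral_reduce)
    ultimately show ?case by (simp only:)
  qed
  have lim: "((\<lambda>L. 9 * pi * K\<^sup>2 * (tn K L / L)^5 * L\<^sup>2) \<longlongrightarrow> 9 * pi * K\<^sup>2 * 1^5 * 0\<^sup>2) (at_right 0)"
    by (intro tendsto_intros tn_ratio_tendsto id)
  have "((\<lambda>L. 9 * pi / 2 * ((2 / (pi * L) * angle_integral K L - 2 / pi) / L\<^sup>2)
      - K * (tn K L / L)^3) \<longlongrightarrow> 0) (at_right 0)"
    by (rule Lim_null_comparison[OF est[folded real_norm_def]]) (use lim in simp)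
  moreover have "((\<lambda>L. K * (tn K L / L)^3) \<longlongrightarrow> K * 1^3) (at_right 0)"
    by (intro tendsto_intros tn_ratio_tendsto)
  ultimately show ?thesis using tendsto_add by fastforce
qed

section \<open>Measures of angular bands and the exchange of integrations\<close>

lemma measure_affine_vimage:
  assumes "S \<in> sets borel" "c \<noteq> (0::real)"
  shows "measure lborel S = \<bar>c\<bar> * measure lborel {x. t + c * x \<in> S}"
proof -
  have [measurable]: "S \<in> sets borel" by fact
  have "(\<integral>\<^sup>+x. indicator S (t + c * x) \<partial>lborel) = (\<integral>\<^sup>+x. indicator {x. t + c * x \<in> S} x \<partial>lborel)"
    by (intro nn_integral_cong) (auto simp: indicator_def)
  also have "\<dots> = emeasure lborel {x. t + c * x \<in> S}"
    by (intro nn_integral_indicator) measurable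
  finally have "emeasure lborel S = \<bar>c\<bar> * emeasure lborel {x. t + c * x \<in> S}"
    using nn_integral_real_affine[of "indicator S" c t] assms by simp
  then show ?thesis by (simp add: measure_def enn2real_mult)
qed

text \<open>The window is moved so that it starts at some \<open>r\<close> between 0 and
  \<open>p\<close>; its part beyond \<open>p\<close> is then moved back by one period and fills the
  gap below \<open>r\<close>.\<close>

lemma measure_periodic:
  fixes p x :: real
  assumes E: "E \<in> sets borel" "\<And>y. y + p \<in> E \<longleftrightarrow> y \<in> E" and "p > 0"
  shows "measure lborel (E \<inter> {x..<x+p}) = measure lborel (E \<inter> {0..<p})"
proof -
  have [measurable]: "E \<in> sets borel" by fact
  have step: "y + real n * p \<in> E \<longleftrightarrow> y \<in> E" for y n
  proof (induction n)
    case (Suc n)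
    have "y + real (Suc n) * p = (y + real n * p) + p" by (simp add: algebra_simps)
    then show ?case using E(2) Suc by metis
  qed simp
  have per: "y + of_int k * p \<in> E \<longleftrightarrow> y \<in> E" for y and k :: int
  proof (cases "k \<ge> 0")
    case True
    then show ?thesis using step[of y "nat k"] by simp
  next
    case False
    then show ?thesis using step[of "y + of_int k * p" "nat (-k)"] by (simp add: algebra_simps)
  qed
  have shift: "measure lborel (E \<inter> {a + of_int k * p..<b + of_int k * p}) = measure lborel (E \<inter> {a..<b})"
    for a b and k :: int
  proof -
    have "{y. of_int k * p + 1 * y \<in> E \<inter> {a + of_int k * p..<b + of_int k * p}} = E \<inter> {a..<b}"
      using per[of _ k] by (auto simp: add.commute)
    then show ?thesis
      using measure_affine_vimage[of "E \<inter> {a + of_int k * p..<b + of_int k * p}" 1 "of_int k * p"] E(1)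
      by simp
  qed
  have split: "measure lborel (E \<inter> {a..<c}) = measure lborel (E \<inter> {a..<b}) + measure lborel (E \<inter> {b..<c})"
    if "a \<le> b" "b \<le> c" for a b c
  proof -
    have "E \<inter> {a..<c} = (E \<inter> {a..<b}) \<union> (E \<inter> {b..<c})" using that by auto
    moreover have "emeasure lborel (E \<inter> {u..<v}) \<noteq> \<infinity>" for u v
      using emeasure_bounded_finite[of "E \<inter> {u..<v}"] bounded_subset[OF bounded_Ico] 
      by (metis inf_le2 infinity_ennreal_def order_less_irrefl)
    ultimately show ?thesis by (subst measure_Union[symmetric]) auto
  qed
  define k where "k = \<lfloor>x / p\<rfloor>"
  define r where "r = x - of_int k * p"
  have r: "0 \<le> r" "r \<le> p"
    using \<open>p > 0\<close> floor_divide_lower[of p x] floor_divide_upper[of p x] by (auto simp: r_def k_def algebra_simps)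
  have "measure lborel (E \<inter> {x..<x+p}) = measure lborel (E \<inter> {r..<r+p})"
    using shift[of r k "r + p"] by (simp add: r_def algebra_simps)
  also have "\<dots> = measure lborel (E \<inter> {r..<p}) + measure lborel (E \<inter> {p..<r+p})"
    by (rule split) (use r in auto)
  also have "measure lborel (E \<inter> {p..<r+p}) = measure lborel (E \<inter> {0..<r})"
    using shift[of 0 1 r] by simp
  also have "measure lborel (E \<inter> {r..<p}) + measure lborel (E \<inter> {0..<r}) = measure lborel (E \<inter> {0..<p})"
    using split[of 0 r p] r by simp
  finally show ?thesis .
qed

lemma abs_cos_ge_iff:
  assumes "0 \<le> \<tau>" "\<tau> \<le> 1" "\<bar>y\<bar> \<le> pi / 2"
  shows "\<tau> \<le> \<bar>cos y\<bar> \<longleftrightarrow> \<bar>y\<bar> \<le> arccos \<tau>"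
proof -
  have "cos y \<ge> 0" using assms by (intro cos_ge_zero) auto
  then have "\<bar>cos y\<bar> = cos \<bar>y\<bar>" by simp
  moreover have "cos (arccos \<tau>) = \<tau>" using assms by simp
  moreover have "cos (arccos \<tau>) \<le> cos \<bar>y\<bar> \<longleftrightarrow> \<bar>y\<bar> \<le> arccos \<tau>"
    using assms arccos_bounded[of \<tau>] pi_ge_zero by (intro cos_mono_le_eq) auto
  ultimately show ?thesis by simp
qed

text \<open>While \<open>s\<close> runs through \<open>{0..<l}\<close> the angle goes round the
  circle once, in the direction given by the sign of \<open>h\<close>. The function
  \<open>\<bar>cos\<bar>\<close> has period \<open>pi\<close>, so the band occurs twice, each time
  with angular width \<open>2 * arccos \<tau>\<close>; dividing by
  \<open>\<bar>h\<bar> = 2 * pi / l\<close> converts angle to length. A negative \<open>h\<close> is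
  reduced to a positive one because cosine is even.\<close>

lemma measure_cos_band:
  assumes \<tau>: "0 \<le> \<tau>" "\<tau> \<le> 1" and h: "\<bar>h\<bar> * l = 2 * pi"
  shows "measure lborel {s \<in> {0..<l}. \<tau> \<le> \<bar>cos (\<theta> + h * s)\<bar>} = 2 * arccos \<tau> / pi * l"
proof -
  define E where "E = {y. \<tau> \<le> \<bar>cos y\<bar>}"
  have "closed E" unfolding E_def by (intro closed_Collect_le continuous_intros)
  then have [measurable]: "E \<in> sets borel" by (rule borel_closed)
  have per: "y + pi \<in> E \<longleftrightarrow> y \<in> E" for y by (simp add: E_def)
  define \<beta> where "\<beta> = arccos \<tau>"
  have \<beta>: "0 \<le> \<beta>" "\<beta> \<le> pi / 2" using \<tau> arccos_lbound[of \<tau>] arccos_le_pi2[of \<tau>] by (auto simp: \<beta>_def)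
  \<comment> \<open>The half-open window lacks its right endpoint, which belongs to the band exactly
    when \<open>\<beta> = pi / 2\<close>.\<close>
  have "E \<inter> {-(pi/2)..<-(pi/2)+pi} = (if \<beta> = pi / 2 then {-(pi/2)..<pi/2} else {-\<beta>..\<beta>})"
  proof -
    have "y \<in> E \<longleftrightarrow> \<bar>y\<bar> \<le> \<beta>" if "y \<in> {-(pi/2)..<pi/2}" for y
      using abs_cos_ge_iff[OF \<tau>, of y] that by (auto simp: E_def \<beta>_def)
    then show ?thesis using \<beta> by (auto simp: abs_le_iff)
  qed
  then have base: "measure lborel (E \<inter> {-(pi/2)..<-(pi/2)+pi}) = 2 * \<beta>" using \<beta> by auto
  have band: "measure lborel (E \<inter> {x..<x+pi}) = 2 * \<beta>" for x
    using measure_periodic[of E pi, OF _ per] base by (metis \<open>E \<in> sets borel\<close> pi_gt_zero)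
  have full: "measure lborel (E \<inter> {x..<x+2*pi}) = 4 * \<beta>" for x
  proof -
    have "E \<inter> {x..<x+2*pi} = (E \<inter> {x..<x+pi}) \<union> (E \<inter> {x+pi..<(x+pi)+pi})" using pi_ge_zero by auto
    moreover have "emeasure lborel (E \<inter> {u..<v}) \<noteq> \<infinity>" for u v
      using emeasure_bounded_finite[of "E \<inter> {u..<v}"] bounded_subset[OF bounded_Ico] 
      by (metis inf_le2 infinity_ennreal_def order_less_irrefl)
    ultimately have "measure lborel (E \<inter> {x..<x+2*pi})
        = measure lborel (E \<inter> {x..<x+pi}) + measure lborel (E \<inter> {x+pi..<(x+pi)+pi})"
      by (subst measure_Union[symmetric]) auto
    then show ?thesis using band[of x] band[of "x + pi"] by linarith
  qed
  have pos: "measure lborel {s \<in> {0..<l}. \<tau> \<le> \<bar>cos (\<theta> + h * s)\<bar>} = 2 * \<beta> / pi * l"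
    if h: "h > 0" "h * l = 2 * pi" for h \<theta>
  proof -
    have eq: "{s. \<theta> + h * s \<in> E \<inter> {\<theta>..<\<theta>+2*pi}} = {s \<in> {0..<l}. \<tau> \<le> \<bar>cos (\<theta> + h * s)\<bar>}"
      using h by (auto simp: E_def zero_le_mult_iff simp flip: h(2))
    define m where "m = measure lborel {s \<in> {0..<l}. \<tau> \<le> \<bar>cos (\<theta> + h * s)\<bar>}"
    have "measure lborel (E \<inter> {\<theta>..<\<theta>+2*pi}) = \<bar>h\<bar> * measure lborel {s. \<theta> + h * s \<in> E \<inter> {\<theta>..<\<theta>+2*pi}}"
      by (rule measure_affine_vimage) (use h in auto)
    then have "4 * \<beta> = h * m"
      unfolding eq full m_def using h(1) by (simp only: abs_of_pos)
    moreover have "l = 2 * pi / h" using h by (simp add: field_simps)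
    moreover have "m = 4 * \<beta> / h" if "4 * \<beta> = h * m" using h that by (simp add: field_simps)
    ultimately have "m = 2 * \<beta> / pi * l" by simp
    then show ?thesis by (simp only: m_def)
  qed
  show ?thesis
  proof (cases "h > 0")
    case True
    then show ?thesis using pos[of h \<theta>] h by (simp add: \<beta>_def)
  next
    case False
    moreover have "cos (\<theta> + h * s) = cos (- \<theta> + (- h) * s)" for s
      using cos_minus[of "\<theta> + h * s"] by simp
    ultimately show ?thesis using pos[of "-h" "-\<theta>"] h by (cases "h = 0") (auto simp: \<beta>_def)
  qed
qed

lemma arccos_tn_continuous:
  assumes "small K L"
  shows "continuous_on {0..L} (\<lambda>z. arccos (tn K z / tn K L))"
    and "z \<in> {0..L} \<Longrightarrow> 0 \<le> tn K z / tn K L \<and> tn K z / tn K L \<le> 1"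
    and "tn K L > 0"
proof -
  have L: "0 < L" using assms by (simp add: small_def)
  show pos: "tn K L > 0"
    using sn_pos[OF assms, of L] cs_pos[OF assms, of L] L by (simp add: tn_def)
  have bd: "0 \<le> tn K z / tn K L \<and> tn K z / tn K L \<le> 1" if "z \<in> {0..L}" for z
  proof -
    have "tn K 0 \<le> tn K z" "tn K z \<le> tn K L"
      using tn_strict_mono[OF assms, of 0 z] tn_strict_mono[OF assms, of z L] that L
      by (auto simp: le_less)
    then show ?thesis using pos by (simp add: tn_def[of K 0])
  qed
  then show "z \<in> {0..L} \<Longrightarrow> 0 \<le> tn K z / tn K L \<and> tn K z / tn K L \<le> 1" .
  have "cs K z \<noteq> 0" if "z \<in> {0..L}" for z using cs_pos[OF assms, of z] that by auto
  then have "continuous_on {0..L} (\<lambda>z. tn K z / tn K L)"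
    unfolding tn_def[of K] using pos by (auto intro!: continuous_intros simp: tn_def)
  then show "continuous_on {0..L} (\<lambda>z. arccos (tn K z / tn K L))"
    by (rule continuous_on_arccos) (use bd in fastforce)
qed

text \<open>Both sides are the area of the region \<open>R\<close> of pairs with
  \<open>tn K z \<le> tn K L * cos \<theta>\<close>: slices at fixed \<open>z\<close> have length
  \<open>arccos (tn K z / tn K L)\<close>, slices at fixed \<open>\<theta>\<close> have length
  \<open>arctn K (tn K L * cos \<theta>)\<close>.\<close>

lemma integral_arccos_tn:
  assumes "small K L"
  shows "(LINT z|lborel. indicator {0..L} z * arccos (tn K z / tn K L)) = angle_integral K L"
proof -
  have L: "0 < L" using assms by (simp add: small_def)
  note tnL = arccos_tn_continuous(3)[OF assms]
  have csL: "cs K L > 0" using cs_pos[OF assms, of L] L by auto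
  \<comment> \<open>Without division the inequality involves only functions continuous everywhere,
    so \<open>R\<close> is closed and thus measurable; \<open>tn K\<close> itself may have
    poles.\<close>
  define R :: "(real \<times> real) set" where "R = {w. fst w \<in> {0..L} \<and> snd w \<in> {0..pi/2} \<and>
     sn K (fst w) * cs K L \<le> sn K L * cos (snd w) * cs K (fst w)}"
  have R_iff: "(z, \<theta>) \<in> R \<longleftrightarrow> z \<in> {0..L} \<and> \<theta> \<in> {0..pi/2} \<and> tn K z \<le> tn K L * cos \<theta>" for z \<theta>
  proof (cases "z \<in> {0..L}")
    case True
    then have "cs K z > 0" using cs_pos[OF assms, of z] by auto
    then show ?thesis using csL by (auto simp: R_def tn_def field_simps)
  qed (auto simp: R_def)
  have "closed R" unfolding R_def atLeastAtMost_iff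
    by (intro closed_Collect_conj closed_Collect_le continuous_intros)
  moreover have "R \<subseteq> {0..L} \<times> {0..pi/2}" by (auto simp: R_def)
  then have "bounded R" by (rule bounded_subset[rotated]) (intro bounded_Times bounded_closed_interval)
  ultimately have int: "integrable lborel (indicator R :: real \<times> real \<Rightarrow> real)"
    using emeasure_bounded_finite[of R] by (intro integrable_real_indicator) auto
  have "(\<integral>\<theta>. (\<integral>z. indicat_real R (z, \<theta>) \<partial>lborel) \<partial>lborel)
      = (\<integral>z. (\<integral>\<theta>. indicat_real R (z, \<theta>) \<partial>lborel) \<partial>lborel)"
    by (rule lborel_pair.Fubini_integral) (unfold lborel_prod case_prod_eta, rule int)
  moreover have "(\<integral>z. indicat_real R (z, \<theta>) \<partial>lborel) = indicator {0..pi/2} \<theta> * arctn K (tn K L * cos \<theta>)" for \<theta>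
  proof (cases "\<theta> \<in> {0..pi/2}")
    case True
    then have c: "0 \<le> cos \<theta>" "cos \<theta> \<le> 1" by (auto intro!: cos_ge_zero order_trans[of "-(pi/2)" 0 \<theta>])
    have "continuous_on {0..L} (tn K)"
      unfolding tn_def[of K, abs_def]
      by (intro continuous_intros ballI) (metis abs_of_nonneg assms atLeastAtMost_iff cs_pos less_irrefl)
    then obtain z0 where z0: "0 \<le> z0" "z0 \<le> L" "tn K z0 = tn K L * cos \<theta>"
      using IVT'[of "tn K" 0 "tn K L * cos \<theta>" L] L c tnL by (auto simp: tn_def[of K 0] mult_left_le)
    have "tn K z \<le> tn K z0 \<longleftrightarrow> z \<le> z0" if "z \<in> {0..L}" for z
      using tn_strict_mono[OF assms, of z z0] tn_strict_mono[OF assms, of z0 z] that z0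
      by (cases z z0 rule: linorder_cases) auto
    then have "indicator R (z, \<theta>) = (indicator {0..z0} z :: real)" for z
      using True z0(1,2) by (auto simp: R_iff indicator_def simp flip: z0(3))
    then show ?thesis using True z0 arctn_tn[OF assms, of z0] by simp
  next
    case False
    then have "indicat_real R (z, \<theta>) = 0" for z by (auto simp: R_iff indicator_def)
    then show ?thesis using False by simp
  qed
  moreover have "(\<integral>\<theta>. indicat_real R (z, \<theta>) \<partial>lborel) = indicator {0..L} z * arccos (tn K z / tn K L)" for z
  proof (cases "z \<in> {0..L}")
    case True
    define \<tau> where "\<tau> = tn K z / tn K L"
    have \<tau>: "0 \<le> \<tau>" "\<tau> \<le> 1" using arccos_tn_continuous(2)[OF assms True] by (auto simp: \<tau>_def)
    have "tn K z \<le> tn K L * cos \<theta> \<longleftrightarrow> \<tau> \<le> cos \<theta>" for \<theta>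
      using tnL by (simp add: \<tau>_def field_simps)
    moreover have "\<tau> \<le> cos \<theta> \<longleftrightarrow> \<theta> \<le> arccos \<tau>" if "\<theta> \<in> {0..pi/2}" for \<theta>
    proof -
      have "cos \<theta> \<ge> 0" using that by (intro cos_ge_zero) (auto intro!: order_trans[of "-(pi/2)" 0 \<theta>])
      then show ?thesis using abs_cos_ge_iff[OF \<tau>, of \<theta>] that by auto
    qed
    ultimately have "indicator R (z, \<theta>) = (indicator {0..arccos \<tau>} \<theta> :: real)" for \<theta>
      using True arccos_le_pi2[OF \<tau>] by (auto simp: R_iff indicator_def)
    then show ?thesis using True arccos_lbound[of \<tau>] \<tau> by (simp add: \<tau>_def)
  next
    case False
    then have "indicat_real R (z, \<theta>) = 0" for \<theta> by (auto simp: R_iff indicator_def)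
    then show ?thesis using False by simp
  qed
  ultimately have "(LINT z|lborel. indicator {0..L} z * arccos (tn K z / tn K L))
     = (LINT \<theta>:{0..pi/2}|lborel. arctn K (tn K L * cos \<theta>))"
    by (simp add: set_lebesgue_integral_def)
  also have "\<dots> = angle_integral K L"
    unfolding angle_integral_def
    by (intro set_borel_integral_eq_integral borel_integrable_atLeastAtMost' continuous_arctn_cos assms)
  finally show ?thesis .
qed

lemma integral_uniform_arccos:
  assumes "small K L" and [measurable]: "g \<in> borel_measurable borel"
    and g: "\<And>z. \<bar>z\<bar> < L \<Longrightarrow> g z = 2 / pi * arccos (tn K \<bar>z\<bar> / tn K L)"
  shows "(LINT z|uniform_measure lborel {-L..L}. g z) = 2 / (pi * L) * angle_integral K L"
proof -
  have L: "0 < L" using assms by (simp add: small_def)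
  define F where "F z = indicator {0..L} z * arccos (tn K z / tn K L)" for z
  have F: "integrable lborel F"
    using borel_integrable_atLeastAtMost'[OF arccos_tn_continuous(1)[OF assms(1)]]
    by (simp add: F_def[abs_def] set_integrable_def)
  then have [measurable]: "F \<in> borel_measurable borel" by auto
  have F': "integrable lborel (\<lambda>z. F (- z))" "(LINT z|lborel. F (- z)) = (LINT z|lborel. F z)"
    using lborel_integrable_real_affine[OF F, of "-1" 0] lborel_integral_real_affine[of "-1" F 0] by auto
  have "indicator {-L..L} z / emeasure lborel {-L..L} = ennreal (indicator {-L..L} z / (2 * L))" for z
  proof -
    have "emeasure lborel {-L..L} = ennreal (2 * L)" using L by simp
    moreover have "1 / ennreal (2 * L) = ennreal (1 / (2 * L))"
      using L by (simp add: divide_ennreal flip: ennreal_1)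
    ultimately show ?thesis by (auto simp: indicator_def)
  qed
  then have "uniform_measure lborel {-L..L} = density lborel (\<lambda>z. ennreal (indicator {-L..L} z / (2 * L)))"
    unfolding uniform_measure_def by (simp only:)
  then have "(LINT z|uniform_measure lborel {-L..L}. g z) = (LINT z|lborel. indicator {-L..L} z / (2 * L) * g z)"
    using L by (simp add: integral_density)
  also have "\<dots> = (LINT z|lborel. 1 / (pi * L) * (F z + F (- z)))"
  proof (intro integral_cong_AE)
    \<comment> \<open>At 0 both \<open>F z\<close> and \<open>F (- z)\<close> contribute, and at
      \<open>L\<close> and \<open>- L\<close> nothing is known about \<open>g\<close>.\<close>
    have "AE z in lborel. z \<notin> {0, L, -L}"
      by (rule AE_not_in) (auto intro!: finite_imp_null_set_lborel)
    then show "AE z in lborel. indicator {-L..L} z / (2 * L) * g z = 1 / (pi * L) * (F z + F (- z))"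
      by eventually_elim (use L in \<open>auto simp: F_def indicator_def g abs_if field_simps\<close>)
  qed auto
  also have "\<dots> = 1 / (pi * L) * ((LINT z|lborel. F z) + (LINT z|lborel. F (- z)))"
    using F F'(1) by simp
  also have "\<dots> = 2 / (pi * L) * angle_integral K L"
    unfolding F'(2) using integral_arccos_tn[OF assms(1)] by (simp add: F_def[abs_def])
  finally show ?thesis .
qed

section \<open>The quadric models of the space forms\<close>

text \<open>The sphere of radius \<open>r\<close> is embedded with its third coordinate divided by \<open>r\<close>, the plane as
  \<open>x$3 = 1\<close>, and the hyperbolic plane as a sheet of a hyperboloid. In the flat case the last summand of
  \<open>form\<close> is the junk value \<open>0\<close> of the division by \<open>0\<close>, which is what is needed.\<close>

definition form :: "real \<Rightarrow> real^3 \<Rightarrow> real^3 \<Rightarrow> real" where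
  "form K x y = x$1 * y$1 + x$2 * y$2 + x$3 * y$3 / K"

definition dual_form :: "real \<Rightarrow> real^3 \<Rightarrow> real^3 \<Rightarrow> real" where
  "dual_form K x y = K * (x$1 * y$1 + x$2 * y$2) + x$3 * y$3"

definition quadric :: "real \<Rightarrow> (real^3) set" where
  "quadric K = {x. dual_form K x x = 1 \<and> (K \<le> 0 \<longrightarrow> x$3 > 0)}"

lemma bounded_bilinear_form: "bounded_bilinear (form K)"
proof -
  have "linear (\<lambda>y::real^3. vector [y$1, y$2, y$3 / K] :: real^3)"
    by (rule linearI) (auto simp: vec_eq_iff forall_3 add_divide_distrib)
  then have "bounded_linear (\<lambda>y::real^3. vector [y$1, y$2, y$3 / K] :: real^3)"
    by (simp add: linear_conv_bounded_linear)
  from bounded_bilinear.comp[OF bounded_bilinear_inner bounded_linear_ident this]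
  show ?thesis by (simp add: inner_vec_def sum_3 form_def[abs_def])
qed

lemma bounded_bilinear_dual_form: "bounded_bilinear (dual_form K)"
proof -
  have "linear (\<lambda>y::real^3. vector [K * y$1, K * y$2, y$3] :: real^3)"
    by (rule linearI) (auto simp: vec_eq_iff forall_3 algebra_simps)
  then have "bounded_linear (\<lambda>y::real^3. vector [K * y$1, K * y$2, y$3] :: real^3)"
    by (simp add: linear_conv_bounded_linear)
  from bounded_bilinear.comp[OF bounded_bilinear_inner bounded_linear_ident this]
  show ?thesis by (simp add: inner_vec_def sum_3 dual_form_def[abs_def] algebra_simps)
qed

lemmas form_simps =
  bounded_bilinear.add_left[OF bounded_bilinear_form]
  bounded_bilinear.add_right[OF bounded_bilinear_form]
  bounded_bilinear.diff_left[OF bounded_bilinear_form]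
  bounded_bilinear.diff_right[OF bounded_bilinear_form]
  bounded_bilinear.scaleR_left[OF bounded_bilinear_form]
  bounded_bilinear.scaleR_right[OF bounded_bilinear_form]
  bounded_bilinear.sum_left[OF bounded_bilinear_form]
  bounded_bilinear.sum_right[OF bounded_bilinear_form]

lemmas dual_form_simps =
  bounded_bilinear.add_left[OF bounded_bilinear_dual_form]
  bounded_bilinear.add_right[OF bounded_bilinear_dual_form]
  bounded_bilinear.scaleR_left[OF bounded_bilinear_dual_form]
  bounded_bilinear.scaleR_right[OF bounded_bilinear_dual_form]
  bounded_bilinear.sum_left[OF bounded_bilinear_dual_form]
  bounded_bilinear.sum_right[OF bounded_bilinear_dual_form]

lemma form_commute: "form K x y = form K y x"
  by (simp add: form_def mult.commute)

lemma dual_form_commute: "dual_form K x y = dual_form K y x"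
  by (simp add: dual_form_def mult.commute)

text \<open>Dividing the third component of a tangent vector by \<open>K\<close> makes sense also in the limit \<open>K = 0\<close>.\<close>

lemma tangent_third_component:
  assumes "y \<in> quadric K" "dual_form K y v = 0"
  obtains w where "v$3 = K * w" "y$1 * v$1 + y$2 * v$2 + y$3 * w = 0"
proof (cases "K = 0")
  case True
  then have "y$3 \<noteq> 0" using assms by (auto simp: quadric_def dual_form_def)
  then show ?thesis
    using that[of "- (y$1 * v$1 + y$2 * v$2) / y$3"] assms True by (simp add: dual_form_def)
next
  case False
  have "K * (y$1 * v$1 + y$2 * v$2 + y$3 * (v$3 / K)) = dual_form K y v"
    using False by (simp add: dual_form_def algebra_simps)
  then have "y$1 * v$1 + y$2 * v$2 + y$3 * (v$3 / K) = 0"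
    using assms False by auto
  then show ?thesis using that[of "v$3 / K"] False by simp
qed

lemma form_third_component:
  "v$3 = K * w \<Longrightarrow> v'$3 = K * w' \<Longrightarrow> form K v v' = v$1 * v'$1 + v$2 * v'$2 + K * w * w'"
  by (simp add: form_def)

lemma K_form: "dual_form K y v = 0 \<Longrightarrow> K * form K y v = 0"
  by (cases "K = 0") (auto simp: dual_form_def form_def algebra_simps)

text \<open>The polynomial core of \<open>tangent_eq_zero\<close>, with third components already
  divided by \<open>K\<close>. The vector \<open>(n1, n2, n3)\<close> is the cross product of
  \<open>a\<close> and \<open>b\<close> and is nonzero by the Gram condition. Both \<open>y\<close>
  and \<open>(z1, z2, K * z3)\<close> are orthogonal to \<open>a\<close> and \<open>b\<close>, hence
  parallel to it, hence to each other. Pairing with \<open>y\<close> by means of \<open>y\<close>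
  and the last equation of \<open>orth\<close> makes the factor of proportionality 0.\<close>

lemma orthogonal_complement_zero:
  fixes K :: real
  assumes y: "y3\<^sup>2 + K * (y1\<^sup>2 + y2\<^sup>2) = 1"
    and orth: "y1 * a1 + y2 * a2 + y3 * a3 = 0" "y1 * b1 + y2 * b2 + y3 * b3 = 0"
      "y1 * z1 + y2 * z2 + y3 * z3 = 0"
    and gram: "(a1 * a1 + a2 * a2 + K * a3 * a3) * (b1 * b1 + b2 * b2 + K * b3 * b3)
      \<noteq> (a1 * b1 + a2 * b2 + K * a3 * b3)\<^sup>2"
    and z: "z1 * a1 + z2 * a2 + K * z3 * a3 = 0" "z1 * b1 + z2 * b2 + K * z3 * b3 = 0"
  shows "z1 = 0 \<and> z2 = 0 \<and> K * z3 = 0"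
proof -
  define n1 where "n1 = a2 * b3 - a3 * b2"
  define n2 where "n2 = a3 * b1 - a1 * b3"
  define n3 where "n3 = a1 * b2 - a2 * b1"
  have par: "p1 * n2 = p2 * n1" "p1 * n3 = p3 * n1" "p2 * n3 = p3 * n2"
    if "p1 * a1 + p2 * a2 + p3 * a3 = 0" "p1 * b1 + p2 * b2 + p3 * b3 = 0" for p1 p2 p3
    using that unfolding n1_def n2_def n3_def by algebra+
  have "n1 \<noteq> 0 \<or> n2 \<noteq> 0 \<or> n3 \<noteq> 0"
  proof (rule ccontr)
    assume "\<not> ?thesis"
    then have "a2 * b3 = a3 * b2" "a3 * b1 = a1 * b3" "a1 * b2 = a2 * b1"
      by (auto simp: n1_def n2_def n3_def)
    with gram show False by algebra
  qed
  moreover have "(z1 * y2 - z2 * y1) * n1 = 0" "(z1 * y2 - z2 * y1) * n2 = 0"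
    "(z1 * y2 - z2 * y1) * n3 = 0" "(z1 * y3 - K * z3 * y1) * n1 = 0"
    "(z1 * y3 - K * z3 * y1) * n2 = 0" "(z1 * y3 - K * z3 * y1) * n3 = 0"
    "(z2 * y3 - K * z3 * y2) * n1 = 0" "(z2 * y3 - K * z3 * y2) * n2 = 0"
    "(z2 * y3 - K * z3 * y2) * n3 = 0"
    using par[OF orth(1,2)] par[OF z] by algebra+
  ultimately have "z1 * y2 = z2 * y1" "z1 * y3 = K * z3 * y1" "z2 * y3 = K * z3 * y2" by auto
  then show ?thesis using y orth(3) by (intro conjI) algebra+
qed

text \<open>\<open>form K\<close> is nondegenerate on every tangent plane, even where it is
  degenerate on R^3. This identifies a tangent vector from its products with the two coordinate
  vectors of a chart.\<close>

lemma tangent_eq_zero: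
  assumes y: "y \<in> quadric K"
    and tan: "dual_form K y a = 0" "dual_form K y b = 0" "dual_form K y z = 0"
    and gram: "form K a a * form K b b \<noteq> (form K a b)\<^sup>2"
    and orth: "form K z a = 0" "form K z b = 0"
  shows "z = 0"
proof -
  obtain wa where wa: "a$3 = K * wa" "y$1 * a$1 + y$2 * a$2 + y$3 * wa = 0"
    using tangent_third_component[OF y tan(1)] .
  obtain wb where wb: "b$3 = K * wb" "y$1 * b$1 + y$2 * b$2 + y$3 * wb = 0"
    using tangent_third_component[OF y tan(2)] .
  obtain wz where wz: "z$3 = K * wz" "y$1 * z$1 + y$2 * z$2 + y$3 * wz = 0"
    using tangent_third_component[OF y tan(3)] .
  have "(y$3)\<^sup>2 + K * ((y$1)\<^sup>2 + (y$2)\<^sup>2) = 1"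
    using y by (simp add: quadric_def dual_form_def power2_eq_square algebra_simps)
  then have "z$1 = 0 \<and> z$2 = 0 \<and> K * wz = 0"
    using orthogonal_complement_zero[of "y$3" K "y$1" "y$2" "a$1" "a$2" wa "b$1" "b$2" wb "z$1" "z$2" wz]
      wa(2) wb(2) wz(2) gram orth
    unfolding form_third_component[OF wa(1) wa(1)] form_third_component[OF wb(1) wb(1)]
      form_third_component[OF wa(1) wb(1)] form_third_component[OF wz(1) wa(1)]
      form_third_component[OF wz(1) wb(1)]
    by blast
  then show ?thesis using wz(1) by (simp add: vec_eq_iff forall_3)
qed

section \<open>Metrics induced by a quadric\<close>

definition pullback :: "real \<Rightarrow> (real^2 \<Rightarrow> real^3) \<Rightarrow> real^2 \<Rightarrow> real^2^2" where
  "pullback K x u = (\<chi> i j. form K (partial i x u) (partial j x u))"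

lemma pullback_compose:
  assumes "\<tau> differentiable (at u)" "x differentiable (at (\<tau> u))"
  shows "pullback K (\<lambda>v. x (\<tau> v)) u =
    transpose (jacobian \<tau> u) ** pullback K x (\<tau> u) ** jacobian \<tau> u"
proof -
  have "jacobian \<tau> u $ j $ i = partial i \<tau> u $ j" for i j
    by (simp add: jacobian_def matrix_def partial_def)
  then show ?thesis
    unfolding vec_eq_iff pullback_def partial_compose[OF assms]
    by (simp add: matrix_matrix_mult_def transpose_def sum_2 form_simps algebra_simps)
qed

lemma partial_pullback:
  assumes "open W" "C_on 2 W x" "u \<in> W"
  shows "partial i (\<lambda>v. pullback K x v $ j $ l) u
    = form K (partial i (partial j x) u) (partial l x u) + form K (partial j x u) (partial i (partial l x) u)"
proof -
  have d: "(partial j x has_derivative frechet_derivative (partial j x) (at u)) (at u)" for j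
    using assms by (auto simp: numeral_2_eq_2 simp flip: frechet_derivative_works)
  from partial_eq[OF bounded_bilinear.FDERIV[OF bounded_bilinear_form d d]]
  show ?thesis by (simp add: pullback_def partial_def[of i "partial j x"] partial_def[of i "partial l x"])
qed

lemma matrix_inv_right:
  assumes "invertible (A :: 'a::semiring_1^'n^'m)"
  shows "A ** matrix_inv A = mat 1"
  unfolding matrix_inv_def
  by (rule someI2_ex[where P="\<lambda>A'. A ** A' = mat 1 \<and> A' ** A = mat 1"])
     (use assms in \<open>auto simp: invertible_def\<close>)

text \<open>Through this formula the geodesic equation becomes a condition on the embedded curve that does not
  depend on the chart, so that no transformation law for the Christoffel symbols is needed.\<close>

lemma gauss_formula:
  assumes W: "open W" "C_on 2 W x" "u \<in> W"
    and g: "\<And>v. v \<in> W \<Longrightarrow> g v = pullback K x v" and inv: "invertible (g u)"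
  shows "(\<Sum>k\<in>UNIV. g u $ m $ k * christoffel g k i j u)
    = form K (partial i (partial j x) u) (partial m x u)"
proof -
  define F where "F l = (partial i (\<lambda>v. g v $ j $ l) u + partial j (\<lambda>v. g v $ i $ l) u
           - partial l (\<lambda>v. g v $ i $ j) u) / 2" for l
  have pg: "partial i (\<lambda>v. g v $ j $ l) u = form K (partial i (partial j x) u) (partial l x u)
      + form K (partial j x u) (partial i (partial l x) u)" for i j l
    using partial_cong[OF W(1,3), of "\<lambda>v. g v $ j $ l" "\<lambda>v. pullback K x v $ j $ l" i] g
    unfolding partial_pullback[OF W] by simp
  \<comment> \<open>Each of the three derivatives of the metric is a sum of two products; by
    symmetry of mixed partial derivatives four of the six cancel and the other two agree.\<close>
  have F: "F l = form K (partial i (partial j x) u) (partial l x u)" for l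
    unfolding F_def pg partial_commute[OF W(2,1,3), of j i] partial_commute[OF W(2,1,3), of l j]
      partial_commute[OF W(2,1,3), of l i]
    by (simp add: form_commute)
  have "(\<Sum>k\<in>UNIV. g u $ m $ k * christoffel g k i j u)
    = (\<Sum>k\<in>UNIV. \<Sum>l\<in>UNIV. g u $ m $ k * matrix_inv (g u) $ k $ l * F l)"
    by (simp add: christoffel_def F_def sum_distrib_left sum_divide_distrib algebra_simps)
  also have "\<dots> = (\<Sum>l\<in>UNIV. (g u ** matrix_inv (g u)) $ m $ l * F l)"
    by (subst sum.swap) (simp add: matrix_matrix_mult_def sum_distrib_right)
  also have "\<dots> = (\<Sum>l\<in>UNIV. if m = l then F l else 0)"
    by (rule sum.cong) (auto simp: matrix_inv_right[OF inv] mat_def)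
  also have "\<dots> = F m" by simp
  finally show ?thesis unfolding F .
qed

lemma has_vector_derivative_partial:
  assumes "f differentiable (at (u t))" "(u has_vector_derivative v) (at t)"
  shows "((\<lambda>s. f (u s)) has_vector_derivative (\<Sum>i\<in>UNIV. v $ i *\<^sub>R partial i f (u t))) (at t)"
  using has_derivative_compose[OF assms(2)[unfolded has_vector_derivative_def]
      has_derivative_partial[OF assms(1)]]
  by (simp add: has_vector_derivative_def scaleR_sum_right)

lemma invertible_pullback:
  assumes "\<And>v. v \<noteq> 0 \<Longrightarrow> v \<bullet> (g *v v) > 0"
  shows "invertible (g :: real^2^2)"
proof -
  have "g *v v = 0 \<Longrightarrow> v = 0" for v using assms[of v] by auto
  then show ?thesis by (simp add: invertible_left_inverse matrix_left_invertible_ker)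
qed

lemma form_pullback_axis:
  "form K (\<Sum>i\<in>UNIV. v $ i *\<^sub>R partial i x u) (partial j x u) = (pullback K x u *v v) $ j"
proof -
  have "form K (\<Sum>i\<in>UNIV. v $ i *\<^sub>R partial i x u) (partial j x u)
      = (\<Sum>i\<in>UNIV. v $ i * form K (partial i x u) (partial j x u))"
    by (simp only: form_simps real_scaleR_def)
  also have "\<dots> = (\<Sum>i\<in>UNIV. form K (partial j x u) (partial i x u) * v $ i)"
    by (intro sum.cong refl) (subst form_commute, rule mult.commute)
  finally show ?thesis by (simp add: pullback_def matrix_vector_mult_def)
qed

lemma form_pullback:
  "form K (\<Sum>i\<in>UNIV. v $ i *\<^sub>R partial i x u) (\<Sum>j\<in>UNIV. w $ j *\<^sub>R partial j x u)
    = v \<bullet> (pullback K x u *v w)"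
proof -
  have "form K (\<Sum>i\<in>UNIV. v $ i *\<^sub>R partial i x u) (\<Sum>j\<in>UNIV. w $ j *\<^sub>R partial j x u)
      = (\<Sum>i\<in>UNIV. v $ i * form K (\<Sum>j\<in>UNIV. w $ j *\<^sub>R partial j x u) (partial i x u))"
    by (subst form_commute, subst bounded_bilinear.sum_right[OF bounded_bilinear_form])
       (simp only: bounded_bilinear.scaleR_right[OF bounded_bilinear_form] real_scaleR_def)
  then show ?thesis unfolding form_pullback_axis by (simp add: inner_vec_def)
qed

section \<open>Surfaces embedded in a quadric: curves and geodesics\<close>

lemma openin_surface_topology:
  "openin (surface_topology M) U \<longleftrightarrow>
     U \<subseteq> points M \<and> (\<forall>c\<in>charts M. open {u \<in> cdom c. cmap c u \<in> U})"
proof -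
  let ?P = "\<lambda>U. U \<subseteq> points M \<and> (\<forall>c\<in>charts M. open {u \<in> cdom c. cmap c u \<in> U})"
  have "istopology ?P"
    unfolding istopology_def
  proof (intro conjI allI impI)
    fix S T assume "?P S" "?P T"
    moreover have "{u \<in> cdom c. cmap c u \<in> S \<inter> T} =
        {u \<in> cdom c. cmap c u \<in> S} \<inter> {u \<in> cdom c. cmap c u \<in> T}" for c :: "'a chart" by auto
    ultimately show "S \<inter> T \<subseteq> points M" "\<forall>c\<in>charts M. open {u \<in> cdom c. cmap c u \<in> S \<inter> T}" by auto
  next
    fix \<K> assume "\<forall>k\<in>\<K>. ?P k"
    moreover have "{u \<in> cdom c. cmap c u \<in> \<Union>\<K>} = (\<Union>k\<in>\<K>. {u \<in> cdom c. cmap c u \<in> k})"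
      for c :: "'a chart" by auto
    ultimately show "\<Union>\<K> \<subseteq> points M" "\<forall>c\<in>charts M. open {u \<in> cdom c. cmap c u \<in> \<Union>\<K>}" by auto
  qed
  then show ?thesis unfolding surface_topology_def by (simp add: topology_inverse')
qed

lemma coords_inverse:
  "p \<in> cimage c \<Longrightarrow> coords c p \<in> cdom c" "p \<in> cimage c \<Longrightarrow> cmap c (coords c p) = p"
  unfolding coords_def by (auto intro: inv_into_into f_inv_into_f)

text \<open>Cramer's rule, written out so that continuity and differentiability of the solution
  follow from those of the entries.\<close>

definition solve2 :: "real^2^2 \<Rightarrow> real^2 \<Rightarrow> real^2" where
  "solve2 g b = (\<chi> k. if k = 1 then (b$1 * g$2$2 - b$2 * g$1$2) / (g$1$1 * g$2$2 - g$1$2 * g$2$1)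
     else (b$2 * g$1$1 - b$1 * g$2$1) / (g$1$1 * g$2$2 - g$1$2 * g$2$1))"

lemma solve2: "invertible g \<Longrightarrow> solve2 g (g *v v) = v"
  by (auto simp: vec_eq_iff forall_2 solve2_def matrix_vector_mult_def sum_2 invertible_det_nz det_2
      field_simps)

text \<open>\<open>X\<close> embeds \<open>M\<close> isometrically as the quadric. The assumption
  \<open>local_inverse\<close> takes the place of the inverse function theorem: near
  \<open>X p\<close> the coordinates of a chart are the restriction of a differentiable map of the
  ambient space, and the nearby points of the surface belong to that chart.\<close>

locale space_form =
  fixes M :: "'a surface" and K :: real and X :: "'a \<Rightarrow> real^3"
  assumes surface: "riemannian_surface M"
    and inj: "inj_on X (points M)" and image: "X ` points M = quadric K"
    and smooth: "\<And>c. c \<in> charts M \<Longrightarrow> C_on 2 (cdom c) (\<lambda>u. X (cmap c u))"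
    and metric: "\<And>c u. c \<in> charts M \<Longrightarrow> u \<in> cdom c \<Longrightarrow> cmet c u = pullback K (\<lambda>u. X (cmap c u)) u"
    and local_inverse: "\<And>c p. c \<in> charts M \<Longrightarrow> p \<in> cimage c \<Longrightarrow>
      \<exists>V (\<Phi> :: real^3 \<Rightarrow> real^2). open V \<and> X p \<in> V \<and> (\<forall>y\<in>V. \<Phi> differentiable (at y)) \<and>
        (\<forall>q\<in>points M. X q \<in> V \<longrightarrow> q \<in> cimage c \<and> coords c q = \<Phi> (X q))"
begin

lemma points_eq: "points M = (\<Union>c\<in>charts M. cimage c)"
  and chart_riemannian: "\<forall>c\<in>charts M. riemannian_chart c"
  and charts_compatible: "\<forall>c\<in>charts M. \<forall>d\<in>charts M. compatible c d"
  using surface unfolding riemannian_surface_def by - (elim conjE, assumption)+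

lemma chart_dom_open: "c \<in> charts M \<Longrightarrow> open (cdom c)"
  using chart_riemannian by (auto simp: riemannian_chart_def)

lemma cimage_subset: "c \<in> charts M \<Longrightarrow> cimage c \<subseteq> points M"
  using points_eq by auto

lemma point_in_chart: "p \<in> points M \<Longrightarrow> \<exists>c\<in>charts M. p \<in> cimage c"
  using points_eq by auto

lemma cimage_open: "c \<in> charts M \<Longrightarrow> openin (surface_topology M) (cimage c)"
  using charts_compatible cimage_subset
  by (auto simp: openin_surface_topology compatible_def metric_transition_def overlap_def)

lemma topspace_eq: "topspace (surface_topology M) = points M"
proof
  show "topspace (surface_topology M) \<subseteq> points M"
    unfolding topspace_def by (auto simp: openin_surface_topology)
  have "{u \<in> cdom c. cmap c u \<in> points M} = cdom c" if "c \<in> charts M" for c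
    using cimage_subset[OF that] by auto
  then have "openin (surface_topology M) (points M)"
    using chart_dom_open by (auto simp: openin_surface_topology)
  then show "points M \<subseteq> topspace (surface_topology M)" by (rule openin_subset)
qed

lemma invertible_metric: "c \<in> charts M \<Longrightarrow> u \<in> cdom c \<Longrightarrow> invertible (cmet c u)"
  using chart_riemannian by (intro invertible_pullback) (auto simp: riemannian_chart_def)

lemma X_in_quadric: "p \<in> points M \<Longrightarrow> X p \<in> quadric K"
  using image by auto

lemma openin_X_vimage:
  assumes "open V"
  shows "openin (surface_topology M) {p \<in> points M. X p \<in> V}"
  unfolding openin_surface_topology
proof (intro conjI ballI)
  fix c assume c: "c \<in> charts M"
  have "continuous_on (cdom c) (\<lambda>u. X (cmap c u))"
    using C_on_le[OF smooth[OF c], of 0] by simp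
  then have "open ((\<lambda>u. X (cmap c u)) -` V \<inter> cdom c)"
    using chart_dom_open[OF c] assms by (simp add: continuous_on_open_vimage)
  moreover have "(\<lambda>u. X (cmap c u)) -` V \<inter> cdom c = {u \<in> cdom c. cmap c u \<in> {p \<in> points M. X p \<in> V}}"
    using cimage_subset[OF c] by auto
  ultimately show "open {u \<in> cdom c. cmap c u \<in> {p \<in> points M. X p \<in> V}}" by simp
qed auto

text \<open>Continuity of the inverse of \<open>X\<close>: around each parameter the coordinates of
  \<open>\<sigma>\<close> are \<open>\<Phi>\<close> composed with \<open>Y\<close>, where
  \<open>\<Phi>\<close> comes from \<open>local_inverse\<close>.\<close>

lemma lift_continuous:
  assumes "continuous_on UNIV Y" "\<And>t::real. \<sigma> t \<in> points M" "\<And>t. X (\<sigma> t) = Y t"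
  shows "continuous_map euclideanreal (surface_topology M) \<sigma>"
proof -
  have "open {t. \<sigma> t \<in> U}" if U: "openin (surface_topology M) U" for U
  proof (subst open_subopen, intro ballI)
    fix t assume "t \<in> {t. \<sigma> t \<in> U}"
    obtain c where c: "c \<in> charts M" "\<sigma> t \<in> cimage c" using point_in_chart assms(2) by blast
    obtain V and \<Phi> :: "real^3 \<Rightarrow> real^2" where V: "open V" "X (\<sigma> t) \<in> V" "\<And>y. y \<in> V \<Longrightarrow> \<Phi> differentiable (at y)"
      "\<And>q. q \<in> points M \<Longrightarrow> X q \<in> V \<Longrightarrow> q \<in> cimage c \<and> coords c q = \<Phi> (X q)"
      using local_inverse[OF c] by blast
    define W where "W = {u \<in> cdom c. cmap c u \<in> U}"
    have "open W" using U c by (auto simp: openin_surface_topology W_def)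
    have "continuous_on V \<Phi>"
      using V(3) by (auto intro!: continuous_at_imp_continuous_on differentiable_imp_continuous_within)
    then have "open (\<Phi> -` W \<inter> V)"
      using V(1) \<open>open W\<close> by (simp add: continuous_on_open_vimage)
    then have op: "open (Y -` (\<Phi> -` W \<inter> V))"
      using assms(1) continuous_on_open_vimage[of UNIV Y] by (metis Int_UNIV_right open_UNIV)
    have "t \<in> Y -` (\<Phi> -` W \<inter> V)"
      using V(2) V(4)[OF assms(2) V(2)] \<open>t \<in> _\<close> c(2) coords_inverse[of "\<sigma> t" c] assms(3)
      by (auto simp: W_def)
    moreover have "Y -` (\<Phi> -` W \<inter> V) \<subseteq> {t. \<sigma> t \<in> U}"
    proof
      fix s assume s: "s \<in> Y -` (\<Phi> -` W \<inter> V)"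
      then have "\<sigma> s \<in> cimage c" "coords c (\<sigma> s) = \<Phi> (Y s)"
        using V(4)[of "\<sigma> s"] assms(2,3) by auto
      then show "s \<in> {t. \<sigma> t \<in> U}" using s coords_inverse(2)[of "\<sigma> s" c] by (auto simp: W_def)
    qed
    ultimately show "\<exists>T. open T \<and> t \<in> T \<and> T \<subseteq> {t. \<sigma> t \<in> U}" using op by blast
  qed
  then show ?thesis using assms(2) by (auto simp: continuous_map topspace_eq)
qed

text \<open>The equation of the quadric, differentiated in a chart.\<close>

lemma tangent_partial:
  assumes "c \<in> charts M" "u \<in> cdom c"
  shows "dual_form K (X (cmap c u)) (partial i (\<lambda>u. X (cmap c u)) u) = 0"
proof -
  let ?x = "\<lambda>u. X (cmap c u)"
  have d: "(?x has_derivative frechet_derivative ?x (at u)) (at u)"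
    using smooth[OF assms(1)] assms(2) by (auto simp: numeral_2_eq_2 simp flip: frechet_derivative_works)
  have "partial i (\<lambda>v. dual_form K (?x v) (?x v)) u = 2 * dual_form K (?x u) (partial i ?x u)"
    using partial_eq[OF bounded_bilinear.FDERIV[OF bounded_bilinear_dual_form d d]]
    by (simp add: partial_def dual_form_commute)
  moreover have "partial i (\<lambda>v. dual_form K (?x v) (?x v)) u = partial i (\<lambda>v. 1 :: real) u"
    using X_in_quadric cimage_subset[OF assms(1)]
    by (intro partial_cong[OF chart_dom_open[OF assms(1)] assms(2)]) (auto simp: quadric_def)
  moreover have "partial i (\<lambda>v. 1 :: real) u = 0"
    by (simp add: partial_eq[OF has_derivative_const])
  ultimately show ?thesis by simp
qed

lemma preimage_open:
  assumes "continuous_map euclideanreal (surface_topology M) \<gamma>" "openin (surface_topology M) U"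
  shows "open (\<gamma> -` U)"
  using assms by (auto simp: continuous_map vimage_def)

lemma X_velocity:
  assumes "continuous_map euclideanreal (surface_topology M) \<gamma>"
    and c: "c \<in> charts M" "\<gamma> t \<in> cimage c" and "(\<lambda>s. coords c (\<gamma> s)) differentiable (at t)"
  shows "((\<lambda>s. X (\<gamma> s)) has_vector_derivative
    (\<Sum>i\<in>UNIV. velocity c \<gamma> t $ i *\<^sub>R partial i (\<lambda>u. X (cmap c u)) (coords c (\<gamma> t)))) (at t)"
proof -
  have "((\<lambda>s. coords c (\<gamma> s)) has_vector_derivative velocity c \<gamma> t) (at t)"
    using assms(4) by (simp add: velocity_def vector_derivative_works)
  moreover have "(\<lambda>u. X (cmap c u)) differentiable (at (coords c (\<gamma> t)))"
    using smooth[OF c(1)] coords_inverse(1)[OF c(2)] by (simp add: numeral_2_eq_2)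
  ultimately have "((\<lambda>s. X (cmap c (coords c (\<gamma> s)))) has_vector_derivative
    (\<Sum>i\<in>UNIV. velocity c \<gamma> t $ i *\<^sub>R partial i (\<lambda>u. X (cmap c u)) (coords c (\<gamma> t)))) (at t)"
    by (intro has_vector_derivative_partial)
  then show ?thesis
    by (rule has_vector_derivative_transform_within_open[OF _ preimage_open[OF assms(1) cimage_open[OF c(1)]]])
       (use c in \<open>auto simp: coords_inverse\<close>)
qed

lemma unit_speed_embedded:
  assumes "unit_speed_curve M \<gamma>"
  defines "D \<equiv> \<lambda>t. vector_derivative (\<lambda>s. X (\<gamma> s)) (at t)"
  shows unit_speed_derivative: "((\<lambda>s. X (\<gamma> s)) has_vector_derivative D t) (at t)"
    and "continuous_on UNIV D"
    and unit_speed_form: "form K (D t) (D t) = 1"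
    and unit_speed_point: "\<gamma> t \<in> points M"
    and unit_speed_tangent: "dual_form K (X (\<gamma> t)) (D t) = 0"
    and unit_speed_coords: "c \<in> charts M \<Longrightarrow> \<gamma> t \<in> cimage c \<Longrightarrow>
      D t = (\<Sum>i\<in>UNIV. velocity c \<gamma> t $ i *\<^sub>R partial i (\<lambda>u. X (cmap c u)) (coords c (\<gamma> t)))"
proof -
  have cont: "continuous_map euclideanreal (surface_topology M) \<gamma>"
    using assms(1) by (simp add: unit_speed_curve_def)
  show pt: "\<gamma> t \<in> points M" for t
    using cont by (auto simp: continuous_map topspace_eq)
  have dd: "(\<lambda>s. coords c (\<gamma> s)) differentiable (at t)"
    "velocity c \<gamma> t \<bullet> (cmet c (coords c (\<gamma> t)) *v velocity c \<gamma> t) = 1"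
    if "c \<in> charts M" "\<gamma> t \<in> cimage c" for c t
    using assms(1) that by (auto simp: unit_speed_curve_def)
  show co: "D t = (\<Sum>i\<in>UNIV. velocity c \<gamma> t $ i *\<^sub>R partial i (\<lambda>u. X (cmap c u)) (coords c (\<gamma> t)))"
    if "c \<in> charts M" "\<gamma> t \<in> cimage c" for c t
    unfolding D_def by (rule vector_derivative_at[OF X_velocity[OF cont that dd(1)[OF that]]])
  show "((\<lambda>s. X (\<gamma> s)) has_vector_derivative D t) (at t)" for t
  proof -
    obtain c where c: "c \<in> charts M" "\<gamma> t \<in> cimage c" using point_in_chart pt by blast
    show ?thesis unfolding co[OF c] by (rule X_velocity[OF cont c dd(1)[OF c]])
  qed
  show "form K (D t) (D t) = 1" for t
  proof -
    obtain c where c: "c \<in> charts M" "\<gamma> t \<in> cimage c" using point_in_chart pt by blast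
    show ?thesis unfolding co[OF c] form_pullback
      using dd(2)[OF c] metric[OF c(1) coords_inverse(1)[OF c(2)]] by simp
  qed
  show "dual_form K (X (\<gamma> t)) (D t) = 0" for t
  proof -
    obtain c where c: "c \<in> charts M" "\<gamma> t \<in> cimage c" using point_in_chart pt by blast
    show ?thesis unfolding co[OF c]
      using tangent_partial[OF c(1) coords_inverse(1)[OF c(2)]] coords_inverse(2)[OF c(2)]
      by (simp add: dual_form_simps)
  qed
  have "isCont D t" for t
  proof -
    obtain c where c: "c \<in> charts M" "\<gamma> t \<in> cimage c" using point_in_chart pt by blast
    let ?I = "\<gamma> -` cimage c"
    have I: "open ?I" using preimage_open[OF cont cimage_open[OF c(1)]] .
    have u: "continuous_on ?I (\<lambda>s. coords c (\<gamma> s))"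
      using dd(1)[OF c(1)] by (auto intro!: continuous_at_imp_continuous_on differentiable_imp_continuous_within)
    have "continuous_on ?I (velocity c \<gamma>)"
      using assms(1) c(1) by (simp add: unit_speed_curve_def)
    moreover have "continuous_on ?I (\<lambda>t. partial i (\<lambda>u. X (cmap c u)) (coords c (\<gamma> t)))" for i
    proof (rule continuous_on_compose2[OF _ u])
      show "continuous_on (cdom c) (partial i (\<lambda>u. X (cmap c u)))"
        using smooth[OF c(1)] C_on_le[of 1 "cdom c" "partial i (\<lambda>u. X (cmap c u))" 0]
        by (simp add: numeral_2_eq_2)
    qed (auto simp: coords_inverse)
    ultimately have "continuous_on ?I (\<lambda>t. \<Sum>i\<in>UNIV. velocity c \<gamma> t $ i *\<^sub>R
        partial i (\<lambda>u. X (cmap c u)) (coords c (\<gamma> t)))"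
      by (intro continuous_intros)
    then have "continuous_on ?I D"
      by (rule continuous_on_eq) (simp add: co[OF c(1)])
    then show ?thesis using I c(2) by (simp add: continuous_on_eq_continuous_at)
  qed
  then show "continuous_on UNIV D" by (simp add: continuous_at_imp_continuous_on)
qed

lemma acceleration:
  assumes c: "c \<in> charts M" and u: "(u has_vector_derivative v t) (at t)" "u t \<in> cdom c"
    and v: "(v has_vector_derivative v') (at t)"
  defines "x \<equiv> \<lambda>u. X (cmap c u)"
  shows "((\<lambda>s. \<Sum>i\<in>UNIV. v s $ i *\<^sub>R partial i x (u s)) has_vector_derivative
      (\<Sum>i\<in>UNIV. v t $ i *\<^sub>R (\<Sum>j\<in>UNIV. v t $ j *\<^sub>R partial j (partial i x) (u t))
         + v' $ i *\<^sub>R partial i x (u t))) (at t)"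
proof (rule has_vector_derivative_sum)
  fix i :: 2
  have "partial i x differentiable (at (u t))"
    using smooth[OF c] u(2) by (simp add: x_def numeral_2_eq_2)
  from has_vector_derivative_partial[of "partial i x", OF this u(1)]
  have 1: "((\<lambda>s. partial i x (u s)) has_vector_derivative
    (\<Sum>j\<in>UNIV. v t $ j *\<^sub>R partial j (partial i x) (u t))) (at t)" .
  have "((\<lambda>s. v s $ i) has_vector_derivative v' $ i) (at t)"
    by (rule bounded_linear.has_vector_derivative[OF bounded_linear_vec_nth v])
  then have "((\<lambda>s. v s $ i) has_real_derivative v' $ i) (at t)"
    by (simp add: has_real_derivative_iff_has_vector_derivative)
  from has_vector_derivative_scaleR[OF this 1]
  show "((\<lambda>s. v s $ i *\<^sub>R partial i x (u s)) has_vector_derivative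
      (v t $ i *\<^sub>R (\<Sum>j\<in>UNIV. v t $ j *\<^sub>R partial j (partial i x) (u t))
         + v' $ i *\<^sub>R partial i x (u t))) (at t)" .
qed

text \<open>The tangential part of the embedded acceleration is the metric applied to the defect in
  the geodesic equation. As the metric is invertible, the equation holds iff the acceleration has
  vanishing products with the coordinate vectors; both directions are used below.\<close>

lemma form_acceleration:
  assumes c: "c \<in> charts M" and u: "u \<in> cdom c"
  defines "x \<equiv> \<lambda>u. X (cmap c u)"
  shows "form K (\<Sum>i\<in>UNIV. v $ i *\<^sub>R (\<Sum>j\<in>UNIV. v $ j *\<^sub>R partial j (partial i x) u)
         + v' $ i *\<^sub>R partial i x u) (partial m x u)
    = (cmet c u *v (v' - (\<chi> k. - (\<Sum>i\<in>UNIV. \<Sum>j\<in>UNIV. christoffel (cmet c) k i j u * v $ i * v $ j)))) $ m"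
proof -
  define \<Gamma> where "\<Gamma> k i j = christoffel (cmet c) k i j u" for k i j
  have g: "(\<Sum>k\<in>UNIV. cmet c u $ m $ k * \<Gamma> k i j) = form K (partial i (partial j x) u) (partial m x u)" for i j
    unfolding \<Gamma>_def x_def
    by (rule gauss_formula[OF chart_dom_open[OF c] smooth[OF c] u metric[OF c]])
       (auto intro: invertible_metric c u)
  have gp: "form K (partial i x u) (partial m x u) = cmet c u $ m $ i" for i
    using metric[OF c u] by (simp add: pullback_def x_def form_commute)
  have "form K (\<Sum>i\<in>UNIV. v $ i *\<^sub>R (\<Sum>j\<in>UNIV. v $ j *\<^sub>R partial j (partial i x) u)
         + v' $ i *\<^sub>R partial i x u) (partial m x u)
    = (\<Sum>i\<in>UNIV. v $ i * (\<Sum>j\<in>UNIV. v $ j * (\<Sum>k\<in>UNIV. cmet c u $ m $ k * \<Gamma> k j i)) + v' $ i * cmet c u $ m $ i)"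
    by (simp only: form_simps real_scaleR_def g gp)
  also have "\<dots> = (cmet c u *v (v' - (\<chi> k. - (\<Sum>i\<in>UNIV. \<Sum>j\<in>UNIV. \<Gamma> k i j * v $ i * v $ j)))) $ m"
    by (simp add: matrix_vector_mult_def sum_2 algebra_simps)
  finally show ?thesis unfolding \<Gamma>_def .
qed

text \<open>The geodesic equation annihilates the tangential part of the acceleration
  \<open>A\<close>, and the equation of the quadric fixes its normal part. Hence
  \<open>A + K *\<^sub>R X (\<gamma> t)\<close> is tangent and orthogonal to the tangent plane, so
  it is 0.\<close>

lemma geodesic_embedded:
  assumes "geodesic M \<gamma>"
  shows "((\<lambda>t. vector_derivative (\<lambda>s. X (\<gamma> s)) (at t)) has_vector_derivative - K *\<^sub>R X (\<gamma> t)) (at t)"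
proof -
  define D where "D t = vector_derivative (\<lambda>s. X (\<gamma> s)) (at t)" for t
  have us: "unit_speed_curve M \<gamma>" using assms by (simp add: geodesic_def)
  note D = unit_speed_embedded[OF us, folded D_def]
  have cont: "continuous_map euclideanreal (surface_topology M) \<gamma>"
    using us by (simp add: unit_speed_curve_def)
  obtain c where c: "c \<in> charts M" "\<gamma> t \<in> cimage c" using point_in_chart D(4) by blast
  define x where "x = (\<lambda>u. X (cmap c u))"
  define u where "u s = coords c (\<gamma> s)" for s
  define v where "v = velocity c \<gamma>"
  define v' where "v' = (\<chi> k. - (\<Sum>i\<in>UNIV. \<Sum>j\<in>UNIV. christoffel (cmet c) k i j (u t) * v t $ i * v t $ j))"
  have ut: "u t \<in> cdom c" "cmap c (u t) = \<gamma> t" using coords_inverse[OF c(2)] by (auto simp: u_def)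
  have "(\<lambda>s. coords c (\<gamma> s)) differentiable (at t)"
    using us c by (auto simp: unit_speed_curve_def)
  then have u': "(u has_vector_derivative v t) (at t)"
    by (simp add: u_def[abs_def] v_def velocity_def vector_derivative_works)
  have v': "(v has_vector_derivative v') (at t)"
    using assms c by (auto simp: geodesic_def v_def v'_def u_def)
  define A where "A = (\<Sum>i\<in>UNIV. v t $ i *\<^sub>R (\<Sum>j\<in>UNIV. v t $ j *\<^sub>R partial j (partial i x) (u t))
         + v' $ i *\<^sub>R partial i x (u t))"
  have "((\<lambda>s. \<Sum>i\<in>UNIV. v s $ i *\<^sub>R partial i x (u s)) has_vector_derivative A) (at t)"
    unfolding A_def x_def by (rule acceleration[OF c(1) u' ut(1) v'])
  then have D': "(D has_vector_derivative A) (at t)"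
    by (rule has_vector_derivative_transform_within_open[OF _ preimage_open[OF cont cimage_open[OF c(1)]]])
       (use c D(6) in \<open>auto simp: v_def u_def x_def\<close>)
  have formA: "form K A (partial m x (u t)) = 0" for m
    unfolding A_def using form_acceleration[OF c(1) ut(1), of "v t" v' m]
    by (simp add: x_def v'_def[symmetric])
  have tan: "dual_form K (X (\<gamma> t)) (partial m x (u t)) = 0" for m
    using tangent_partial[OF c(1) ut(1)] ut(2) by (simp add: x_def)
  \<comment> \<open>The tangency condition on the velocity is differentiated; unit speed makes the
    second term equal to \<open>K\<close>.\<close>
  have "((\<lambda>s. dual_form K (X (\<gamma> s)) (D s)) has_vector_derivative
      dual_form K (X (\<gamma> t)) A + dual_form K (D t) (D t)) (at t)"
    by (rule bounded_bilinear.has_vector_derivative[OF bounded_bilinear_dual_form D(1) D'])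
  moreover have "((\<lambda>s. dual_form K (X (\<gamma> s)) (D s)) has_vector_derivative 0) (at t)"
    using D(5) by simp
  ultimately have "dual_form K (X (\<gamma> t)) A + dual_form K (D t) (D t) = 0"
    by (rule vector_derivative_unique_at)
  moreover have "dual_form K (D t) (D t) = K"
  proof -
    obtain w where w: "D t $ 3 = K * w"
      using tangent_third_component[OF X_in_quadric[OF D(4)] D(5)] by metis
    have "dual_form K (D t) (D t) = K * form K (D t) (D t)"
      unfolding form_third_component[OF w w] by (simp add: dual_form_def w algebra_simps)
    then show ?thesis using D(3) by simp
  qed
  ultimately have "dual_form K (X (\<gamma> t)) (A + K *\<^sub>R X (\<gamma> t)) = 0"
    using X_in_quadric[OF D(4)] by (simp add: dual_form_simps quadric_def)
  moreover have "form K (A + K *\<^sub>R X (\<gamma> t)) (partial m x (u t)) = 0" for m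
    using formA[of m] K_form[OF tan[of m]] by (simp add: form_simps)
  moreover have "form K (partial 1 x (u t)) (partial 1 x (u t)) * form K (partial 2 x (u t)) (partial 2 x (u t))
     \<noteq> (form K (partial 1 x (u t)) (partial 2 x (u t)))\<^sup>2"
    using invertible_metric[OF c(1) ut(1)] metric[OF c(1) ut(1)]
    by (simp add: invertible_det_nz det_2 pullback_def x_def power2_eq_square form_commute)
  ultimately have "A + K *\<^sub>R X (\<gamma> t) = 0"
    using tangent_eq_zero[OF X_in_quadric[OF D(4)[of t]] tan[of 1] tan[of 2]] by blast
  then have "A = - K *\<^sub>R X (\<gamma> t)" by (simp add: eq_neg_iff_add_eq_0)
  then show ?thesis using D' by (simp add: D_def[abs_def])
qed

text \<open>The coordinate velocity is determined by the linear system whose matrix is the metric.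
  The last conclusion expresses it through \<open>D\<close> and the partial derivatives of the chart
  alone, so that its regularity can be read off.\<close>

lemma lift_coords:
  assumes Y: "\<And>t. (Y has_vector_derivative D t) (at t)" and \<sigma>: "\<And>t. \<sigma> t \<in> points M" "\<And>t. X (\<sigma> t) = Y t"
    and c: "c \<in> charts M" "\<sigma> t \<in> cimage c"
  defines "x \<equiv> \<lambda>u. X (cmap c u)" and "u \<equiv> \<lambda>t. coords c (\<sigma> t)"
  shows lift_cont: "continuous_map euclideanreal (surface_topology M) \<sigma>"
    and "u differentiable (at t)"
    and "D t = (\<Sum>i\<in>UNIV. velocity c \<sigma> t $ i *\<^sub>R partial i x (u t))"
    and "velocity c \<sigma> t = solve2 (pullback K x (u t)) (\<chi> i. form K (D t) (partial i x (u t)))"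
proof -
  have contY: "continuous_on UNIV Y"
    using Y by (meson continuous_at_imp_continuous_on has_vector_derivative_continuous)
  then show cont: "continuous_map euclideanreal (surface_topology M) \<sigma>"
    using lift_continuous \<sigma> by blast
  show diff: "u differentiable (at t)"
  proof -
    obtain V and \<Phi> :: "real^3 \<Rightarrow> real^2" where V: "open V" "X (\<sigma> t) \<in> V" "\<And>y. y \<in> V \<Longrightarrow> \<Phi> differentiable (at y)"
      "\<And>q. q \<in> points M \<Longrightarrow> X q \<in> V \<Longrightarrow> q \<in> cimage c \<and> coords c q = \<Phi> (X q)"
      using local_inverse[OF c] by blast
    have "open (Y -` V)"
      using contY V(1) continuous_on_open_vimage[of UNIV Y] by (metis Int_UNIV_right open_UNIV)
    have "(\<Phi> \<circ> Y) differentiable (at t)"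
      using V(2,3) \<sigma>(2) Y by (intro differentiable_chain_at differentiableI_vector) auto
    then obtain E where "((\<Phi> \<circ> Y) has_derivative E) (at t)" by (auto simp: differentiable_def)
    then have "(u has_derivative E) (at t)"
      by (rule has_derivative_transform_within_open[OF _ \<open>open (Y -` V)\<close>])
         (use V \<sigma> in \<open>auto simp: u_def\<close>)
    then show ?thesis by (auto simp: differentiable_def)
  qed
  have "(Y has_vector_derivative (\<Sum>i\<in>UNIV. velocity c \<sigma> t $ i *\<^sub>R partial i x (u t))) (at t)"
    using X_velocity[OF cont c] diff \<sigma>(2) by (simp add: u_def x_def)
  then show D: "D t = (\<Sum>i\<in>UNIV. velocity c \<sigma> t $ i *\<^sub>R partial i x (u t))"
    using Y vector_derivative_unique_at by blast
  have "(\<chi> i. form K (D t) (partial i x (u t))) = pullback K x (u t) *v velocity c \<sigma> t"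
    unfolding D form_pullback_axis by simp
  moreover have "invertible (pullback K x (u t))"
    using invertible_metric[OF c(1)] metric[OF c(1)] coords_inverse(1)[OF c(2)] by (simp add: x_def u_def)
  ultimately show "velocity c \<sigma> t = solve2 (pullback K x (u t)) (\<chi> i. form K (D t) (partial i x (u t)))"
    by (simp add: solve2)
qed

lemma unit_speed_lift:
  assumes Y: "\<And>t. (Y has_vector_derivative D t) (at t)" and \<sigma>: "\<And>t. \<sigma> t \<in> points M" "\<And>t. X (\<sigma> t) = Y t"
    and D: "continuous_on UNIV D" "\<And>t. form K (D t) (D t) = 1"
  shows "unit_speed_curve M \<sigma>"
  unfolding unit_speed_curve_def
proof (intro conjI ballI)
  obtain c where "c \<in> charts M" "\<sigma> 0 \<in> cimage c" using point_in_chart \<sigma>(1) by blast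
  then show cont: "continuous_map euclideanreal (surface_topology M) \<sigma>" by (rule lift_cont[OF Y \<sigma>])
  fix c assume c: "c \<in> charts M"
  define x where "x = (\<lambda>u. X (cmap c u))"
  define u where "u t = coords c (\<sigma> t)" for t
  let ?I = "\<sigma> -` cimage c"
  note L = lift_coords[OF Y \<sigma> c, folded x_def u_def]
  have uc: "continuous_on ?I u"
    using L(2) by (auto intro!: continuous_at_imp_continuous_on differentiable_imp_continuous_within)
  have p: "continuous_on ?I (\<lambda>t. partial i x (u t))" for i
  proof (rule continuous_on_compose2[OF _ uc])
    show "continuous_on (cdom c) (partial i x)"
      using smooth[OF c] C_on_le[of 1 "cdom c" "partial i x" 0]
      by (simp add: numeral_2_eq_2 x_def)
  qed (auto simp: coords_inverse u_def)
  have g: "continuous_on ?I (\<lambda>t. pullback K x (u t) $ i $ j)" for i j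
    unfolding pullback_def
    by (simp add: bounded_bilinear.continuous_on[OF bounded_bilinear_form p p])
  have b: "continuous_on ?I (\<lambda>t. form K (D t) (partial i x (u t)))" for i
    by (rule bounded_bilinear.continuous_on[OF bounded_bilinear_form continuous_on_subset[OF D(1)] p]) simp
  have "pullback K x (u t) $ 1 $ 1 * pullback K x (u t) $ 2 $ 2 - pullback K x (u t) $ 1 $ 2 * pullback K x (u t) $ 2 $ 1 \<noteq> 0"
    if "t \<in> ?I" for t
    using invertible_metric[OF c, of "u t"] metric[OF c, of "u t"] that coords_inverse(1)[of "\<sigma> t" c]
    by (auto simp: invertible_det_nz det_2 u_def x_def)
  then have "continuous_on ?I (\<lambda>t. solve2 (pullback K x (u t)) (\<chi> i. form K (D t) (partial i x (u t))) $ k)" for k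
    unfolding solve2_def by (cases "k = 1") (auto intro!: continuous_intros g b)
  then have "continuous_on ?I (\<lambda>t. \<chi> k. solve2 (pullback K x (u t)) (\<chi> i. form K (D t) (partial i x (u t))) $ k)"
    by (rule continuous_on_vec_lambda)
  then show "continuous_on ?I (velocity c \<sigma>)"
    by (rule continuous_on_eq) (use L(4) in auto)
  fix t assume t: "t \<in> ?I"
  then show "(\<lambda>s. coords c (\<sigma> s)) differentiable (at t)" using L(2)[of t] by (simp add: u_def[abs_def])
  have "u t \<in> cdom c" using t coords_inverse(1)[of "\<sigma> t" c] by (auto simp: u_def)
  then show "velocity c \<sigma> t \<bullet> (cmet c (coords c (\<sigma> t)) *v velocity c \<sigma> t) = 1"
    using D(2)[of t] L(3)[of t] t metric[OF c, of "u t"] form_pullback[of K "velocity c \<sigma> t" x "u t" "velocity c \<sigma> t"]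
    by (simp add: u_def x_def)
qed

text \<open>The converse of \<open>geodesic_embedded\<close>. The coordinate velocity is first shown
  to be differentiable by the formula with \<open>solve2\<close>; then the acceleration
  \<open>- K *\<^sub>R Y t\<close> has no tangential part, and \<open>form_acceleration\<close>
  yields the geodesic equation.\<close>

lemma geodesic_lift:
  assumes Y: "\<And>t. (Y has_vector_derivative D t) (at t)" and \<sigma>: "\<And>t. \<sigma> t \<in> points M" "\<And>t. X (\<sigma> t) = Y t"
    and D: "\<And>t. (D has_vector_derivative - K *\<^sub>R Y t) (at t)" "\<And>t. form K (D t) (D t) = 1"
  shows "geodesic M \<sigma>"
  unfolding geodesic_def
proof (intro conjI ballI)
  have "continuous_on UNIV D"
    using D(1) by (meson continuous_at_imp_continuous_on has_vector_derivative_continuous)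
  then show us: "unit_speed_curve M \<sigma>" using unit_speed_lift[OF Y \<sigma>] D(2) by blast
  fix c t assume c: "c \<in> charts M" and t: "t \<in> \<sigma> -` cimage c"
  define x where "x = (\<lambda>u. X (cmap c u))"
  define u where "u t = coords c (\<sigma> t)" for t
  define v where "v = velocity c \<sigma>"
  define \<Gamma> where "\<Gamma> = (\<chi> k. - (\<Sum>i\<in>UNIV. \<Sum>j\<in>UNIV. christoffel (cmet c) k i j (u t) * v t $ i * v t $ j))"
  let ?I = "\<sigma> -` cimage c"
  note L = lift_coords[OF Y \<sigma> c, folded x_def u_def v_def]
  have op: "open ?I"
    using preimage_open[OF L(1) cimage_open[OF c]] t by auto
  have ut: "u t \<in> cdom c" "cmap c (u t) = \<sigma> t" using t coords_inverse[of "\<sigma> t" c] by (auto simp: u_def)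
  have u': "(u has_vector_derivative v t) (at t)"
    using L(2) t by (simp add: v_def velocity_def u_def[abs_def] vector_derivative_works)
  have p: "(\<lambda>s. partial i x (u s)) differentiable (at t)" for i
  proof -
    have "partial i x differentiable (at (u t))"
      using smooth[OF c] ut by (simp add: x_def numeral_2_eq_2)
    from has_vector_derivative_partial[of "partial i x", OF this u'] show ?thesis
      by (rule differentiableI_vector)
  qed
  have bl: "(\<lambda>s. form K (f s) (g s)) differentiable (at t)"
    if "f differentiable (at t)" "g differentiable (at t)" for f g :: "real \<Rightarrow> real^3"
    using that bounded_bilinear.FDERIV[OF bounded_bilinear_form] unfolding differentiable_def by blast
  have g: "(\<lambda>s. pullback K x (u s) $ i $ j) differentiable (at t)" for i j
    unfolding pullback_def using bl[OF p p] by simp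
  have b: "(\<lambda>s. form K (D s) (partial i x (u s))) differentiable (at t)" for i
    by (rule bl[OF differentiableI_vector[OF D(1)] p])
  have nz: "pullback K x (u t) $ 1 $ 1 * pullback K x (u t) $ 2 $ 2 - pullback K x (u t) $ 1 $ 2 * pullback K x (u t) $ 2 $ 1 \<noteq> 0"
    using invertible_metric[OF c ut(1)] metric[OF c ut(1)] by (auto simp: invertible_det_nz det_2 x_def)
  have sk: "(\<lambda>t. solve2 (pullback K x (u t)) (\<chi> i. form K (D t) (partial i x (u t))) $ k) differentiable (at t)" for k
    unfolding solve2_def using nz
    by (cases "k = 1") (auto intro!: differentiable_divide differentiable_diff differentiable_mult g b)
  have "(\<lambda>t. \<Sum>k\<in>UNIV. solve2 (pullback K x (u t)) (\<chi> i. form K (D t) (partial i x (u t))) $ k *\<^sub>R axis k (1::real))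
    differentiable (at t)"
    by (intro differentiable_sum ballI differentiable_scaleR sk differentiable_const) simp
  then obtain v' where "((\<lambda>t. \<Sum>k\<in>UNIV. solve2 (pullback K x (u t)) (\<chi> i. form K (D t) (partial i x (u t))) $ k *\<^sub>R axis k (1::real))
    has_vector_derivative v') (at t)"
    using vector_derivative_works by blast
  then have v': "(v has_vector_derivative v') (at t)"
  proof (rule has_vector_derivative_transform_within_open[OF _ op t])
    fix s assume "s \<in> ?I"
    then have "v s = solve2 (pullback K x (u s)) (\<chi> i. form K (D s) (partial i x (u s)))" using L(4) by auto
    then show "(\<Sum>k\<in>UNIV. solve2 (pullback K x (u s)) (\<chi> i. form K (D s) (partial i x (u s))) $ k *\<^sub>R axis k (1::real)) = v s"
      using basis_expansion[of "v s"] by (simp add: scalar_mult_eq_scaleR)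
  qed
  define A where "A = (\<Sum>i\<in>UNIV. v t $ i *\<^sub>R (\<Sum>j\<in>UNIV. v t $ j *\<^sub>R partial j (partial i x) (u t))
         + v' $ i *\<^sub>R partial i x (u t))"
  have "((\<lambda>s. \<Sum>i\<in>UNIV. v s $ i *\<^sub>R partial i x (u s)) has_vector_derivative A) (at t)"
    unfolding A_def x_def by (rule acceleration[OF c u' ut(1) v'])
  then have "(D has_vector_derivative A) (at t)"
    by (rule has_vector_derivative_transform_within_open[OF _ op t]) (use L(3) in auto)
  then have A: "A = - K *\<^sub>R Y t" using D(1) vector_derivative_unique_at by blast
  have "form K A (partial m x (u t)) = 0" for m
    using K_form[OF tangent_partial[OF c ut(1)]] ut(2) \<sigma>(2) by (simp add: A form_simps bounded_bilinear.minus_left[OF bounded_bilinear_form] x_def)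
  then have "(cmet c (u t) *v (v' - \<Gamma>)) $ m = 0" for m
    using form_acceleration[OF c ut(1), of "v t" v' m] by (simp add: A_def x_def \<Gamma>_def)
  then have "cmet c (u t) *v (v' - \<Gamma>) = 0" by (simp add: vec_eq_iff)
  then have "v' - \<Gamma> = 0"
    using solve2[OF invertible_metric[OF c ut(1)], of "v' - \<Gamma>"] solve2[OF invertible_metric[OF c ut(1)], of 0] by simp
  then show "(velocity c \<sigma> has_vector_derivative
           (\<chi> k. - (\<Sum>i\<in>UNIV. \<Sum>j\<in>UNIV. christoffel (cmet c) k i j (coords c (\<sigma> t))
                        * velocity c \<sigma> t $ i * velocity c \<sigma> t $ j))) (at t)"
    using v' by (simp add: \<Gamma>_def v_def u_def)
qed

end

section \<open>Explicit geodesics and isometries of the quadric\<close>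

lemma has_vector_derivative_scaleR_const:
  "(f has_real_derivative f') (at t) \<Longrightarrow> ((\<lambda>t. f t *\<^sub>R P) has_vector_derivative f' *\<^sub>R P) (at t)"
  using has_vector_derivative_scaleR[of f f' t UNIV "\<lambda>_. P" 0] by simp

text \<open>The two combinations of \<open>Y\<close> and \<open>D\<close> in the proof are constants
  of motion. By \<open>cs_sn_square\<close> they can be solved for \<open>Y\<close>, which gives
  uniqueness of the solution directly.\<close>

lemma harmonic_solution:
  fixes Y D :: "real \<Rightarrow> 'b::real_normed_vector"
  assumes Y: "\<And>t. (Y has_vector_derivative D t) (at t)"
    and D: "\<And>t. (D has_vector_derivative - K *\<^sub>R Y t) (at t)"
  shows "Y (a + s) = cs K s *\<^sub>R Y a + sn K s *\<^sub>R D a"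
proof -
  have "((\<lambda>s. a + s) has_vector_derivative 1) (at s)" for s
    by (auto intro!: derivative_eq_intros simp flip: has_real_derivative_iff_has_vector_derivative)
  note shift = vector_diff_chain_at[OF this]
  have Y': "((\<lambda>s. Y (a + s)) has_vector_derivative D (a + s)) (at s)" for s
    using shift[OF Y] by (simp add: o_def)
  have D': "((\<lambda>s. D (a + s)) has_vector_derivative - K *\<^sub>R Y (a + s)) (at s)" for s
    using shift[OF D] by (simp add: o_def)
  have "((\<lambda>s. cs K s *\<^sub>R Y (a + s) - sn K s *\<^sub>R D (a + s)) has_vector_derivative
      (cs K s *\<^sub>R D (a + s) + (- K * sn K s) *\<^sub>R Y (a + s)) -
      (sn K s *\<^sub>R (- K *\<^sub>R Y (a + s)) + cs K s *\<^sub>R D (a + s))) (at s)" for s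
    by (intro has_vector_derivative_diff has_vector_derivative_scaleR DERIV_cs DERIV_sn Y' D')
  then have "((\<lambda>s. cs K s *\<^sub>R Y (a + s) - sn K s *\<^sub>R D (a + s)) has_vector_derivative 0) (at s)" for s
    by (simp add: algebra_simps)
  then obtain C where C: "cs K s *\<^sub>R Y (a + s) - sn K s *\<^sub>R D (a + s) = C" for s
    using has_vector_derivative_zero_constant[of UNIV] by (metis (no_types, lifting) UNIV_I convex_UNIV)
  have "((\<lambda>s. (K * sn K s) *\<^sub>R Y (a + s) + cs K s *\<^sub>R D (a + s)) has_vector_derivative
      ((K * sn K s) *\<^sub>R D (a + s) + (K * cs K s) *\<^sub>R Y (a + s)) +
      (cs K s *\<^sub>R (- K *\<^sub>R Y (a + s)) + (- K * sn K s) *\<^sub>R D (a + s))) (at s)" for s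
    by (intro has_vector_derivative_add has_vector_derivative_scaleR DERIV_cs DERIV_cmult DERIV_sn Y' D')
  then have "((\<lambda>s. (K * sn K s) *\<^sub>R Y (a + s) + cs K s *\<^sub>R D (a + s)) has_vector_derivative 0) (at s)" for s
    by (simp add: algebra_simps)
  then obtain C' where C': "(K * sn K s) *\<^sub>R Y (a + s) + cs K s *\<^sub>R D (a + s) = C'" for s
    using has_vector_derivative_zero_constant[of UNIV] by (metis (no_types, lifting) UNIV_I convex_UNIV)
  have "((cs K s)\<^sup>2 + K * (sn K s)\<^sup>2) *\<^sub>R Y (a + s)
     = cs K s *\<^sub>R (cs K s *\<^sub>R Y (a + s) - sn K s *\<^sub>R D (a + s))
       + sn K s *\<^sub>R ((K * sn K s) *\<^sub>R Y (a + s) + cs K s *\<^sub>R D (a + s))"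
    by (simp add: algebra_simps power2_eq_square)
  then have "Y (a + s) = cs K s *\<^sub>R C + sn K s *\<^sub>R C'"
    unfolding C C' cs_sn_square by simp
  moreover have "C = Y a" "C' = D a" using C[of 0] C'[of 0] by auto
  ultimately show ?thesis by simp
qed

lemma dual_form_K:
  assumes "y \<in> quadric K" "dual_form K y v = 0"
  shows "dual_form K v v = K * form K v v"
proof -
  obtain w where w: "v$3 = K * w" using tangent_third_component[OF assms] by metis
  show ?thesis unfolding form_third_component[OF w w] by (simp add: dual_form_def w algebra_simps)
qed

text \<open>The quadratic equation follows from \<open>cs_sn_square\<close>. The sheet is never
  left: by the intermediate value theorem the third component would vanish somewhere, and there
  \<open>dual_form\<close> is nonpositive when \<open>K \<le> 0\<close>.\<close>

lemma circle_in_quadric: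
  assumes P: "P \<in> quadric K" and V: "dual_form K P V = 0" "form K V V = 1"
  shows "cs K t *\<^sub>R P + sn K t *\<^sub>R V \<in> quadric K"
proof -
  let ?Y = "\<lambda>t. cs K t *\<^sub>R P + sn K t *\<^sub>R V"
  have PP: "dual_form K P P = 1" using P by (simp add: quadric_def)
  have VV: "dual_form K V V = K" using dual_form_K[OF P V(1)] V(2) by simp
  have VP: "dual_form K V P = 0" using V(1) by (simp add: dual_form_commute)
  have d: "dual_form K (?Y t) (?Y t) = 1" for t
    using cs_sn_square[of K t]
    by (simp add: dual_form_simps PP VV V(1) VP power2_eq_square algebra_simps)
  have "?Y t $ 3 > 0" if "K \<le> 0"
  proof (rule ccontr)
    assume "\<not> ?Y t $ 3 > 0"
    moreover have "?Y 0 $ 3 > 0" using P that by (simp add: quadric_def)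
    moreover have cont: "continuous_on A (\<lambda>t. ?Y t $ 3)" for A by (intro continuous_intros)
    ultimately have "\<exists>s. ?Y s $ 3 = 0"
      using IVT'[of "\<lambda>t. ?Y t $ 3" t 0 0, OF _ _ _ cont] IVT2'[of "\<lambda>t. ?Y t $ 3" t 0 0, OF _ _ _ cont]
      by (cases "t \<le> 0") force+
    then obtain s where s: "?Y s $ 3 = 0" by blast
    have "dual_form K (?Y s) (?Y s) = K * ((?Y s $ 1)\<^sup>2 + (?Y s $ 2)\<^sup>2)"
      unfolding dual_form_def s by (simp add: power2_eq_square)
    also have "\<dots> \<le> 0" using that by (simp add: mult_nonpos_nonneg)
    finally show False using d[of s] by simp
  qed
  then show ?thesis using d by (simp add: quadric_def)
qed

text \<open>A reversed Cauchy-Schwarz argument: on the upper sheet the product of the third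
  components exceeds the contribution of the other two. It is used to tell the two sheets
  apart.\<close>

lemma dual_form_quadric_pos:
  assumes "x \<in> quadric K" "y \<in> quadric K" "K \<le> 0"
  shows "dual_form K x y > 0"
proof -
  define k where "k = - K"
  have k: "k \<ge> 0" using assms by (simp add: k_def)
  have x: "(x$3)\<^sup>2 = 1 + k * ((x$1)\<^sup>2 + (x$2)\<^sup>2)" "x$3 > 0" and y: "(y$3)\<^sup>2 = 1 + k * ((y$1)\<^sup>2 + (y$2)\<^sup>2)" "y$3 > 0"
    using assms by (auto simp: quadric_def dual_form_def k_def power2_eq_square algebra_simps)
  have cs: "(x$1 * y$1 + x$2 * y$2)\<^sup>2 \<le> ((x$1)\<^sup>2 + (x$2)\<^sup>2) * ((y$1)\<^sup>2 + (y$2)\<^sup>2)"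
  proof -
    have "((x$1)\<^sup>2 + (x$2)\<^sup>2) * ((y$1)\<^sup>2 + (y$2)\<^sup>2) - (x$1 * y$1 + x$2 * y$2)\<^sup>2 = (x$1 * y$2 - x$2 * y$1)\<^sup>2"
      by (simp add: power2_eq_square algebra_simps)
    then show ?thesis using zero_le_power2[of "x$1 * y$2 - x$2 * y$1"] by linarith
  qed
  have "(k * (x$1 * y$1 + x$2 * y$2))\<^sup>2 \<le> k\<^sup>2 * (((x$1)\<^sup>2 + (x$2)\<^sup>2) * ((y$1)\<^sup>2 + (y$2)\<^sup>2))"
    unfolding power_mult_distrib[of k] using cs by (intro mult_left_mono) auto
  also have "\<dots> < (1 + k * ((x$1)\<^sup>2 + (x$2)\<^sup>2)) * (1 + k * ((y$1)\<^sup>2 + (y$2)\<^sup>2))"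
  proof -
    have "0 \<le> k * ((x$1)\<^sup>2 + (x$2)\<^sup>2)" "0 \<le> k * ((y$1)\<^sup>2 + (y$2)\<^sup>2)" using k by auto
    then show ?thesis by (simp add: algebra_simps power2_eq_square)
  qed
  also have "\<dots> = (x$3 * y$3)\<^sup>2" by (simp add: power_mult_distrib x y)
  finally have "k * (x$1 * y$1 + x$2 * y$2) < x$3 * y$3"
    by (rule power2_less_imp_less) (use x y in simp)
  then show ?thesis by (simp add: dual_form_def k_def)
qed

text \<open>Invariance of \<open>form K\<close> is demanded on tangent vectors only. For
  \<open>K = 0\<close> the map acts as a Euclidean motion of the plane \<open>x$3 = 1\<close>, and
  its translation part changes \<open>form\<close> on other vectors.\<close>

definition quadric_iso :: "real \<Rightarrow> (real^3 \<Rightarrow> real^3) \<Rightarrow> (real^3 \<Rightarrow> real^3) \<Rightarrow> bool" where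
  "quadric_iso K A B \<longleftrightarrow> bounded_linear A \<and> bounded_linear B \<and> (\<forall>x. B (A x) = x) \<and> (\<forall>y. A (B y) = y) \<and>
     A ` quadric K = quadric K \<and>
     (\<forall>y\<in>quadric K. \<forall>a b. dual_form K y a = 0 \<longrightarrow> dual_form K y b = 0 \<longrightarrow> form K (A a) (A b) = form K a b)"

text \<open>An isometry of the quadric that takes a given unit tangent vector \<open>V\<close> at \<open>P\<close> to the first
  basis vector at the third one. Its inverse has the columns \<open>V\<close>, \<open>N\<close>, \<open>P\<close>, where \<open>N\<close> is the
  cross product of \<open>P\<close> and \<open>V\<close>.\<close>

lemma quadric_isometry:
  assumes P: "P \<in> quadric K" and V: "dual_form K P V = 0" "form K V V = 1"
  obtains A B where "quadric_iso K A B" "A P = axis 3 1" "A V = axis 1 1"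
proof -
  obtain w where w: "V$3 = K * w" "P$1 * V$1 + P$2 * V$2 + P$3 * w = 0"
    using tangent_third_component[OF P V(1)] .
  define p1 p2 p3 v1 v2 where pv: "p1 = P$1" "p2 = P$2" "p3 = P$3" "v1 = V$1" "v2 = V$2"
  \<comment> \<open>The column \<open>N\<close> of the inverse is \<open>(n1, n2, K * n3)\<close>:
    the cross product with its third component multiplied by \<open>K\<close>, which makes it
    tangent at \<open>P\<close>. So \<open>n3\<close> plays the part that \<open>w\<close> plays for
    \<open>V\<close>.\<close>
  define n1 where "n1 = p2 * (K * w) - p3 * v2"
  define n2 where "n2 = p3 * v1 - p1 * (K * w)"
  define n3 where "n3 = p1 * v2 - p2 * v1"
  have PP: "K * (p1 * p1 + p2 * p2) + p3 * p3 = 1"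
    using P by (simp add: quadric_def dual_form_def pv)
  have PV: "p1 * v1 + p2 * v2 + p3 * w = 0" using w(2) by (simp add: pv)
  have VV: "v1 * v1 + v2 * v2 + K * w * w = 1"
    using V(2) unfolding form_third_component[OF w(1) w(1)] by (simp add: pv)
  \<comment> \<open>Lagrange's identity for the length of a cross product, adapted to the two
    forms.\<close>
  have NN: "n1 * n1 + n2 * n2 + K * n3 * n3 = 1"
  proof -
    have "n1 * n1 + n2 * n2 + K * n3 * n3
      = (K * (p1 * p1 + p2 * p2) + p3 * p3) * (v1 * v1 + v2 * v2 + K * w * w) - K * (p1 * v1 + p2 * v2 + p3 * w)\<^sup>2"
      unfolding n1_def n2_def n3_def power2_eq_square by (simp add: algebra_simps)
    then show ?thesis unfolding PP PV VV by simp
  qed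
  have NV: "n1 * v1 + n2 * v2 + K * n3 * w = 0" "n1 * p1 + n2 * p2 + n3 * p3 = 0"
    unfolding n1_def n2_def n3_def by algebra+
  define MA :: "real^3^3" where "MA = vector [vector [v1, v2, w], vector [n1, n2, n3], vector [K * p1, K * p2, p3]]"
  define MB :: "real^3^3" where "MB = vector [vector [v1, n1, p1], vector [v2, n2, p2], vector [K * w, K * n3, p3]]"
  have e1: "v1 * v1 + v2 * v2 + w * (K * w) = 1" "v1 * n1 + v2 * n2 + w * (K * n3) = 0" "v1 * p1 + v2 * p2 + w * p3 = 0"
    using VV NV PV by (simp_all add: mult_ac)
  have e2: "n1 * v1 + n2 * v2 + n3 * (K * w) = 0" "n1 * n1 + n2 * n2 + n3 * (K * n3) = 1" "n1 * p1 + n2 * p2 + n3 * p3 = 0"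
    using NN NV by (simp_all add: mult_ac)
  have e3: "K * (p1 * v1 + p2 * v2) + p3 * (K * w) = 0" "K * (p1 * n1 + p2 * n2) + p3 * (K * n3) = 0"
    "K * (p1 * p1 + p2 * p2) + p3 * p3 = 1"
  proof -
    have "K * (p1 * v1 + p2 * v2) + p3 * (K * w) = K * (p1 * v1 + p2 * v2 + p3 * w)"
      "K * (p1 * n1 + p2 * n2) + p3 * (K * n3) = K * (n1 * p1 + n2 * p2 + n3 * p3)"
      by (simp_all add: algebra_simps)
    then show "K * (p1 * v1 + p2 * v2) + p3 * (K * w) = 0" "K * (p1 * n1 + p2 * n2) + p3 * (K * n3) = 0"
      unfolding PV NV by simp_all
  qed (rule PP)
  have e3': "K * p1 * v1 + K * p2 * v2 + p3 * (K * w) = 0" "K * p1 * n1 + K * p2 * n2 + p3 * (K * n3) = 0"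
    "K * p1 * p1 + K * p2 * p2 + p3 * p3 = 1"
    using e3 by (simp_all add: distrib_left mult.assoc)
  have AB: "MA ** MB = mat 1"
    unfolding vec_eq_iff forall_3 MA_def MB_def matrix_matrix_mult_def mat_def sum_3
    by (simp add: e1 e2 e3' del: mult.assoc)
  then have BA: "MB ** MA = mat 1" by (simp add: matrix_left_right_inverse)
  define A B where "A = (\<lambda>x. MA *v x)" "B = (\<lambda>x. MB *v x)"
  have inv: "B (A x) = x" "A (B x) = x" for x
    using AB BA by (simp_all add: A_B_def matrix_vector_mul_assoc)
  have lin: "bounded_linear A" "bounded_linear B"
    by (auto simp: A_B_def matrix_vector_mul_bounded_linear)
  have A_comp: "A x $ 1 = v1 * x$1 + v2 * x$2 + w * x$3" "A x $ 2 = n1 * x$1 + n2 * x$2 + n3 * x$3"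
    "A x $ 3 = K * (p1 * x$1 + p2 * x$2) + p3 * x$3" for x
    by (simp_all add: A_B_def MA_def matrix_vector_mult_def sum_3 algebra_simps)
  have B_comp: "B y $ 1 = v1 * y$1 + n1 * y$2 + p1 * y$3" "B y $ 2 = v2 * y$1 + n2 * y$2 + p2 * y$3"
    "B y $ 3 = K * w * y$1 + K * n3 * y$2 + p3 * y$3" for y
    by (simp_all add: A_B_def MB_def matrix_vector_mult_def sum_3 algebra_simps)
  have dB: "dual_form K (B y) (B z) = dual_form K y z" for y z
  proof -
    have "dual_form K (B y) (B z) = (v1 * v1 + v2 * v2 + K * w * w) * (K * y$1 * z$1)
      + (n1 * n1 + n2 * n2 + K * n3 * n3) * (K * y$2 * z$2)
      + (K * (p1 * p1 + p2 * p2) + p3 * p3) * (y$3 * z$3)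
      + (n1 * v1 + n2 * v2 + K * n3 * w) * (K * (y$1 * z$2 + y$2 * z$1))
      + (p1 * v1 + p2 * v2 + p3 * w) * (K * (y$1 * z$3 + y$3 * z$1))
      + (n1 * p1 + n2 * p2 + n3 * p3) * (K * (y$2 * z$3 + y$3 * z$2))"
      unfolding dual_form_def B_comp by (simp add: algebra_simps)
    then show ?thesis unfolding PP PV VV NN NV by (simp add: dual_form_def algebra_simps)
  qed
  then have dA: "dual_form K (A y) (A z) = dual_form K y z" for y z
    using inv by metis
  have A3: "A x $ 3 = dual_form K P x" for x
    by (simp add: A_comp dual_form_def pv)
  have Aq: "A x \<in> quadric K" if "x \<in> quadric K" for x
    using that dA A3 dual_form_quadric_pos[OF P that] by (auto simp: quadric_def)
  have Bq: "B y \<in> quadric K" if y: "y \<in> quadric K" for y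
  proof -
    have d: "dual_form K (B y) (B y) = 1" using dB y by (simp add: quadric_def)
    have "B y $ 3 > 0" if K: "K \<le> 0"
    proof (rule ccontr)
      assume neg: "\<not> B y $ 3 > 0"
      have "B y $ 3 \<noteq> 0"
      proof
        assume "B y $ 3 = 0"
        then have "dual_form K (B y) (B y) = K * ((B y $ 1)\<^sup>2 + (B y $ 2)\<^sup>2)"
          by (simp add: dual_form_def power2_eq_square)
        also have "\<dots> \<le> 0" using K by (simp add: mult_nonpos_nonneg)
        finally show False using d by simp
      qed
      \<comment> \<open>On the wrong sheet the opposite point would lie in the quadric and pair
        positively with \<open>P\<close>; but \<open>B y\<close> pairs with \<open>P\<close> to
        \<open>y $ 3\<close>, which is positive.\<close>
      then have "- B y \<in> quadric K" using neg d by (auto simp: quadric_def dual_form_def)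
      from dual_form_quadric_pos[OF P this K] have "dual_form K P (B y) < 0"
        by (simp add: dual_form_def algebra_simps)
      moreover have "dual_form K P (B y) = y $ 3" using A3[of "B y"] inv by simp
      ultimately show False using y K by (simp add: quadric_def)
    qed
    then show ?thesis using d by (simp add: quadric_def)
  qed
  have form: "form K (A a) (A b) = form K a b"
    if y: "y \<in> quadric K" "dual_form K y a = 0" "dual_form K y b = 0" for y a b
  proof (cases "K = 0")
    case True
    then have "a$3 = 0" "b$3 = 0" using y by (auto simp: quadric_def dual_form_def)
    moreover have "p3 = 1"
    proof -
      have "(p3 - 1) * (p3 + 1) = 0" "p3 > 0"
        using P True by (auto simp: quadric_def dual_form_def pv algebra_simps)
      then show ?thesis by auto
    qed
    ultimately have "form K (A a) (A b) = (v1 * v1 + v2 * v2) * (a$1 * b$1 + a$2 * b$2)"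
      by (simp add: form_def A_comp True n1_def n2_def algebra_simps)
    also have "v1 * v1 + v2 * v2 = 1" using VV True by simp
    finally show ?thesis using True by (simp add: form_def)
  next
    case False
    then have "form K x y = dual_form K x y / K" for x y
      by (simp add: form_def dual_form_def field_simps)
    then show ?thesis using dA by simp
  qed
  have "A P = axis 3 1"
    unfolding vec_eq_iff forall_3 A_comp axis_def pv[symmetric] by (simp add: e1 e2 e3)
  moreover have "A V = axis 1 1"
    unfolding vec_eq_iff forall_3 A_comp axis_def w(1) pv[symmetric] by (simp add: e1 e2 e3)
  moreover have "A ` quadric K = quadric K"
    using Aq Bq inv by (metis image_eqI image_subsetI subsetI subset_antisym)
  ultimately show ?thesis using that[of A B] lin inv form by (simp add: quadric_iso_def)
qed

context space_form
begin

lemma geodesic_formula: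
  assumes "geodesic M \<gamma>"
  shows "X (\<gamma> (a + s)) = cs K s *\<^sub>R X (\<gamma> a) + sn K s *\<^sub>R vector_derivative (\<lambda>s. X (\<gamma> s)) (at a)"
proof -
  have us: "unit_speed_curve M \<gamma>" using assms by (simp add: geodesic_def)
  show ?thesis
    by (rule harmonic_solution[OF unit_speed_derivative[OF us] geodesic_embedded[OF assms]])
qed

text \<open>The curve is written down in the quadric and carried back by the inverse of
  \<open>X\<close>; \<open>geodesic_lift\<close> then replaces any existence theorem for
  differential equations.\<close>

lemma geodesic_exists:
  assumes "p \<in> points M" "dual_form K (X p) V = 0" "form K V V = 1"
  obtains \<sigma> where "geodesic M \<sigma>" "\<sigma> 0 = p" "\<And>t. X (\<sigma> t) = cs K t *\<^sub>R X p + sn K t *\<^sub>R V"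
    "vector_derivative (\<lambda>t. X (\<sigma> t)) (at 0) = V"
proof -
  define Y where "Y t = cs K t *\<^sub>R X p + sn K t *\<^sub>R V" for t
  define D where "D t = (- K * sn K t) *\<^sub>R X p + cs K t *\<^sub>R V" for t
  define \<sigma> where "\<sigma> t = inv_into (points M) X (Y t)" for t
  note Xp = X_in_quadric[OF assms(1)]
  have "Y t \<in> X ` points M" for t
    unfolding image Y_def by (rule circle_in_quadric[OF Xp assms(2,3)])
  then have \<sigma>: "\<sigma> t \<in> points M" "X (\<sigma> t) = Y t" for t
    by (auto simp: \<sigma>_def inv_into_into f_inv_into_f)
  have Y': "(Y has_vector_derivative D t) (at t)" for t
    unfolding Y_def[abs_def] D_def
    by (intro has_vector_derivative_add has_vector_derivative_scaleR_const DERIV_cs DERIV_sn)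
  have D': "(D has_vector_derivative - K *\<^sub>R Y t) (at t)" for t
  proof -
    have "(D has_vector_derivative (- K * cs K t) *\<^sub>R X p + (- K * sn K t) *\<^sub>R V) (at t)"
      unfolding D_def[abs_def]
      by (intro has_vector_derivative_add has_vector_derivative_scaleR_const DERIV_cs DERIV_cmult DERIV_sn)
    then show ?thesis by (simp add: Y_def algebra_simps)
  qed
  have "form K (D t) (D t) = 1" for t
  proof -
    \<comment> \<open>In the expansion of \<open>form K (D t) (D t)\<close> every product with
      \<open>X p\<close> carries a factor \<open>K\<close>, so that the values are right also for
      \<open>K = 0\<close>.\<close>
    have "K * form K (X p) V = 0" "K * form K V (X p) = 0"
      using K_form[OF assms(2)] form_commute by auto
    moreover have "K * (K * form K (X p) (X p)) = K"
      using Xp by (cases "K = 0") (auto simp: quadric_def dual_form_def form_def field_simps)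
    moreover have "form K (D t) (D t) = (sn K t)\<^sup>2 * (K * (K * form K (X p) (X p)))
        - sn K t * cs K t * (K * form K (X p) V) - sn K t * cs K t * (K * form K V (X p)) + (cs K t)\<^sup>2 * form K V V"
      unfolding D_def by (simp add: form_simps power2_eq_square algebra_simps)
    ultimately have "form K (D t) (D t) = (sn K t)\<^sup>2 * K + (cs K t)\<^sup>2"
      using assms(3) by (simp only: mult_zero_right mult_1_right diff_zero)
    then show ?thesis using cs_sn_square[of K t] by (simp add: algebra_simps)
  qed
  then have "geodesic M \<sigma>" by (rule geodesic_lift[OF Y' \<sigma> D'])
  moreover have "\<sigma> 0 = p"
    using inj assms(1) by (simp add: \<sigma>_def Y_def)
  moreover have "vector_derivative (\<lambda>t. X (\<sigma> t)) (at 0) = V"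
    using Y'[of 0] \<sigma>(2) by (simp add: D_def vector_derivative_at)
  ultimately show ?thesis using that \<sigma>(2) Y_def by simp
qed

lemma right_angle_form:
  assumes "geodesic M \<gamma>" "geodesic M \<eta>" "meet_at_right_angle M \<gamma> t \<eta> s"
  shows "\<gamma> t = \<eta> s" "form K (vector_derivative (\<lambda>s. X (\<gamma> s)) (at t)) (vector_derivative (\<lambda>s. X (\<eta> s)) (at s)) = 0"
proof -
  show eq: "\<gamma> t = \<eta> s" using assms(3) by (simp add: meet_at_right_angle_def)
  have us: "unit_speed_curve M \<gamma>" "unit_speed_curve M \<eta>" using assms by (auto simp: geodesic_def)
  obtain c where c: "c \<in> charts M" "\<gamma> t \<in> cimage c"
    using point_in_chart unit_speed_point[OF us(1)] by blast
  have "velocity c \<gamma> t \<bullet> (cmet c (coords c (\<gamma> t)) *v velocity c \<eta> s) = 0"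
    using assms(3) c unfolding meet_at_right_angle_def by blast
  then show "form K (vector_derivative (\<lambda>s. X (\<gamma> s)) (at t)) (vector_derivative (\<lambda>s. X (\<eta> s)) (at s)) = 0"
    using unit_speed_coords[OF us(1) c] unit_speed_coords[OF us(2) c(1), of s] c(2)
      metric[OF c(1) coords_inverse(1)[OF c(2)]] eq
    by (simp add: form_pullback)
qed

text \<open>The embedding is moved instead of the equator: composing \<open>X\<close> with an
  isometry of the quadric gives another embedding of the same kind, with the equator in standard
  position.\<close>

lemma normalize:
  assumes "geodesic M \<gamma>"
  obtains X' where "space_form M K X'"
    "\<And>s. X' (\<gamma> (a + s)) = cs K s *\<^sub>R axis 3 1 + sn K s *\<^sub>R axis 1 1"
proof -
  have us: "unit_speed_curve M \<gamma>" using assms by (simp add: geodesic_def)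
  define V where "V = vector_derivative (\<lambda>s. X (\<gamma> s)) (at a)"
  have P: "X (\<gamma> a) \<in> quadric K" by (rule X_in_quadric[OF unit_speed_point[OF us]])
  have V: "dual_form K (X (\<gamma> a)) V = 0" "form K V V = 1"
    unfolding V_def by (rule unit_speed_tangent[OF us] unit_speed_form[OF us])+
  obtain A B where AB: "quadric_iso K A B" "A (X (\<gamma> a)) = axis 3 1" "A V = axis 1 1"
    using quadric_isometry[OF P V] .
  have A: "bounded_linear A" "bounded_linear B" "\<And>x. B (A x) = x" "\<And>y. A (B y) = y" "A ` quadric K = quadric K"
    "\<And>y a b. y \<in> quadric K \<Longrightarrow> dual_form K y a = 0 \<Longrightarrow> dual_form K y b = 0 \<Longrightarrow> form K (A a) (A b) = form K a b"
    using AB(1) by (auto simp: quadric_iso_def)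
  have "space_form M K (\<lambda>p. A (X p))"
  proof
    show "riemannian_surface M" by (rule surface)
    show "inj_on (\<lambda>p. A (X p)) (points M)"
    proof (rule inj_onI)
      fix p q assume "p \<in> points M" "q \<in> points M" "A (X p) = A (X q)"
      then have "X p = X q" by (metis A(3))
      with \<open>p \<in> points M\<close> \<open>q \<in> points M\<close> show "p = q" using inj by (simp add: inj_on_eq_iff)
    qed
    show "(\<lambda>p. A (X p)) ` points M = quadric K"
    proof -
      have "(\<lambda>p. A (X p)) ` points M = A ` (X ` points M)" by (simp add: image_image)
      then show ?thesis by (simp only: image A(5))
    qed
  next
    fix c assume c: "c \<in> charts M"
    show "C_on 2 (cdom c) (\<lambda>u. A (X (cmap c u)))"
      by (rule C_on_bounded_linear[OF chart_dom_open[OF c] A(1) smooth[OF c]])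
    fix u assume u: "u \<in> cdom c"
    have "(\<lambda>u. X (cmap c u)) differentiable (at u)"
      using smooth[OF c] u by (simp add: numeral_2_eq_2)
    note d = partial_bounded_linear[OF A(1) this]
    show "cmet c u = pullback K (\<lambda>u. A (X (cmap c u))) u"
      unfolding metric[OF c u] pullback_def d
      using A(6)[OF X_in_quadric tangent_partial[OF c u] tangent_partial[OF c u]] cimage_subset[OF c] u
      by (simp add: vec_eq_iff image_subset_iff)
  next
    fix c p assume c: "c \<in> charts M" "p \<in> cimage c"
    obtain V and \<Phi> :: "real^3 \<Rightarrow> real^2" where V: "open V" "X p \<in> V" "\<And>y. y \<in> V \<Longrightarrow> \<Phi> differentiable (at y)"
      "\<And>q. q \<in> points M \<Longrightarrow> X q \<in> V \<Longrightarrow> q \<in> cimage c \<and> coords c q = \<Phi> (X q)"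
      using local_inverse[OF c] by blast
    have "open (B -` V)"
      using V(1) linear_continuous_on[OF A(2), of UNIV] continuous_on_open_vimage[of UNIV B]
      by (metis Int_UNIV_right open_UNIV)
    moreover have "(\<lambda>y. \<Phi> (B y)) differentiable (at y)" if "y \<in> B -` V" for y
      using differentiable_chain_at[of B y \<Phi>] V(3) that bounded_linear_imp_differentiable[OF A(2)]
      by (auto simp: o_def)
    ultimately show "\<exists>V (\<Phi> :: real^3 \<Rightarrow> real^2). open V \<and> A (X p) \<in> V \<and> (\<forall>y\<in>V. \<Phi> differentiable (at y)) \<and>
        (\<forall>q\<in>points M. A (X q) \<in> V \<longrightarrow> q \<in> cimage c \<and> coords c q = \<Phi> (A (X q)))"
      using V(2,4) A(3) by (intro exI[of _ "B -` V"] exI[of _ "\<lambda>y. \<Phi> (B y)"]) auto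
  qed
  moreover have "A (X (\<gamma> (a + s))) = cs K s *\<^sub>R axis 3 1 + sn K s *\<^sub>R axis 1 1" for s
    unfolding geodesic_formula[OF assms, of a s] V_def[symmetric]
    by (simp add: linear_add linear_scale bounded_linear.linear[OF A(1)] AB(2,3))
  ultimately show ?thesis using that by blast
qed

end

section \<open>The conditional probability\<close>

lemma cs_pos_nonpos: "K \<le> 0 \<Longrightarrow> cs K t > 0"
  by (cases K rule: K_cases) (auto simp: trig_zero trig_neg)

locale normalized_equator = space_form +
  fixes \<gamma> :: "real \<Rightarrow> 'a" and a :: real
  assumes equator: "geodesic M \<gamma>"
    and normal: "\<And>s. X (\<gamma> (a + s)) = cs K s *\<^sub>R axis 3 1 + sn K s *\<^sub>R axis 1 1"
begin

text \<open>The unit velocity of the equator at \<open>a + z\<close>; together with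
  \<open>axis 2 1\<close> it is an orthonormal basis of the tangent plane there.\<close>

definition tang :: "real \<Rightarrow> real^3" where
  "tang z = cs K z *\<^sub>R axis 1 1 - (K * sn K z) *\<^sub>R axis 3 1"

text \<open>The point at distance \<open>s\<close> from \<open>\<gamma> (a + z)\<close> in the direction that makes the angle \<open>\<theta>\<close> with
  the equator.\<close>

definition ray :: "real \<Rightarrow> real \<Rightarrow> real \<Rightarrow> real^3" where
  "ray z \<theta> s = cs K s *\<^sub>R X (\<gamma> (a + z)) + sn K s *\<^sub>R (cos \<theta> *\<^sub>R tang z + sin \<theta> *\<^sub>R axis 2 1)"

text \<open>The geodesic perpendicular to the equator at \<open>\<gamma> (a + z)\<close>, as the
  section of the quadric by a plane through the origin.\<close>

definition orthogonal_line :: "real \<Rightarrow> 'a set" where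
  "orthogonal_line z = {q \<in> points M. X q $ 1 * cs K z = X q $ 3 * sn K z}"

lemma equator_comp: "X (\<gamma> (a + z)) $ 1 = sn K z" "X (\<gamma> (a + z)) $ 2 = 0" "X (\<gamma> (a + z)) $ 3 = cs K z"
  by (simp_all add: normal axis_def)

lemma tang_comp: "tang z $ 1 = cs K z" "tang z $ 2 = 0" "tang z $ 3 = - K * sn K z"
  by (simp_all add: tang_def axis_def)

lemma ray_comp:
  "ray z \<theta> s $ 1 = cs K s * sn K z + sn K s * cs K z * cos \<theta>"
  "ray z \<theta> s $ 2 = sn K s * sin \<theta>"
  "ray z \<theta> s $ 3 = cs K s * cs K z - K * sn K s * sn K z * cos \<theta>"
  by (simp_all add: ray_def equator_comp tang_comp axis_def algebra_simps)

lemma equator_point: "\<gamma> t \<in> points M"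
  using equator unit_speed_point by (simp add: geodesic_def)

lemma unit_tangent_iff:
  "dual_form K (X (\<gamma> (a + z))) V = 0 \<and> form K V V = 1 \<longleftrightarrow>
    (\<exists>\<theta>. V = cos \<theta> *\<^sub>R tang z + sin \<theta> *\<^sub>R axis 2 1)"
proof
  assume V: "dual_form K (X (\<gamma> (a + z))) V = 0 \<and> form K V V = 1"
  obtain w where w: "V$3 = K * w" "sn K z * V$1 + cs K z * w = 0"
    using tangent_third_component[OF X_in_quadric[OF equator_point] conjunct1[OF V]]
    unfolding equator_comp by (metis add.right_neutral mult_zero_left)
  define c where "c = cs K z * V$1 - K * sn K z * w"
  note sq = cs_sn_square[of K z, unfolded power2_eq_square]
  have V1: "V$1 = c * cs K z" unfolding c_def using sq w(2) by algebra
  have w': "w = - c * sn K z" unfolding c_def using sq w(2) by algebra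
  have "V$1 * V$1 + V$2 * V$2 + K * w * w = 1"
    using V unfolding form_third_component[OF w(1) w(1)] by simp
  then have "c\<^sup>2 + (V$2)\<^sup>2 = 1" unfolding V1 w' using sq by algebra
  then obtain \<theta> where "c = cos \<theta>" "V$2 = sin \<theta>" by (rule sincos_total_2pi)
  then show "\<exists>\<theta>. V = cos \<theta> *\<^sub>R tang z + sin \<theta> *\<^sub>R axis 2 1"
    using V1 w' w(1) by (intro exI[of _ \<theta>]) (simp add: vec_eq_iff forall_3 tang_comp axis_def)
next
  assume "\<exists>\<theta>. V = cos \<theta> *\<^sub>R tang z + sin \<theta> *\<^sub>R axis 2 1"
  then obtain \<theta> where \<theta>: "V = cos \<theta> *\<^sub>R tang z + sin \<theta> *\<^sub>R axis 2 1" by blast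
  have comp: "V$1 = cos \<theta> * cs K z" "V$2 = sin \<theta>" "V$3 = K * (- cos \<theta> * sn K z)"
    by (simp_all add: \<theta> tang_comp axis_def)
  have "form K V V = (cos \<theta>)\<^sup>2 * ((cs K z)\<^sup>2 + K * (sn K z)\<^sup>2) + (sin \<theta>)\<^sup>2"
    unfolding form_third_component[OF comp(3) comp(3)] comp(1,2) by (simp add: power2_eq_square algebra_simps)
  moreover have "dual_form K (X (\<gamma> (a + z))) V = 0"
    unfolding dual_form_def comp equator_comp by (simp add: algebra_simps)
  ultimately show "dual_form K (X (\<gamma> (a + z))) V = 0 \<and> form K V V = 1"
    by (simp add: cs_sn_square)
qed

lemma geodesic_is_ray:
  assumes "geodesic M \<sigma>" "\<sigma> r = \<gamma> (a + z)"
  obtains \<theta> where "vector_derivative (\<lambda>s. X (\<sigma> s)) (at r) = cos \<theta> *\<^sub>R tang z + sin \<theta> *\<^sub>R axis 2 1"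
    "\<And>s. X (\<sigma> (r + s)) = ray z \<theta> s"
proof -
  have us: "unit_speed_curve M \<sigma>" using assms by (simp add: geodesic_def)
  obtain \<theta> where \<theta>: "vector_derivative (\<lambda>s. X (\<sigma> s)) (at r) = cos \<theta> *\<^sub>R tang z + sin \<theta> *\<^sub>R axis 2 1"
    using unit_speed_tangent[OF us, of r] unit_speed_form[OF us, of r] unit_tangent_iff[of z] assms(2) by metis
  then show ?thesis using that[of \<theta>] geodesic_formula[OF assms(1), of r] assms(2)
    by (simp add: ray_def)
qed

lemma ray_is_geodesic:
  obtains \<sigma> where "geodesic M \<sigma>" "\<sigma> 0 = \<gamma> (a + z)" "\<And>s. X (\<sigma> s) = ray z \<theta> s"
proof -
  have "dual_form K (X (\<gamma> (a + z))) (cos \<theta> *\<^sub>R tang z + sin \<theta> *\<^sub>R axis 2 1) = 0"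
    "form K (cos \<theta> *\<^sub>R tang z + sin \<theta> *\<^sub>R axis 2 1) (cos \<theta> *\<^sub>R tang z + sin \<theta> *\<^sub>R axis 2 1) = 1"
    using unit_tangent_iff[of z] by blast+
  from geodesic_exists[OF equator_point this] show ?thesis
    using that unfolding ray_def by metis
qed

lemma ray_in_quadric: "ray z \<theta> s \<in> quadric K"
  by (metis X_in_quadric ray_is_geodesic unit_speed_point geodesic_def)

lemma X_eq_iff: "p \<in> points M \<Longrightarrow> q \<in> points M \<Longrightarrow> X p = X q \<longleftrightarrow> p = q"
  using inj by (simp add: inj_on_eq_iff)

lemma geodesic_circle_eq: "geodesic_circle M (\<gamma> (a + z)) \<rho> = {q \<in> points M. \<exists>\<theta>. X q = ray z \<theta> \<rho>}"
proof (intro equalityI subsetI)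
  fix q assume "q \<in> geodesic_circle M (\<gamma> (a + z)) \<rho>"
  then obtain \<sigma> where \<sigma>: "geodesic M \<sigma>" "\<sigma> 0 = \<gamma> (a + z)" "q = \<sigma> \<rho>"
    by (auto simp: geodesic_circle_def)
  obtain \<theta> where "\<And>s. X (\<sigma> (0 + s)) = ray z \<theta> s" using geodesic_is_ray[OF \<sigma>(1,2)] by metis
  then have "X q = ray z \<theta> \<rho>" using \<sigma>(3) by (metis add_0)
  moreover have "q \<in> points M" using \<sigma> unit_speed_point by (simp add: geodesic_def)
  ultimately show "q \<in> {q \<in> points M. \<exists>\<theta>. X q = ray z \<theta> \<rho>}" by blast
next
  fix q assume "q \<in> {q \<in> points M. \<exists>\<theta>. X q = ray z \<theta> \<rho>}"
  then obtain \<theta> where q: "q \<in> points M" "X q = ray z \<theta> \<rho>" by blast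
  obtain \<sigma> where \<sigma>: "geodesic M \<sigma>" "\<sigma> 0 = \<gamma> (a + z)" "\<And>s. X (\<sigma> s) = ray z \<theta> s"
    using ray_is_geodesic[where z = z and \<theta> = \<theta>] by metis
  have "q = \<sigma> \<rho>" using X_eq_iff[OF q(1), of "\<sigma> \<rho>"] q(2) \<sigma> unit_speed_point by (simp add: geodesic_def)
  then show "q \<in> geodesic_circle M (\<gamma> (a + z)) \<rho>" using \<sigma> by (auto simp: geodesic_circle_def)
qed

text \<open>The right angle forces \<open>cos \<phi> = 0\<close>, so the ray stays in the plane of
  \<open>orthogonal_line z\<close>. Conversely the equation of the quadric puts the two remaining
  coordinates of a point of that section on the curve of \<open>cs_sn_surj\<close>, which provides
  its parameter on the geodesic.\<close>

lemma grating_line_eq: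
  assumes "grating_line M \<gamma> l"
  obtains z where "l = orthogonal_line z"
proof -
  obtain \<eta> t s where \<eta>: "geodesic M \<eta>" "l = range \<eta>" "meet_at_right_angle M \<gamma> t \<eta> s"
    using assms by (auto simp: grating_line_def)
  define z where "z = t - a"
  have t: "t = a + z" by (simp add: z_def)
  note ra = right_angle_form[OF equator \<eta>(1,3)]
  obtain \<phi> where \<phi>: "vector_derivative (\<lambda>s. X (\<eta> s)) (at s) = cos \<phi> *\<^sub>R tang z + sin \<phi> *\<^sub>R axis 2 1"
    "\<And>r. X (\<eta> (s + r)) = ray z \<phi> r"
    using geodesic_is_ray[OF \<eta>(1)] ra(1) t by metis
  have "vector_derivative (\<lambda>s. X (\<gamma> s)) (at t) = tang z"
  proof -
    have "((\<lambda>s. X (\<gamma> s)) has_vector_derivative tang z) (at t)"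
    proof -
      have "X (\<gamma> u) = cs K (u - a) *\<^sub>R axis 3 1 + sn K (u - a) *\<^sub>R axis 1 1" for u
        using normal[of "u - a"] by simp
      moreover have "((\<lambda>u. cs K (u - a) *\<^sub>R axis 3 (1::real) + sn K (u - a) *\<^sub>R axis 1 (1::real))
        has_vector_derivative (- K * sn K z) *\<^sub>R axis 3 1 + cs K z *\<^sub>R axis 1 1) (at t)"
        by (intro has_vector_derivative_add has_vector_derivative_scaleR_const)
           (auto intro!: derivative_eq_intros simp: z_def)
      ultimately show ?thesis by (simp add: tang_def algebra_simps)
    qed
    then show ?thesis by (rule vector_derivative_at)
  qed
  then have "form K (tang z) (cos \<phi> *\<^sub>R tang z + sin \<phi> *\<^sub>R axis 2 1) = 0" using ra(2) \<phi>(1) by simp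
  moreover have "form K (tang z) (tang z) = 1"
    using unit_tangent_iff[of z "tang z"] by (metis add.right_neutral cos_zero scaleR_one scaleR_zero_left sin_zero)
  moreover have "form K (tang z) (axis 2 1) = 0" by (simp add: form_def tang_comp axis_def)
  ultimately have "cos \<phi> = 0" by (simp add: form_simps)
  then have sin: "(sin \<phi>)\<^sup>2 = 1" using sin_cos_squared_add2[of \<phi>] by simp
  have "l = orthogonal_line z"
  proof (intro equalityI subsetI)
    fix q assume "q \<in> l"
    then obtain r where "q = \<eta> r" using \<eta>(2) by blast
    then have "X q = ray z \<phi> (r - s)" using \<phi>(2)[of "r - s"] by simp
    moreover have "q \<in> points M" using \<open>q = \<eta> r\<close> \<eta>(1) unit_speed_point by (simp add: geodesic_def)
    ultimately show "q \<in> orthogonal_line z"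
      using \<open>cos \<phi> = 0\<close> by (simp add: orthogonal_line_def ray_comp)
  next
    fix q assume "q \<in> orthogonal_line z"
    then have q: "q \<in> points M" "X q $ 1 * cs K z = X q $ 3 * sn K z" by (auto simp: orthogonal_line_def)
    \<comment> \<open>The value of \<open>dual_form K\<close> at \<open>X q\<close> and the foot
      point \<open>X (\<gamma> (a + z))\<close>.\<close>
    define c where "c = K * X q $ 1 * sn K z + X q $ 3 * cs K z"
    note sq = cs_sn_square[of K z, unfolded power2_eq_square]
    have x: "X q $ 1 = c * sn K z" "X q $ 3 = c * cs K z"
      unfolding c_def using sq q(2) by algebra+
    have quad: "dual_form K (X q) (X q) = 1" using X_in_quadric[OF q(1)] by (simp add: quadric_def)
    have "dual_form K (X q) (X q) = c\<^sup>2 * ((cs K z)\<^sup>2 + K * (sn K z)\<^sup>2) + K * (X q $ 2)\<^sup>2"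
      unfolding dual_form_def x by (simp add: power2_eq_square algebra_simps)
    then have c1: "c\<^sup>2 + K * (sin \<phi> * X q $ 2)\<^sup>2 = 1"
      using quad sin by (simp add: cs_sn_square power_mult_distrib)
    have c2: "c > 0" if "K \<le> 0"
    proof -
      have "0 < c * cs K z" using X_in_quadric[OF q(1)] that x(2) by (simp add: quadric_def)
      then show ?thesis using cs_pos_nonpos[OF that, of z] by (simp add: zero_less_mult_iff)
    qed
    \<comment> \<open>The factor \<open>sin \<phi>\<close> is 1 or -1 and hence its own inverse; it
      accounts for the direction in which the line is traversed.\<close>
    obtain r where r: "cs K r = c" "sn K r = sin \<phi> * X q $ 2"
      using cs_sn_surj[OF c1 c2] by blast
    have "X q $ 2 = sn K r * sin \<phi>" using r(2) sin by (simp add: power2_eq_square)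
    then have "X q = ray z \<phi> r"
      using x r(1) \<open>cos \<phi> = 0\<close> by (simp add: vec_eq_iff forall_3 ray_comp)
    then have "X q = X (\<eta> (s + r))" using \<phi>(2) by simp
    moreover have "\<eta> (s + r) \<in> points M" using \<eta>(1) unit_speed_point by (simp add: geodesic_def)
    ultimately have "q = \<eta> (s + r)" using X_eq_iff q(1) by blast
    then show "q \<in> l" using \<eta>(2) by blast
  qed
  then show ?thesis using that by blast
qed

lemma equator_in_orthogonal_line: "\<gamma> (a + z) \<in> orthogonal_line z"
  by (simp add: orthogonal_line_def equator_point equator_comp)

lemma orthogonal_line_0: "sn K z = 0 \<Longrightarrow> orthogonal_line z = {q \<in> points M. X q $ 1 = 0}"
  using cs_sn_square[of K z] by (auto simp: orthogonal_line_def)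

text \<open>An orthogonal line depends only on \<open>sn\<close> and \<open>cs\<close> of its foot
  parameter, that is, on its foot point, and foot points lie in the grating. The line through
  \<open>\<gamma> a\<close> may have its foot at the antipode, where \<open>sn\<close> also
  vanishes, and is the same line.\<close>

lemma Union_grating:
  assumes "grating M \<gamma> L G" "\<gamma> a \<in> \<Union>G"
  shows "orthogonal_line 0 \<subseteq> \<Union>G" "\<Union>G \<subseteq> (\<Union>m::int. orthogonal_line (2 * of_int m * L))"
proof -
  have lines: "\<And>l. l \<in> G \<Longrightarrow> grating_line M \<gamma> l"
    and pts: "\<Union>G \<inter> range \<gamma> = {\<gamma> (a + 2 * of_int m * L) |m::int. True}"
    using assms by (auto simp: grating_def)
  obtain l where l: "l \<in> G" "\<gamma> a \<in> l" using assms(2) by blast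
  obtain z where z: "l = orthogonal_line z" using grating_line_eq[OF lines[OF l(1)]] .
  have "sn K z = 0" using l(2) equator_comp[of 0] unfolding z by (simp add: orthogonal_line_def)
  then have "l = orthogonal_line 0" unfolding z by (simp add: orthogonal_line_0)
  then show "orthogonal_line 0 \<subseteq> \<Union>G" using l(1) by blast
  show "\<Union>G \<subseteq> (\<Union>m::int. orthogonal_line (2 * of_int m * L))"
  proof
    fix q assume "q \<in> \<Union>G"
    then obtain l where l: "l \<in> G" "q \<in> l" by blast
    obtain z where z: "l = orthogonal_line z" using grating_line_eq[OF lines[OF l(1)]] .
    have "\<gamma> (a + z) \<in> \<Union>G \<inter> range \<gamma>" using l(1) z equator_in_orthogonal_line by blast
    then obtain m :: int where "\<gamma> (a + z) = \<gamma> (a + 2 * of_int m * L)" using pts by blast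
    then have "sn K z = sn K (2 * of_int m * L)" "cs K z = cs K (2 * of_int m * L)"
      using equator_comp[of z] equator_comp[of "2 * of_int m * L"] by (auto simp: add.assoc)
    then have "l = orthogonal_line (2 * of_int m * L)" unfolding z orthogonal_line_def by simp
    then show "q \<in> (\<Union>m::int. orthogonal_line (2 * of_int m * L))" using l(2) by blast
  qed
qed

text \<open>A needle that hits some grating line satisfies the inequality of
  \<open>sn_multiple_eq_0\<close>, since \<open>tn K\<close> on the needle is bounded by
  \<open>tn K L\<close>; so the line is the one at parameter 0. The converse is the intermediate
  value theorem along the needle.\<close>

lemma hitting_tips_eq:
  assumes L: "small K L" and adm: "K > 0 \<Longrightarrow> \<exists>n::nat. n > 1 \<and> 2 * real n * sqrt K * L = pi"
    and G: "grating M \<gamma> L G" "\<gamma> a \<in> \<Union>G" and z: "\<bar>z\<bar> < L"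
  shows "hitting_tips M G L (\<gamma> (a + z)) =
    {q \<in> points M. \<exists>\<theta>. X q = ray z \<theta> L \<and> \<bar>sn K z\<bar> * cs K L \<le> sn K L * cs K z * \<bar>cos \<theta>\<bar>}"
proof (intro equalityI subsetI)
  have L0: "0 < L" using L by (simp add: small_def)
  have csL: "cs K L > 0" and csz: "cs K z > 0" using cs_pos[OF L] z L0 by auto
  have snL: "sn K L > 0" using sn_pos[OF L] L0 by auto
  fix q assume "q \<in> hitting_tips M G L (\<gamma> (a + z))"
  then obtain N where q: "q \<in> points M" and N: "needle M L (\<gamma> (a + z)) q N" "N \<inter> \<Union>G \<noteq> {}"
    by (auto simp: hitting_tips_def)
  from N(1) obtain \<sigma> where \<sigma>: "geodesic M \<sigma>" "\<sigma> 0 = \<gamma> (a + z)" "\<sigma> L = q" "N = \<sigma> ` {-L..L}"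
    unfolding needle_def by blast
  obtain s where s: "s \<in> {-L..L}" "\<sigma> s \<in> \<Union>G" using N(2) \<sigma>(4) by blast
  obtain \<theta> where \<theta>: "\<And>s. X (\<sigma> (0 + s)) = ray z \<theta> s" using geodesic_is_ray[OF \<sigma>(1,2)] by metis
  obtain m :: int where m: "\<sigma> s \<in> orthogonal_line (2 * of_int m * L)"
    using Union_grating(2)[OF G] s(2) by blast
  define w where "w = 2 * of_int m * L"
  \<comment> \<open>Lying on the line at \<open>w\<close> means
    \<open>tn K (w - z) = tn K s * cos \<theta>\<close>. It is kept cross-multiplied because
    \<open>cs K (w - z)\<close> may vanish on the sphere.\<close>
  have "cs K s * sn K (w - z) = sn K s * cos \<theta> * cs K (w - z)"
    using m[folded w_def] \<theta>[of s] by (simp add: orthogonal_line_def ray_comp sn_diff cs_diff algebra_simps)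
  moreover have css: "cs K s > 0" using cs_pos[OF L, of s] s by auto
  ultimately have eq: "cs K s * \<bar>sn K (w - z)\<bar> = \<bar>sn K s\<bar> * \<bar>cos \<theta>\<bar> * \<bar>cs K (w - z)\<bar>"
    by (metis abs_mult abs_of_pos)
  have "\<bar>sn K s\<bar> * cs K L \<le> sn K L * cs K s"
  proof -
    have sL: "\<bar>s\<bar> \<le> L" using s(1) by auto
    have "sn K (L - \<bar>s\<bar>) \<ge> 0"
      using sn_pos[OF L, of "L - \<bar>s\<bar>"] sL by (cases "\<bar>s\<bar> = L") auto
    moreover have "sn K \<bar>s\<bar> = \<bar>sn K s\<bar>"
    proof -
      have "0 \<le> sn K \<bar>s\<bar>" using sn_pos[OF L, of "\<bar>s\<bar>"] sL by (cases "s = 0") auto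
      then show ?thesis by (cases "s \<ge> 0") auto
    qed
    moreover have "cs K \<bar>s\<bar> = cs K s" by (simp add: abs_if)
    ultimately show ?thesis by (simp add: sn_diff mult.commute)
  qed
  then have "(\<bar>sn K s\<bar> * cs K L) * (\<bar>cos \<theta>\<bar> * \<bar>cs K (w - z)\<bar>) \<le> (sn K L * cs K s) * (\<bar>cos \<theta>\<bar> * \<bar>cs K (w - z)\<bar>)"
    by (intro mult_right_mono) auto
  then have "cs K s * (\<bar>sn K (w - z)\<bar> * cs K L) \<le> cs K s * (sn K L * \<bar>cos \<theta>\<bar> * \<bar>cs K (w - z)\<bar>)"
    using eq by (simp add: algebra_simps)
  then have le: "\<bar>sn K (w - z)\<bar> * cs K L \<le> sn K L * \<bar>cos \<theta>\<bar> * \<bar>cs K (w - z)\<bar>"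
    using css by simp
  moreover have "sn K L * \<bar>cos \<theta>\<bar> * \<bar>cs K (w - z)\<bar> \<le> sn K L * \<bar>cs K (w - z)\<bar>"
    using snL by (intro mult_right_mono mult_left_le) auto
  ultimately have "sn K w = 0"
    unfolding w_def by (intro sn_multiple_eq_0[OF adm L0 z]) auto
  \<comment> \<open>Where \<open>sn\<close> vanishes, \<open>cs\<close> is 1 or -1, so in absolute
    value \<open>w - z\<close> may be replaced by \<open>z\<close> in \<open>le\<close>.\<close>
  moreover then have "\<bar>cs K w\<bar> = 1" using cs_sn_square[of K w] by (simp add: power2_eq_1_iff) auto
  ultimately have "\<bar>sn K z\<bar> * cs K L \<le> sn K L * cs K z * \<bar>cos \<theta>\<bar>"
    using le csz by (simp add: sn_diff cs_diff abs_mult mult_ac)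
  moreover have "X q = ray z \<theta> L" using \<theta>[of L] \<sigma>(3) by simp
  ultimately show "q \<in> {q \<in> points M. \<exists>\<theta>. X q = ray z \<theta> L \<and> \<bar>sn K z\<bar> * cs K L \<le> sn K L * cs K z * \<bar>cos \<theta>\<bar>}"
    using q by blast
next
  have L0: "0 < L" using L by (simp add: small_def)
  have csL: "cs K L > 0" and csz: "cs K z > 0" using cs_pos[OF L] z L0 by auto
  have snL: "sn K L > 0" using sn_pos[OF L] L0 by auto
  fix q assume "q \<in> {q \<in> points M. \<exists>\<theta>. X q = ray z \<theta> L \<and> \<bar>sn K z\<bar> * cs K L \<le> sn K L * cs K z * \<bar>cos \<theta>\<bar>}"
  then obtain \<theta> where q: "q \<in> points M" "X q = ray z \<theta> L" "\<bar>sn K z\<bar> * cs K L \<le> sn K L * cs K z * \<bar>cos \<theta>\<bar>"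
    by blast
  obtain \<sigma> where \<sigma>: "geodesic M \<sigma>" "\<sigma> 0 = \<gamma> (a + z)" "\<And>s. X (\<sigma> s) = ray z \<theta> s"
    using ray_is_geodesic[where z = z and \<theta> = \<theta>] by metis
  have pts: "\<sigma> s \<in> points M" for s using \<sigma>(1) unit_speed_point by (simp add: geodesic_def)
  have "\<sigma> L = q" using X_eq_iff[OF q(1) pts, of L] q(2) \<sigma>(3) by simp
  \<comment> \<open>The first coordinate along the needle, whose zeros lie on
    \<open>orthogonal_line 0\<close>. At both ends the second summand dominates the first, and it is
    odd in \<open>s\<close>, so there is a change of sign.\<close>
  define h where "h s = cs K s * sn K z + sn K s * cs K z * cos \<theta>" for s
  have cont: "continuous_on A h" for A unfolding h_def by (intro continuous_intros)
  have "\<bar>cs K L * sn K z\<bar> \<le> \<bar>sn K L * cs K z * cos \<theta>\<bar>"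
    using q(3) csL snL csz by (simp add: abs_mult mult.commute)
  then have "(h (-L) \<le> 0 \<and> 0 \<le> h L) \<or> (h L \<le> 0 \<and> 0 \<le> h (-L))"
    unfolding h_def sn_minus cs_minus by (auto simp: abs_if split: if_splits)
  then obtain s where s: "-L \<le> s" "s \<le> L" "h s = 0"
    using IVT'[OF _ _ _ cont, of "-L" 0 L] IVT2'[OF _ _ _ cont, of L 0 "-L"] L0 by force
  then have "\<sigma> s \<in> orthogonal_line 0"
    using pts by (simp add: orthogonal_line_def \<sigma>(3) ray_comp h_def)
  then have "\<sigma> s \<in> \<Union>G" using Union_grating(1)[OF G] by blast
  then have "\<sigma> s \<in> \<sigma> ` {-L..L} \<inter> \<Union>G" using s by simp
  moreover have "needle M L (\<gamma> (a + z)) q (\<sigma> ` {-L..L})"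
    unfolding needle_def using \<sigma>(1,2) \<open>\<sigma> L = q\<close> by blast
  ultimately show "q \<in> hitting_tips M G L (\<gamma> (a + z))"
    using q(1) unfolding hitting_tips_def by blast
qed

end

section \<open>Arc length parametrizations of geodesic circles\<close>

lemma circle_motion:
  fixes \<alpha> \<beta> :: "real \<Rightarrow> real"
  assumes d: "\<And>s. (\<alpha> has_real_derivative \<alpha>' s) (at s)" "\<And>s. (\<beta> has_real_derivative \<beta>' s) (at s)"
    and c: "continuous_on UNIV \<alpha>'" "continuous_on UNIV \<beta>'"
    and circ: "\<And>s. (\<alpha> s)\<^sup>2 + (\<beta> s)\<^sup>2 = 1" and speed: "\<And>s. (\<alpha>' s)\<^sup>2 + (\<beta>' s)\<^sup>2 = \<omega>\<^sup>2" and "\<omega> > 0"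
  obtains h \<theta> where "\<bar>h\<bar> = \<omega>" "\<And>s. \<alpha> s = cos (\<theta> + h * s)" "\<And>s. \<beta> s = sin (\<theta> + h * s)"
proof -
  have orth: "\<alpha> s * \<alpha>' s + \<beta> s * \<beta>' s = 0" for s
  proof -
    have "((\<lambda>s. (\<alpha> s)\<^sup>2 + (\<beta> s)\<^sup>2) has_real_derivative 2 * (\<alpha> s * \<alpha>' s + \<beta> s * \<beta>' s)) (at s)"
      by (auto intro!: derivative_eq_intros d simp: algebra_simps)
    then show ?thesis unfolding circ using DERIV_unique[OF _ DERIV_const] by fastforce
  qed
  \<comment> \<open>The angular velocity. By Lagrange's identity its square is the square of the
    speed, and continuity of the derivatives excludes a change of sign, so it is constant.\<close>
  define g where "g s = \<alpha> s * \<beta>' s - \<beta> s * \<alpha>' s" for s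
  have g2: "(g s)\<^sup>2 = \<omega>\<^sup>2" for s
    using circ[of s] speed[of s] orth[of s] unfolding g_def by algebra
  have "continuous_on UNIV \<alpha>" "continuous_on UNIV \<beta>"
    using d by (meson DERIV_isCont continuous_at_imp_continuous_on)+
  then have gc: "continuous_on A g" for A
    unfolding g_def by (intro continuous_intros; metis c continuous_on_subset subset_UNIV)
  have gw: "g s = \<omega> \<or> g s = - \<omega>" for s
    using g2[of s] by (simp add: power2_eq_iff)
  have const: "g s = g 0" for s
  proof (rule ccontr)
    assume "g s \<noteq> g 0"
    then have "(g 0 \<le> 0 \<and> 0 \<le> g s) \<or> (g s \<le> 0 \<and> 0 \<le> g 0)"
      using gw[of s] gw[of 0] \<open>\<omega> > 0\<close> by auto
    then have "\<exists>r. g r = 0"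
      using IVT'[OF _ _ _ gc, of 0 0 s] IVT2'[OF _ _ _ gc, of s 0 0]
        IVT'[OF _ _ _ gc, of s 0 0] IVT2'[OF _ _ _ gc, of 0 0 s] by (cases "0 \<le> s") force+
    then obtain r where "g r = 0" by blast
    then show False using gw[of r] \<open>\<omega> > 0\<close> by simp
  qed
  define h where "h = g 0"
  have h: "\<alpha> s * \<beta>' s - \<beta> s * \<alpha>' s = h" for s using const[of s] by (simp add: g_def h_def)
  have a': "\<alpha>' s = - h * \<beta> s" for s using orth[of s] circ[of s] h[of s] by algebra
  have b': "\<beta>' s = h * \<alpha> s" for s using orth[of s] circ[of s] h[of s] by algebra
  \<comment> \<open>Turned back by the angle \<open>h * s\<close>, the moving point stands
    still.\<close>
  have "((\<lambda>s. cos (h * s) * \<alpha> s + sin (h * s) * \<beta> s) has_real_derivative 0) (at s)"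
    "((\<lambda>s. cos (h * s) * \<beta> s - sin (h * s) * \<alpha> s) has_real_derivative 0) (at s)" for s
    using d[of s] unfolding a' b' by (auto intro!: derivative_eq_intros simp: algebra_simps)
  then have C: "cos (h * s) * \<alpha> s + sin (h * s) * \<beta> s = \<alpha> 0" "cos (h * s) * \<beta> s - sin (h * s) * \<alpha> s = \<beta> 0" for s
    using DERIV_isconst_all[of "\<lambda>s. cos (h * s) * \<alpha> s + sin (h * s) * \<beta> s" s 0]
      DERIV_isconst_all[of "\<lambda>s. cos (h * s) * \<beta> s - sin (h * s) * \<alpha> s" s 0] by auto
  obtain \<theta> where \<theta>: "\<alpha> 0 = cos \<theta>" "\<beta> 0 = sin \<theta>" using circ[of 0] by (rule sincos_total_2pi)
  have "\<alpha> s = cos (\<theta> + h * s)" "\<beta> s = sin (\<theta> + h * s)" for s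
  proof -
    note e = C[of s, unfolded \<theta>] and sc = sin_cos_squared_add[of "h * s", unfolded power2_eq_square]
    have gen: "p * C - q * S = a \<and> q * C + p * S = b"
      if "C * a + S * b = p" "C * b - S * a = q" "S * S + C * C = 1" for C S p q a b :: real
    proof -
      have "p * C - q * S = (S * S + C * C) * a" "q * C + p * S = (S * S + C * C) * b"
        unfolding that(1,2)[symmetric] by (simp_all add: algebra_simps)
      then show ?thesis unfolding that(3) by simp
    qed
    show "\<alpha> s = cos (\<theta> + h * s)" "\<beta> s = sin (\<theta> + h * s)"
      using gen[OF e sc] unfolding cos_add sin_add by simp_all
  qed
  moreover have "\<bar>h\<bar> = \<omega>" using gw[of 0] \<open>\<omega> > 0\<close> by (auto simp: h_def)
  ultimately show ?thesis using that by blast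
qed

context normalized_equator
begin

text \<open>The expressions are the coordinates of \<open>x\<close> in the frame formed by
  \<open>tang z\<close>, \<open>axis 2 1\<close> and \<open>X (\<gamma> (a + z))\<close>; on the
  circle they are \<open>sn K L * cos \<theta>\<close>, \<open>sn K L * sin \<theta>\<close> and
  \<open>cs K L\<close>. Eliminating \<open>\<theta>\<close> leaves closed conditions on
  \<open>x\<close>.\<close>

lemma on_circle_iff:
  assumes "sn K L > 0"
  shows "(\<exists>\<theta>. x = ray z \<theta> L) \<longleftrightarrow>
    (x$1 * cs K z - x$3 * sn K z)\<^sup>2 + (x$2)\<^sup>2 = (sn K L)\<^sup>2 \<and> K * x$1 * sn K z + x$3 * cs K z = cs K L"
    (is "?l \<longleftrightarrow> ?r")
    and "x = ray z \<theta> L \<Longrightarrow> x$1 * cs K z - x$3 * sn K z = sn K L * cos \<theta>"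
proof -
  note sq = cs_sn_square[of K z, unfolded power2_eq_square]
  show comp: "x$1 * cs K z - x$3 * sn K z = sn K L * cos \<theta>" if "x = ray z \<theta> L" for x \<theta>
  proof -
    have "x$1 * cs K z - x$3 * sn K z = (cs K z * cs K z + K * (sn K z * sn K z)) * (sn K L * cos \<theta>)"
      unfolding that ray_comp by (simp add: algebra_simps)
    then show ?thesis using sq by simp
  qed
  have comp2: "K * ray z \<theta> L$1 * sn K z + ray z \<theta> L$3 * cs K z = cs K L" for \<theta>
  proof -
    have "K * ray z \<theta> L$1 * sn K z + ray z \<theta> L$3 * cs K z = (cs K z * cs K z + K * (sn K z * sn K z)) * cs K L"
      unfolding ray_comp by (simp add: algebra_simps)
    then show ?thesis using sq by simp
  qed
  show "?l \<longleftrightarrow> ?r"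
  proof
    assume ?l
    then obtain \<theta> where \<theta>: "x = ray z \<theta> L" by blast
    have "(sn K L * cos \<theta>)\<^sup>2 + (sn K L * sin \<theta>)\<^sup>2 = (sn K L)\<^sup>2 * ((sin \<theta>)\<^sup>2 + (cos \<theta>)\<^sup>2)"
      by (simp add: power_mult_distrib algebra_simps del: sin_cos_squared_add sin_cos_squared_add2)
    then show ?r using comp[OF \<theta>] comp2[of \<theta>] \<theta> ray_comp(2)[of z \<theta> L] by simp
  next
    assume r: ?r
    define b where "b = x$1 * cs K z - x$3 * sn K z"
    have "(b / sn K L)\<^sup>2 + (x$2 / sn K L)\<^sup>2 = 1"
      using r assms by (simp add: b_def[symmetric] power_divide flip: add_divide_distrib)
    then obtain \<theta> where \<theta>: "b / sn K L = cos \<theta>" "x$2 / sn K L = sin \<theta>" by (rule sincos_total_2pi)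
    have \<theta>': "b = sn K L * cos \<theta>" "x$2 = sn K L * sin \<theta>" using \<theta> assms by (simp_all add: field_simps)
    have d: "K * x$1 * sn K z + x$3 * cs K z = cs K L" using r by simp
    have "x$1 = cs K L * sn K z + b * cs K z" unfolding d[symmetric] b_def using sq by algebra
    moreover have "x$3 = cs K L * cs K z - K * b * sn K z" unfolding d[symmetric] b_def using sq by algebra
    ultimately have "x = ray z \<theta> L" by (simp add: vec_eq_iff forall_3 ray_comp \<theta>' mult_ac)
    then show ?l by blast
  qed
qed

lemma ray_cong: "cos \<theta> = cos \<theta>' \<Longrightarrow> sin \<theta> = sin \<theta>' \<Longrightarrow> ray z \<theta> s = ray z \<theta>' s"
  by (simp add: ray_def)

lemma ray_eq_iff:
  assumes "sn K L > 0"
  shows "ray z \<theta> L = ray z \<theta>' L \<longleftrightarrow> cos \<theta> = cos \<theta>' \<and> sin \<theta> = sin \<theta>'"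
proof
  assume eq: "ray z \<theta> L = ray z \<theta>' L"
  have "sn K L * cos \<theta> = sn K L * cos \<theta>'"
    using on_circle_iff(2)[OF assms eq] on_circle_iff(2)[OF assms refl, of z \<theta>] by simp
  moreover have "sn K L * sin \<theta> = sn K L * sin \<theta>'" using eq ray_comp(2) by metis
  ultimately show "cos \<theta> = cos \<theta>' \<and> sin \<theta> = sin \<theta>'" using assms by simp
qed (use ray_cong in blast)

text \<open>The circle of radius \<open>L\<close> has circumference \<open>2 * pi * sn K L\<close>,
  and the angle divided out by \<open>sn K L\<close> is arc length. Existence gives the choice in
  \<open>uniform_on_curve\<close> its meaning.\<close>

lemma circle_arclength_param:
  assumes "sn K L > 0"
  shows "\<exists>l c. arclength_param M (geodesic_circle M (\<gamma> (a + z)) L) l c"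
proof -
  define \<rho> where "\<rho> = sn K L"
  have \<rho>: "\<rho> > 0" using assms by (simp add: \<rho>_def)
  define Y where "Y s = ray z (s / \<rho>) L" for s
  define D where "D s = (- sin (s / \<rho>)) *\<^sub>R tang z + cos (s / \<rho>) *\<^sub>R axis 2 (1::real)" for s
  define c where "c s = inv_into (points M) X (Y s)" for s
  have "Y s \<in> X ` points M" for s unfolding image Y_def by (rule ray_in_quadric)
  then have c: "c s \<in> points M" "X (c s) = Y s" for s
    by (auto simp: c_def inv_into_into f_inv_into_f)
  have Y': "(Y has_vector_derivative D s) (at s)" for s
  proof -
    have "Y = (\<lambda>s. cs K L *\<^sub>R X (\<gamma> (a + z)) + ((\<rho> * cos (s / \<rho>)) *\<^sub>R tang z + (\<rho> * sin (s / \<rho>)) *\<^sub>R axis 2 1))"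
      by (auto simp: Y_def ray_def \<rho>_def algebra_simps)
    moreover have "((\<lambda>s. cs K L *\<^sub>R X (\<gamma> (a + z)) + ((\<rho> * cos (s / \<rho>)) *\<^sub>R tang z + (\<rho> * sin (s / \<rho>)) *\<^sub>R axis 2 (1::real)))
      has_vector_derivative 0 + D s) (at s)"
      unfolding D_def using \<rho>
      by (intro has_vector_derivative_add has_vector_derivative_scaleR_const has_vector_derivative_const)
         (auto intro!: derivative_eq_intros)
    ultimately show ?thesis by simp
  qed
  have Dc: "continuous_on UNIV D" unfolding D_def by (intro continuous_intros) (use \<rho> in auto)
  have D1: "form K (D s) (D s) = 1" for s
  proof -
    have "D s = cos (pi / 2 + s / \<rho>) *\<^sub>R tang z + sin (pi / 2 + s / \<rho>) *\<^sub>R axis 2 1"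
      by (simp add: D_def cos_add sin_add)
    then show ?thesis using unit_tangent_iff[of z] by blast
  qed
  have us: "unit_speed_curve M c" by (rule unit_speed_lift[OF Y' c Dc D1])
  moreover have "c (s + 2 * pi * \<rho>) = c s" for s
  proof -
    have "(s + 2 * pi * \<rho>) / \<rho> = s / \<rho> + 2 * pi" using \<rho> by (simp add: field_simps)
    then have "Y (s + 2 * pi * \<rho>) = Y s" unfolding Y_def by (intro ray_cong) simp_all
    then show ?thesis by (simp add: c_def)
  qed
  moreover have "bij_betw c {0..<2 * pi * \<rho>} (geodesic_circle M (\<gamma> (a + z)) L)"
  proof (rule bij_betw_imageI)
    show "inj_on c {0..<2 * pi * \<rho>}"
    proof (rule inj_onI)
      fix s t assume st: "s \<in> {0..<2 * pi * \<rho>}" "t \<in> {0..<2 * pi * \<rho>}" "c s = c t"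
      then have "Y s = Y t" using c by metis
      then obtain n :: int where n: "t / \<rho> = s / \<rho> + 2 * pi * n"
        using ray_eq_iff[OF assms] sin_cos_eq_iff[of "t / \<rho>" "s / \<rho>"] unfolding Y_def by metis
      then have e: "t = s + 2 * pi * \<rho> * n" using \<rho> by (simp add: field_simps)
      have "\<bar>t - s\<bar> < 2 * pi * \<rho>" using st by auto
      then have "\<bar>2 * pi * \<rho> * n\<bar> < 2 * pi * \<rho> * 1" unfolding e by simp
      then have "\<bar>real_of_int n\<bar> < 1" using \<rho> by (simp add: abs_mult)
      then have "n = 0" by linarith
      then show "s = t" using e by simp
    qed
    show "c ` {0..<2 * pi * \<rho>} = geodesic_circle M (\<gamma> (a + z)) L"
    proof (intro equalityI subsetI)
      fix q assume "q \<in> c ` {0..<2 * pi * \<rho>}"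
      then show "q \<in> geodesic_circle M (\<gamma> (a + z)) L"
        using c unfolding geodesic_circle_eq Y_def by blast
    next
      fix q assume "q \<in> geodesic_circle M (\<gamma> (a + z)) L"
      then obtain \<theta> where q: "q \<in> points M" "X q = ray z \<theta> L" unfolding geodesic_circle_eq by blast
      obtain t where t: "0 \<le> t" "t < 2 * pi" "cos \<theta> = cos t" "sin \<theta> = sin t"
        using sincos_total_2pi[of "cos \<theta>" "sin \<theta>"] by (metis sin_cos_squared_add2)
      have "X q = Y (\<rho> * t)" unfolding q(2) Y_def using \<rho> t by (intro ray_cong) simp_all
      then have "q = c (\<rho> * t)" using c q X_eq_iff by metis
      moreover have "\<rho> * t \<in> {0..<2 * pi * \<rho>}" using t \<rho> by simp
      ultimately show "q \<in> c ` {0..<2 * pi * \<rho>}" by blast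
    qed
  qed
  ultimately have "arclength_param M (geodesic_circle M (\<gamma> (a + z)) L) (2 * pi * \<rho>) c"
    using \<rho> by (simp add: arclength_param_def)
  then show ?thesis by blast
qed

text \<open>In the frame at the centre the curve moves on a Euclidean circle with constant speed, so
  \<open>circle_motion\<close> applies. Periodicity makes the total angle a multiple of
  \<open>2 * pi\<close>, and injectivity on one period excludes more than one turn.\<close>

lemma arclength_param_is_rotation:
  assumes snL: "sn K L > 0" and c: "arclength_param M (geodesic_circle M (\<gamma> (a + z)) L) l c"
  obtains h \<theta> where "\<bar>h\<bar> * l = 2 * pi" "\<And>s. X (c s) = ray z (\<theta> + h * s) L"
proof -
  have l: "l > 0" and us: "unit_speed_curve M c" and per: "\<And>s. c (s + l) = c s"
    and bij: "bij_betw c {0..<l} (geodesic_circle M (\<gamma> (a + z)) L)"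
    using c by (auto simp: arclength_param_def)
  have perk: "c (s + real k * l) = c s" for s k
  proof (induction k)
    case (Suc k)
    have "c (s + real (Suc k) * l) = c ((s + real k * l) + l)" by (simp add: algebra_simps)
    then show ?case using per Suc by simp
  qed simp
  have circ: "\<exists>\<theta>. X (c s) = ray z \<theta> L" for s
  proof -
    \<comment> \<open>The bijection speaks only of \<open>{0..<l}\<close>; other parameters are
      brought there by the period.\<close>
    define k where "k = \<lfloor>s / l\<rfloor>"
    define r where "r = s - of_int k * l"
    have r: "r \<in> {0..<l}"
      using l floor_divide_lower[of l s] floor_divide_upper[of l s] by (auto simp: r_def k_def algebra_simps)
    have "c r = c s"
    proof (cases "k \<ge> 0")
      case True
      then show ?thesis using perk[of r "nat k"] by (simp add: r_def)
    next
      case False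
      then show ?thesis using perk[of s "nat (-k)"] by (simp add: r_def)
    qed
    moreover have "c r \<in> geodesic_circle M (\<gamma> (a + z)) L" using bij r bij_betwE by blast
    ultimately show ?thesis unfolding geodesic_circle_eq by auto
  qed
  define D where "D t = vector_derivative (\<lambda>s. X (c s)) (at t)" for t
  note U = unit_speed_embedded[OF us, folded D_def]
  define \<rho> where "\<rho> = sn K L"
  have \<rho>: "\<rho> > 0" using snL by (simp add: \<rho>_def)
  have comp: "((\<lambda>s. X (c s) $ i) has_real_derivative D s $ i) (at s)" for i s
    using bounded_linear.has_vector_derivative[OF bounded_linear_vec_nth U(1)]
    by (simp add: has_real_derivative_iff_has_vector_derivative)
  define \<alpha> where "\<alpha> s = (X (c s) $ 1 * cs K z - X (c s) $ 3 * sn K z) / \<rho>" for s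
  define \<beta> where "\<beta> s = X (c s) $ 2 / \<rho>" for s
  define \<alpha>' where "\<alpha>' s = (D s $ 1 * cs K z - D s $ 3 * sn K z) / \<rho>" for s
  define \<beta>' where "\<beta>' s = D s $ 2 / \<rho>" for s
  have oc: "(X (c s)$1 * cs K z - X (c s)$3 * sn K z)\<^sup>2 + (X (c s)$2)\<^sup>2 = \<rho>\<^sup>2"
    "K * X (c s)$1 * sn K z + X (c s)$3 * cs K z = cs K L" for s
    using on_circle_iff(1)[OF snL, of "X (c s)" z] circ[of s] by (auto simp: \<rho>_def)
  have d1: "(\<alpha> has_real_derivative \<alpha>' s) (at s)" for s
    unfolding \<alpha>_def[abs_def] \<alpha>'_def by (intro DERIV_cdivide DERIV_diff DERIV_cmult_right comp)
  have d2: "(\<beta> has_real_derivative \<beta>' s) (at s)" for s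
    unfolding \<beta>_def[abs_def] \<beta>'_def by (intro DERIV_cdivide comp)
  have c1: "continuous_on UNIV \<alpha>'" unfolding \<alpha>'_def[abs_def] using \<rho> by (auto intro!: continuous_intros U(2))
  have c2: "continuous_on UNIV \<beta>'" unfolding \<beta>'_def[abs_def] using \<rho> by (auto intro!: continuous_intros U(2))
  have circ1: "(\<alpha> s)\<^sup>2 + (\<beta> s)\<^sup>2 = 1" for s
    using oc(1)[of s] \<rho> by (simp add: \<alpha>_def \<beta>_def power_divide flip: add_divide_distrib)
  have speed: "(\<alpha>' s)\<^sup>2 + (\<beta>' s)\<^sup>2 = (1 / \<rho>)\<^sup>2" for s
  proof -
    note sq = cs_sn_square[of K z, unfolded power2_eq_square]
    \<comment> \<open>The component along the centre is constant on the circle, so the velocity lies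
      in the plane of \<open>tang z\<close> and \<open>axis 2 1\<close>, where unit speed becomes a
      sum of two squares.\<close>
    define e where "e = D s $ 1 * cs K z - D s $ 3 * sn K z"
    have "((\<lambda>s. K * sn K z * X (c s) $ 1 + cs K z * X (c s) $ 3) has_real_derivative
        (K * sn K z * D s $ 1 + cs K z * D s $ 3)) (at s)"
      by (intro DERIV_add DERIV_cmult comp)
    moreover have "K * sn K z * X (c s) $ 1 + cs K z * X (c s) $ 3 = cs K L" for s
      using oc(2)[of s] by (simp add: mult_ac)
    ultimately have z0: "K * sn K z * D s $ 1 + cs K z * D s $ 3 = 0"
      using DERIV_unique[OF _ DERIV_const] by simp
    have D1: "D s $ 1 = e * cs K z" unfolding e_def using z0 sq by algebra
    have D3: "D s $ 3 = K * (- e * sn K z)" unfolding e_def using z0 sq by algebra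
    have "1 = e * e * ((cs K z)\<^sup>2 + K * (sn K z)\<^sup>2) + D s $ 2 * D s $ 2"
      using U(3)[of s] unfolding form_third_component[OF D3 D3] D1 by (simp add: power2_eq_square algebra_simps)
    then have "e * e + D s $ 2 * D s $ 2 = 1" by (simp add: cs_sn_square)
    then show ?thesis
      by (simp add: \<alpha>'_def \<beta>'_def e_def[symmetric] power_divide power2_eq_square flip: add_divide_distrib)
  qed
  obtain h \<theta> where h: "\<bar>h\<bar> = 1 / \<rho>" "\<And>s. \<alpha> s = cos (\<theta> + h * s)" "\<And>s. \<beta> s = sin (\<theta> + h * s)"
    using circle_motion[OF d1 d2 c1 c2 circ1 speed] \<rho> by (metis divide_pos_pos zero_less_one)
  have X: "X (c s) = ray z (\<theta> + h * s) L" for s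
  proof -
    obtain \<phi> where \<phi>: "X (c s) = ray z \<phi> L" using circ by blast
    have "cos \<phi> = \<alpha> s" using on_circle_iff(2)[OF snL \<phi>] \<rho> by (simp add: \<alpha>_def \<rho>_def)
    moreover have "sin \<phi> = \<beta> s" using \<rho> by (simp add: \<beta>_def \<phi> ray_comp \<rho>_def)
    ultimately show ?thesis unfolding \<phi> h(2,3) by (rule ray_cong)
  qed
  have hl: "\<bar>h\<bar> * l > 0" using h(1) \<rho> l by simp
  have "X (c l) = X (c 0)" using per[of 0] by simp
  then obtain n :: int where n: "\<theta> + h * l = \<theta> + 2 * pi * n"
    unfolding X ray_eq_iff[OF snL] using sin_cos_eq_iff[of "\<theta> + h * l" "\<theta> + h * 0"] by auto
  then have "h * l = 2 * pi * n" by simp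
  then have hn: "\<bar>h\<bar> * l = 2 * pi * \<bar>real_of_int n\<bar>" using l by (metis abs_mult abs_of_pos pi_gt_zero zero_less_mult_iff zero_less_numeral)
  then have "n \<noteq> 0" using hl by auto
  then have n1: "\<bar>real_of_int n\<bar> \<ge> 1" by linarith
  have "\<bar>h\<bar> * l \<le> 2 * pi"
  proof (rule ccontr)
    assume gt: "\<not> \<bar>h\<bar> * l \<le> 2 * pi"
    \<comment> \<open>With more than one turn the curve would be back at its start at time
      \<open>t\<close>, before the end of the period.\<close>
    define t where "t = 2 * pi / \<bar>h\<bar>"
    have h0: "\<bar>h\<bar> > 0" using h(1) \<rho> by simp
    then have t: "t > 0" "t < l" using gt by (auto simp: t_def field_simps)
    have "h * t = 2 * pi \<or> h * t = - (2 * pi)" using h0 by (auto simp: t_def abs_if)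
    then have "cos (\<theta> + h * t) = cos (\<theta> + h * 0)" "sin (\<theta> + h * t) = sin (\<theta> + h * 0)"
      by (auto simp: cos_diff sin_diff)
    then have "X (c t) = X (c 0)" unfolding X by (rule ray_cong)
    then have "c t = c 0" using X_eq_iff[OF U(4) U(4)] by blast
    moreover have "inj_on c {0..<l}" using bij by (rule bij_betw_imp_inj_on)
    ultimately have "t = 0" using t l by (auto dest: inj_onD)
    then show False using t by simp
  qed
  moreover have "2 * pi * 1 \<le> 2 * pi * \<bar>real_of_int n\<bar>" using n1 by (intro mult_left_mono) auto
  ultimately have "\<bar>h\<bar> * l = 2 * pi" using hn by simp
  then show ?thesis using that X by blast
qed

end

section \<open>Measurability, the conditional probability and the Buffon probability\<close>

lemma sets_surface_borel:
  "sets (surface_borel M) = sigma_sets (points M) {U. openin (surface_topology M) U}"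
proof -
  have "{U. openin (surface_topology M) U} \<subseteq> Pow (points M)"
    by (auto simp: openin_surface_topology)
  then show ?thesis unfolding surface_borel_def by (simp add: sets_measure_of)
qed

lemma (in space_form) curve_measurable:
  assumes "continuous_map euclideanreal (surface_topology M) c"
  shows "c \<in> borel \<rightarrow>\<^sub>M surface_borel M"
  unfolding surface_borel_def
proof (rule measurable_measure_of)
  show "{U. openin (surface_topology M) U} \<subseteq> Pow (points M)"
    by (auto simp: openin_surface_topology)
  show "c \<in> space borel \<rightarrow> points M"
    using assms by (auto simp: continuous_map topspace_eq)
  show "c -` U \<inter> space borel \<in> sets borel" if "U \<in> {U. openin (surface_topology M) U}" for U
    using preimage_open[OF assms, of U] that by simp
qed

lemma (in space_form) closed_X_vimage:
  assumes "closed C"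
  shows "{p \<in> points M. X p \<in> C} \<in> sets (surface_borel M)"
proof -
  have "{p \<in> points M. X p \<in> - C} \<in> sets (surface_borel M)"
    unfolding sets_surface_borel using openin_X_vimage[of "- C"] assms
    by (intro sigma_sets.Basic) auto
  then have "points M - {p \<in> points M. X p \<in> - C} \<in> sets (surface_borel M)"
    unfolding sets_surface_borel by (rule sigma_sets.Compl)
  moreover have "points M - {p \<in> points M. X p \<in> - C} = {p \<in> points M. X p \<in> C}" by auto
  ultimately show ?thesis by simp
qed

context normalized_equator
begin

lemma conditional_probability:
  assumes L: "small K L" and adm: "K > 0 \<Longrightarrow> \<exists>n::nat. n > 1 \<and> 2 * real n * sqrt K * L = pi"
    and G: "grating M \<gamma> L G" "\<gamma> a \<in> \<Union>G" and z: "\<bar>z\<bar> < L"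
  shows "measure (uniform_on_curve M (geodesic_circle M (\<gamma> (a + z)) L)) (hitting_tips M G L (\<gamma> (a + z)))
    = 2 / pi * arccos (tn K \<bar>z\<bar> / tn K L)"
proof -
  have L0: "0 < L" using L by (simp add: small_def)
  have csL: "cs K L > 0" and csz: "cs K z > 0" using cs_pos[OF L] z L0 by auto
  have snL: "sn K L > 0" using sn_pos[OF L] L0 by auto
  define C where "C = geodesic_circle M (\<gamma> (a + z)) L"
  define H where "H = hitting_tips M G L (\<gamma> (a + z))"
  define \<tau> where "\<tau> = tn K \<bar>z\<bar> / tn K L"
  have \<tau>: "0 \<le> \<tau>" "\<tau> \<le> 1" using arccos_tn_continuous(2)[OF L, of "\<bar>z\<bar>"] z by (auto simp: \<tau>_def)
  have snz: "sn K \<bar>z\<bar> = \<bar>sn K z\<bar>" "cs K \<bar>z\<bar> = cs K z"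
  proof -
    have "0 \<le> sn K \<bar>z\<bar>" using sn_pos[OF L, of "\<bar>z\<bar>"] z by (cases "z = 0") auto
    then show "sn K \<bar>z\<bar> = \<bar>sn K z\<bar>" by (cases "z \<ge> 0") auto
  qed (simp add: abs_if)
  have hit_iff: "\<bar>sn K z\<bar> * cs K L \<le> sn K L * cs K z * \<bar>cos \<theta>\<bar> \<longleftrightarrow> \<tau> \<le> \<bar>cos \<theta>\<bar>" for \<theta>
    unfolding \<tau>_def tn_def snz using csL csz snL by (simp add: field_simps)
  have H: "H = {q \<in> points M. \<exists>\<theta>. X q = ray z \<theta> L \<and> \<tau> \<le> \<bar>cos \<theta>\<bar>}"
    unfolding H_def hit_iff[symmetric] by (rule hitting_tips_eq[OF L _ G z]) (rule adm)
  \<comment> \<open>Equations and weak inequalities describe the hits as the preimage of a closed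
    set, hence as a measurable set.\<close>
  define W where "W = {x::real^3. (x$1 * cs K z - x$3 * sn K z)\<^sup>2 + (x$2)\<^sup>2 = (sn K L)\<^sup>2 \<and>
      K * x$1 * sn K z + x$3 * cs K z = cs K L \<and> \<tau> * sn K L \<le> \<bar>x$1 * cs K z - x$3 * sn K z\<bar>}"
  have HW: "H = {q \<in> points M. X q \<in> W}"
  proof -
    have "(\<exists>\<theta>. x = ray z \<theta> L \<and> \<tau> \<le> \<bar>cos \<theta>\<bar>) \<longleftrightarrow>
      (x$1 * cs K z - x$3 * sn K z)\<^sup>2 + (x$2)\<^sup>2 = (sn K L)\<^sup>2 \<and>
      K * x$1 * sn K z + x$3 * cs K z = cs K L \<and> \<tau> * sn K L \<le> \<bar>x$1 * cs K z - x$3 * sn K z\<bar>" for x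
    proof -
      have "\<tau> \<le> \<bar>cos \<theta>\<bar> \<longleftrightarrow> \<tau> * sn K L \<le> \<bar>x$1 * cs K z - x$3 * sn K z\<bar>" if "x = ray z \<theta> L" for \<theta>
        unfolding on_circle_iff(2)[OF snL that] using snL by (simp add: abs_mult mult.commute)
      then show ?thesis using on_circle_iff(1)[OF snL, of x z] by blast
    qed
    then show ?thesis unfolding H W_def by simp
  qed
  have "closed {x::real^3. (x$1 * cs K z - x$3 * sn K z)\<^sup>2 + (x$2)\<^sup>2 = (sn K L)\<^sup>2 \<and>
      K * x$1 * sn K z + x$3 * cs K z = cs K L \<and> \<tau> * sn K L \<le> \<bar>x$1 * cs K z - x$3 * sn K z\<bar>}"
    by (intro closed_Collect_conj closed_Collect_eq closed_Collect_le continuous_intros)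
  then have "closed W" unfolding W_def .
  from closed_X_vimage[OF this] have Hm: "H \<in> sets (surface_borel M)" unfolding HW .
  have "\<exists>p. case p of (l, c) \<Rightarrow> arclength_param M C l c"
    using circle_arclength_param[OF snL] by (auto simp: C_def)
  then have some: "case (SOME (l, c). arclength_param M C l c) of (l, c) \<Rightarrow> arclength_param M C l c"
    by (rule someI_ex)
  obtain l c where lc: "(SOME (l, c). arclength_param M C l c) = (l, c)" by (meson surj_pair)
  then have param: "arclength_param M C l c" using some by simp
  have unif: "uniform_on_curve M C = distr (uniform_measure lborel {0..<l}) (surface_borel M) c"
    unfolding uniform_on_curve_def lc by simp
  have l: "l > 0" and us: "unit_speed_curve M c" using param by (auto simp: arclength_param_def)
  have cpts: "c s \<in> points M" for s using unit_speed_point[OF us] .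
  have cm: "c \<in> borel \<rightarrow>\<^sub>M surface_borel M"
    using us by (intro curve_measurable) (simp add: unit_speed_curve_def)
  then have cm': "c \<in> uniform_measure lborel {0..<l} \<rightarrow>\<^sub>M surface_borel M"
    by (simp cong: measurable_cong_sets)
  obtain h \<theta> where h: "\<bar>h\<bar> * l = 2 * pi" "\<And>s. X (c s) = ray z (\<theta> + h * s) L"
    using arclength_param_is_rotation[OF snL param[unfolded C_def]] by metis
  have c_in_H: "c s \<in> H \<longleftrightarrow> \<tau> \<le> \<bar>cos (\<theta> + h * s)\<bar>" for s
    unfolding H using cpts h(2) ray_eq_iff[OF snL] by auto
  have "measure (uniform_on_curve M C) H = measure (uniform_measure lborel {0..<l}) (c -` H)"
    unfolding unif using measure_distr[OF cm' Hm] by simp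
  also have "\<dots> = measure lborel ({0..<l} \<inter> c -` H) / measure lborel {0..<l}"
    using measurable_sets[OF cm Hm] l by (intro measure_uniform_measure) auto
  also have "{0..<l} \<inter> c -` H = {s \<in> {0..<l}. \<tau> \<le> \<bar>cos (\<theta> + h * s)\<bar>}"
    using c_in_H by auto
  also have "measure lborel {s \<in> {0..<l}. \<tau> \<le> \<bar>cos (\<theta> + h * s)\<bar>} = 2 * arccos \<tau> / pi * l"
    by (rule measure_cos_band[OF \<tau> h(1)])
  also have "2 * arccos \<tau> / pi * l / measure lborel {0..<l} = 2 / pi * arccos \<tau>"
    using l by simp
  finally show ?thesis by (simp add: C_def H_def \<tau>_def)
qed

end

text \<open>The Bochner integral calls for an integrand measurable on the whole line, while
  \<open>conditional_probability\<close> describes it only near one grating point. Every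
  \<open>\<gamma> (a + 2 * m * L)\<close> is a grating point, and normalizing the embedding there
  gives the same formula on each interval of length \<open>2 * L\<close>; together these cover the
  line up to countably many points.\<close>

lemma (in space_form) buffon_probability_eq:
  assumes L: "small K L" and adm: "K > 0 \<Longrightarrow> \<exists>n::nat. n > 1 \<and> 2 * real n * sqrt K * L = pi"
    and \<gamma>: "geodesic M \<gamma>" and G: "grating M \<gamma> L G" "\<gamma> a \<in> \<Union>G"
  shows "buffon_probability M \<gamma> G a L = 2 / (pi * L) * angle_integral K L"
proof -
  have L0: "0 < L" using L by (simp add: small_def)
  define f where "f z = measure (uniform_on_curve M (geodesic_circle M (\<gamma> (a + z)) L))
    (hitting_tips M G L (\<gamma> (a + z)))" for z
  have f: "f (2 * of_int m * L + z) = 2 / pi * arccos (tn K \<bar>z\<bar> / tn K L)" if z: "\<bar>z\<bar> < L" for z and m :: int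
  proof -
    have "\<gamma> (a + 2 * of_int m * L) \<in> \<Union>G" using G unfolding grating_def by blast
    moreover obtain X' where X': "space_form M K X'"
      "\<And>s. X' (\<gamma> (a + 2 * of_int m * L + s)) = cs K s *\<^sub>R axis 3 1 + sn K s *\<^sub>R axis 1 1"
      using normalize[OF \<gamma>, of "a + 2 * of_int m * L"] by metis
    interpret normalized_equator M K X' \<gamma> "a + 2 * of_int m * L"
      using X' \<gamma> by (intro normalized_equator.intro normalized_equator_axioms.intro)
    from calculation show ?thesis
      using conditional_probability[OF L adm G(1) _ z] by (simp add: f_def add.assoc)
  qed
  define F where "F z = indicator {0..L} z *\<^sub>R arccos (tn K z / tn K L)" for z
  have [measurable]: "F \<in> borel_measurable borel"
    unfolding F_def[abs_def]
    by (intro borel_measurable_continuous_on_indicator arccos_tn_continuous(1) L) simp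
  \<comment> \<open>The index of the grating point nearest to parameter \<open>z\<close>.\<close>
  define k where "k z = \<lfloor>z / (2 * L) + 1 / 2\<rfloor>" for z
  have "f \<in> borel_measurable borel"
  proof (rule measurable_discrete_difference)
    show "(\<lambda>z. 2 / pi * F \<bar>z - 2 * of_int (k z) * L\<bar>) \<in> borel_measurable borel"
      unfolding k_def by measurable
    show "countable (range (\<lambda>m::int. (2 * of_int m - 1) * L))" by simp
    fix z :: real assume nz: "z \<notin> range (\<lambda>m::int. (2 * of_int m - 1) * L)"
    define y where "y = z - 2 * of_int (k z) * L"
    have "of_int (k z) \<le> z / (2 * L) + 1 / 2" "z / (2 * L) + 1 / 2 < of_int (k z) + 1"
      unfolding k_def by linarith+
    then have "of_int (k z) * (2 * L) \<le> z + L" "z + L < (of_int (k z) + 1) * (2 * L)"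
      using L0 by (simp_all add: field_simps)
    then have "- L \<le> y" "y < L" by (simp_all add: y_def algebra_simps)
    moreover have "y \<noteq> - L"
    proof
      assume "y = - L"
      then have "z = (2 * of_int (k z) - 1) * L" by (simp add: y_def algebra_simps)
      then show False using nz by blast
    qed
    ultimately have y: "\<bar>y\<bar> < L" by simp
    have "f z = 2 / pi * arccos (tn K \<bar>y\<bar> / tn K L)" using f[OF y, of "k z"] by (simp add: y_def)
    then show "2 / pi * F \<bar>z - 2 * of_int (k z) * L\<bar> = f z"
      using y by (simp add: y_def[symmetric] F_def)
  qed auto
  from integral_uniform_arccos[OF L this] show ?thesis
    using f[of _ 0] by (simp add: buffon_probability_def f_def)
qed

section \<open>Stereographic charts\<close>

text \<open>The identity charts of the plane and of the disk are the cases \<open>\<epsilon> = 0\<close> and \<open>\<epsilon> = -1\<close>.\<close>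

definition sqn :: "real^2 \<Rightarrow> real" where
  "sqn u = (u$1)\<^sup>2 + (u$2)\<^sup>2"

definition conf_dom :: "real \<Rightarrow> (real^2) set" where
  "conf_dom \<epsilon> = {u. 1 + \<epsilon> * sqn u > 0}"

definition conf_metric :: "real \<Rightarrow> real \<Rightarrow> real^2 \<Rightarrow> real^2^2" where
  "conf_metric A \<epsilon> u = (A / (1 + \<epsilon> * sqn u)\<^sup>2) *\<^sub>R mat 1"

text \<open>Inverse of the projection from \<open>(0, 0, - \<sigma>)\<close>, for the quadric of
  curvature \<open>4 * \<epsilon> / A\<close>. In the flat case it is the scaled inclusion at height
  \<open>\<sigma>\<close>.\<close>

definition stereo_inv :: "real \<Rightarrow> real \<Rightarrow> real \<Rightarrow> real^2 \<Rightarrow> real^3" where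
  "stereo_inv A \<epsilon> \<sigma> u = vector [sqrt A * u$1 / (1 + \<epsilon> * sqn u), sqrt A * u$2 / (1 + \<epsilon> * sqn u),
     \<sigma> * (1 - \<epsilon> * sqn u) / (1 + \<epsilon> * sqn u)]"

text \<open>On the quadric, \<open>1 + \<sigma> * x$3\<close> is 2 divided by the conformal
  denominator. Expressed in this way the projection is the same formula for every
  \<open>\<epsilon>\<close>.\<close>

definition stereo_proj :: "real \<Rightarrow> real \<Rightarrow> real^3 \<Rightarrow> real^2" where
  "stereo_proj A \<sigma> x = vector [2 * x$1 / (sqrt A * (1 + \<sigma> * x$3)), 2 * x$2 / (sqrt A * (1 + \<sigma> * x$3))]"

lemma has_derivative_nth: "((\<lambda>u. u $ i) has_derivative (\<lambda>h. h $ i)) F"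
  by (rule bounded_linear.has_derivative[OF bounded_linear_vec_nth has_derivative_ident])

lemma C_on_sqn: "open W \<Longrightarrow> C_on n W (\<lambda>u. 1 + \<epsilon> * sqn u)"
  unfolding sqn_def power2_eq_square
  by (intro C_on_add C_on_mult C_on_const C_on_component)

lemma open_conf_dom: "open (conf_dom \<epsilon>)"
  unfolding conf_dom_def sqn_def by (intro open_Collect_less continuous_intros)

lemma C_on_stereo_inv: "C_on n (conf_dom \<epsilon>) (stereo_inv A \<epsilon> \<sigma>)"
proof (rule C_on_vec[OF open_conf_dom])
  fix i :: 3
  have sub: "C_on n (conf_dom \<epsilon>) (\<lambda>u. 1 - \<epsilon> * sqn u)"
    using C_on_sqn[OF open_conf_dom, of n \<epsilon> "- \<epsilon>"] by simp
  have "C_on n (conf_dom \<epsilon>) (\<lambda>u. sqrt A * u$j / (1 + \<epsilon> * sqn u))" for j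
    by (intro C_on_divide C_on_mult C_on_const C_on_component C_on_sqn open_conf_dom)
       (auto simp: conf_dom_def)
  moreover have "C_on n (conf_dom \<epsilon>) (\<lambda>u. \<sigma> * (1 - \<epsilon> * sqn u) / (1 + \<epsilon> * sqn u))"
    by (intro C_on_divide C_on_mult C_on_const sub C_on_sqn open_conf_dom)
       (auto simp: conf_dom_def)
  ultimately show "C_on n (conf_dom \<epsilon>) (\<lambda>u. stereo_inv A \<epsilon> \<sigma> u $ i)"
    using exhaust_3[of i] by (auto simp: stereo_inv_def)
qed

lemma smooth_conf_metric: "smooth_on (conf_dom \<epsilon>) (conf_metric A \<epsilon>)"
  unfolding smooth_on_def conf_metric_def[abs_def] power2_eq_square
  by (intro allI C_on_scaleR C_on_const C_on_divide C_on_mult C_on_sqn open_conf_dom)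
     (auto simp: conf_dom_def)

lemma has_derivative_sqn:
  "(sqn has_derivative (\<lambda>h. 2 * (u$1 * h$1 + u$2 * h$2))) (at u)"
  unfolding sqn_def[abs_def]
  by (auto intro!: derivative_eq_intros has_derivative_nth simp: algebra_simps)

lemma partial_stereo_inv:
  assumes u: "u \<in> conf_dom \<epsilon>"
  defines "D \<equiv> 1 + \<epsilon> * sqn u"
  shows "partial i (stereo_inv A \<epsilon> \<sigma>) u $ 1 = sqrt A * ((if i = 1 then D else 0) - 2 * \<epsilon> * u$1 * u$i) / D\<^sup>2"
    and "partial i (stereo_inv A \<epsilon> \<sigma>) u $ 2 = sqrt A * ((if i = 2 then D else 0) - 2 * \<epsilon> * u$2 * u$i) / D\<^sup>2"
    and "partial i (stereo_inv A \<epsilon> \<sigma>) u $ 3 = - 4 * \<sigma> * \<epsilon> * u$i / D\<^sup>2"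
proof -
  have D: "D \<noteq> 0" using u by (simp add: conf_dom_def D_def)
  have diff: "stereo_inv A \<epsilon> \<sigma> differentiable (at u)"
    using C_on_stereo_inv[of 1 \<epsilon> A \<sigma>] u by simp
  have comp: "partial i (stereo_inv A \<epsilon> \<sigma>) u $ k = partial i (\<lambda>v. stereo_inv A \<epsilon> \<sigma> v $ k) u" for k
    by (rule partial_bounded_linear[OF bounded_linear_vec_nth diff, symmetric])
  have i: "i = 1 \<or> i = 2" by (rule exhaust_2)
  note Dd = has_derivative_sqn[of u]
  have 1: "((\<lambda>v. sqrt A * v$k / (1 + \<epsilon> * sqn v)) has_derivative
    (\<lambda>h. (sqrt A * h$k * D - sqrt A * u$k * (2 * \<epsilon> * (u$1 * h$1 + u$2 * h$2))) / (D * D))) (at u)" for k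
    using D unfolding D_def
    by (auto intro!: derivative_eq_intros has_derivative_nth Dd simp: D_def)
  have "partial i (\<lambda>v. sqrt A * v$k / (1 + \<epsilon> * sqn v)) u
    = sqrt A * ((if i = k then D else 0) - 2 * \<epsilon> * u$k * u$i) / D\<^sup>2" for k
    using partial_eq[OF 1, of i k] i by (auto simp: axis_def power2_eq_square algebra_simps)
  then show "partial i (stereo_inv A \<epsilon> \<sigma>) u $ 1 = sqrt A * ((if i = 1 then D else 0) - 2 * \<epsilon> * u$1 * u$i) / D\<^sup>2"
    "partial i (stereo_inv A \<epsilon> \<sigma>) u $ 2 = sqrt A * ((if i = 2 then D else 0) - 2 * \<epsilon> * u$2 * u$i) / D\<^sup>2"
    unfolding comp by (simp_all add: stereo_inv_def)
  have 2: "((\<lambda>v. \<sigma> * (1 - \<epsilon> * sqn v) / (1 + \<epsilon> * sqn v)) has_derivative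
    (\<lambda>h. (- \<sigma> * (2 * \<epsilon> * (u$1 * h$1 + u$2 * h$2)) * D - \<sigma> * (2 - D) * (2 * \<epsilon> * (u$1 * h$1 + u$2 * h$2))) / (D * D))) (at u)"
  proof -
    have "(\<lambda>v. \<sigma> * (1 - \<epsilon> * sqn v) / (1 + \<epsilon> * sqn v)) = (\<lambda>v. \<sigma> * (2 - (1 + \<epsilon> * sqn v)) / (1 + \<epsilon> * sqn v))"
      by (simp add: algebra_simps)
    then show ?thesis using D unfolding D_def
      by (auto intro!: derivative_eq_intros Dd simp: D_def algebra_simps)
  qed
  have "partial i (\<lambda>v. \<sigma> * (1 - \<epsilon> * sqn v) / (1 + \<epsilon> * sqn v)) u = - 4 * \<sigma> * \<epsilon> * u$i / D\<^sup>2"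
    using partial_eq[OF 2, of i] i by (auto simp: axis_def power2_eq_square algebra_simps)
  then show "partial i (stereo_inv A \<epsilon> \<sigma>) u $ 3 = - 4 * \<sigma> * \<epsilon> * u$i / D\<^sup>2"
    unfolding comp by (simp add: stereo_inv_def)
qed

lemma pullback_stereo_inv:
  assumes "A > 0" "\<sigma> * \<sigma> = 1" and u: "u \<in> conf_dom \<epsilon>"
  shows "pullback (4 * \<epsilon> / A) (stereo_inv A \<epsilon> \<sigma>) u = conf_metric A \<epsilon> u"
proof -
  define D where "D = 1 + \<epsilon> * sqn u"
  have D: "D \<noteq> 0" using u by (simp add: conf_dom_def D_def)
  note P = partial_stereo_inv[OF u, folded D_def]
  have A: "sqrt A * sqrt A = A" using assms(1) by simp
  have "form (4 * \<epsilon> / A) (partial i (stereo_inv A \<epsilon> \<sigma>) u) (partial j (stereo_inv A \<epsilon> \<sigma>) u)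
    = (if i = j then A / D\<^sup>2 else 0)" for i j
  proof -
    define \<delta> where "\<delta> i j = (if i = j then D else 0)" for i j :: 2
    \<comment> \<open>For \<open>\<epsilon> = 0\<close> the left side is a division by 0 and equals
      0, as does the right side.\<close>
    have third: "a * \<epsilon> * (b * \<epsilon>) / (4 * \<epsilon> / A) = a * b * \<epsilon> * A / 4" for a b
      using assms(1) by (cases "\<epsilon> = 0") (auto simp: field_simps)
    have "partial i (stereo_inv A \<epsilon> \<sigma>) u $ 3 * partial j (stereo_inv A \<epsilon> \<sigma>) u $ 3 / (4 * \<epsilon> / A)
      = (- 4 * \<sigma> * u$i / D\<^sup>2) * \<epsilon> * ((- 4 * \<sigma> * u$j / D\<^sup>2) * \<epsilon>) / (4 * \<epsilon> / A)"
      unfolding P(3) by (simp add: field_simps)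
    also have "\<dots> = (- 4 * \<sigma> * u$i / D\<^sup>2) * (- 4 * \<sigma> * u$j / D\<^sup>2) * \<epsilon> * A / 4"
      by (rule third)
    also have "\<dots> = (\<sigma> * \<sigma>) * (4 * \<epsilon> * A * u$i * u$j) / (D\<^sup>2 * D\<^sup>2)"
      using D by (simp add: field_simps)
    finally have 3: "partial i (stereo_inv A \<epsilon> \<sigma>) u $ 3 * partial j (stereo_inv A \<epsilon> \<sigma>) u $ 3 / (4 * \<epsilon> / A)
      = A * (4 * \<epsilon> * u$i * u$j) / (D\<^sup>2 * D\<^sup>2)" using assms(2) by simp
    have k: "(sqrt A * (x - y) / D\<^sup>2) * (sqrt A * (x' - y') / D\<^sup>2) = A * ((x - y) * (x' - y')) / (D\<^sup>2 * D\<^sup>2)" for x y x' y'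
      using A by (simp add: mult_ac)
    have "form (4 * \<epsilon> / A) (partial i (stereo_inv A \<epsilon> \<sigma>) u) (partial j (stereo_inv A \<epsilon> \<sigma>) u)
      = A * ((\<delta> i 1 - 2 * \<epsilon> * u$1 * u$i) * (\<delta> j 1 - 2 * \<epsilon> * u$1 * u$j)
        + (\<delta> i 2 - 2 * \<epsilon> * u$2 * u$i) * (\<delta> j 2 - 2 * \<epsilon> * u$2 * u$j) + 4 * \<epsilon> * u$i * u$j) / (D\<^sup>2 * D\<^sup>2)"
      unfolding form_def 3 P(1,2) k \<delta>_def[symmetric] by (simp add: add_divide_distrib distrib_left)
    \<comment> \<open>Apart from the diagonal contribution, the terms add up to a multiple of
      \<open>1 + \<epsilon> * sqn u - D\<close>, which is 0.\<close>
    also have "(\<delta> i 1 - 2 * \<epsilon> * u$1 * u$i) * (\<delta> j 1 - 2 * \<epsilon> * u$1 * u$j)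
        + (\<delta> i 2 - 2 * \<epsilon> * u$2 * u$i) * (\<delta> j 2 - 2 * \<epsilon> * u$2 * u$j) + 4 * \<epsilon> * u$i * u$j
      = (if i = j then D\<^sup>2 else 0)"
      using exhaust_2[of i] exhaust_2[of j]
      by (auto simp: \<delta>_def D_def sqn_def power2_eq_square algebra_simps)
    finally have "form (4 * \<epsilon> / A) (partial i (stereo_inv A \<epsilon> \<sigma>) u) (partial j (stereo_inv A \<epsilon> \<sigma>) u)
      = A * (if i = j then D\<^sup>2 else 0) / (D\<^sup>2 * D\<^sup>2)" .
    moreover have "A * D\<^sup>2 / (D\<^sup>2 * D\<^sup>2) = A / D\<^sup>2"
      using D by (intro nonzero_mult_divide_mult_cancel_right) simp
    ultimately show ?thesis by (cases "i = j") simp_all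
  qed
  then show ?thesis
    by (simp add: vec_eq_iff pullback_def conf_metric_def mat_def D_def)
qed

text \<open>With \<open>D = 1 + \<epsilon> * sqn u\<close> the third component is
  \<open>\<sigma> * (2 - D) / D\<close>, and the equation of the quadric reduces to
  \<open>4 * (D - 1) + (2 - D)\<^sup>2 = D\<^sup>2\<close>.\<close>

lemma stereo_inv_in_quadric:
  assumes "A > 0" "\<sigma> * \<sigma> = 1" "\<epsilon> \<le> 0 \<Longrightarrow> \<sigma> = 1" and u: "u \<in> conf_dom \<epsilon>"
  shows "stereo_inv A \<epsilon> \<sigma> u \<in> quadric (4 * \<epsilon> / A)"
    and "1 + \<sigma> * stereo_inv A \<epsilon> \<sigma> u $ 3 = 2 / (1 + \<epsilon> * sqn u)"
    and "stereo_proj A \<sigma> (stereo_inv A \<epsilon> \<sigma> u) = u"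
proof -
  define D where "D = 1 + \<epsilon> * sqn u"
  have D: "D > 0" using u by (simp add: conf_dom_def D_def)
  have A: "sqrt A * sqrt A = A" "sqrt A > 0" using assms(1) by simp_all
  have comp: "stereo_inv A \<epsilon> \<sigma> u $ 1 = sqrt A * u$1 / D" "stereo_inv A \<epsilon> \<sigma> u $ 2 = sqrt A * u$2 / D"
    "stereo_inv A \<epsilon> \<sigma> u $ 3 = \<sigma> * (2 - D) / D"
    by (simp_all add: stereo_inv_def D_def)
  have s: "\<sigma> * (\<sigma> * (2 - D) / D) = (2 - D) / D" 
    using assms(2) by (metis mult.assoc mult_1 times_divide_eq_right)
  show two: "1 + \<sigma> * stereo_inv A \<epsilon> \<sigma> u $ 3 = 2 / (1 + \<epsilon> * sqn u)"
    unfolding comp s D_def[symmetric] using D by (simp add: field_simps)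
  show "stereo_proj A \<sigma> (stereo_inv A \<epsilon> \<sigma> u) = u"
  proof -
    have "stereo_proj A \<sigma> (stereo_inv A \<epsilon> \<sigma> u)
      = vector [2 * (sqrt A * u$1 / D) / (sqrt A * (2 / D)), 2 * (sqrt A * u$2 / D) / (sqrt A * (2 / D))]"
      unfolding stereo_proj_def two D_def[symmetric] comp(1,2) ..
    then show ?thesis using A D by (simp add: vec_eq_iff forall_2)
  qed
  have "dual_form (4 * \<epsilon> / A) (stereo_inv A \<epsilon> \<sigma> u) (stereo_inv A \<epsilon> \<sigma> u)
    = 4 * \<epsilon> / A * ((sqrt A * sqrt A) * sqn u / (D * D)) + (\<sigma> * \<sigma>) * ((2 - D) * (2 - D)) / (D * D)"
  proof -
    define s where "s = sqrt A"
    show ?thesis unfolding dual_form_def comp sqn_def power2_eq_square s_def[symmetric]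
      by (simp add: add_divide_distrib algebra_simps)
  qed
  also have "\<dots> = (4 * (\<epsilon> * sqn u) + (2 - D) * (2 - D)) / (D * D)"
    unfolding A assms(2) using assms(1) by (simp add: add_divide_distrib)
  also have "4 * (\<epsilon> * sqn u) + (2 - D) * (2 - D) = D * D" by (simp add: D_def algebra_simps)
  finally have "dual_form (4 * \<epsilon> / A) (stereo_inv A \<epsilon> \<sigma> u) (stereo_inv A \<epsilon> \<sigma> u) = 1" using D by simp
  moreover have "stereo_inv A \<epsilon> \<sigma> u $ 3 > 0" if "4 * \<epsilon> / A \<le> 0"
  proof -
    have \<epsilon>: "\<epsilon> \<le> 0" using that assms(1) by (simp add: divide_le_0_iff)
    moreover have "sqn u \<ge> 0" by (simp add: sqn_def)
    ultimately have "D \<le> 1" by (simp add: D_def mult_nonpos_nonneg)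
    then show ?thesis unfolding comp(3) using D assms(3)[OF \<epsilon>] by simp
  qed
  ultimately show "stereo_inv A \<epsilon> \<sigma> u \<in> quadric (4 * \<epsilon> / A)" by (simp add: quadric_def)
qed

lemma stereo_proj_right_inverse:
  assumes "A > 0" "\<sigma> * \<sigma> = 1" "\<epsilon> \<le> 0 \<Longrightarrow> \<sigma> = 1"
    and x: "x \<in> quadric (4 * \<epsilon> / A)" "1 + \<sigma> * x$3 \<noteq> 0"
  shows "stereo_proj A \<sigma> x \<in> conf_dom \<epsilon>" "stereo_inv A \<epsilon> \<sigma> (stereo_proj A \<sigma> x) = x"
proof -
  define t where "t = 1 + \<sigma> * x$3"
  have A: "sqrt A * sqrt A = A" "sqrt A > 0" using assms(1) by simp_all
  have q: "4 * \<epsilon> / A * (x$1 * x$1 + x$2 * x$2) = 1 - x$3 * x$3"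
    using x(1) by (simp add: quadric_def dual_form_def)
  \<comment> \<open>For \<open>\<epsilon> \<le> 0\<close> the point is on the upper sheet; otherwise
    its third component is at most 1 in absolute value, and only the height of the projection centre
    is excluded.\<close>
  have t: "t > 0"
  proof (cases "\<epsilon> \<le> 0")
    case True
    then have "x$3 > 0" using x(1) assms(1) by (simp add: quadric_def divide_le_0_iff)
    then show ?thesis using assms(3)[OF True] by (simp add: t_def)
  next
    case False
    then have "0 \<le> 4 * \<epsilon> / A * (x$1 * x$1 + x$2 * x$2)" using assms(1) by simp
    then have "(\<sigma> * x$3) * (\<sigma> * x$3) \<le> 1" using q assms(2)
      by (metis diff_ge_0_iff_ge mult.left_commute mult.right_neutral mult.assoc)
    then have "\<bar>\<sigma> * x$3\<bar> \<le> 1" by (metis abs_square_le_1 power2_eq_square)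
    then have "-1 \<le> \<sigma> * x$3" by linarith
    then show ?thesis using x(2) unfolding t_def by linarith
  qed
  have "\<epsilon> * sqn (stereo_proj A \<sigma> x) = (4 * \<epsilon> / (sqrt A * sqrt A) * (x$1 * x$1 + x$2 * x$2)) / (t * t)"
    unfolding sqn_def stereo_proj_def t_def[symmetric] power2_eq_square
    by (simp add: add_divide_distrib algebra_simps)
  also have "\<dots> = (1 - x$3 * x$3) / (t * t)" unfolding A q ..
  also have "1 - x$3 * x$3 = (2 - t) * t"
  proof -
    have "(2 - t) * t = 1 - (\<sigma> * \<sigma>) * (x$3 * x$3)" by (simp add: t_def algebra_simps)
    then show ?thesis using assms(2) by simp
  qed
  also have "(2 - t) * t / (t * t) = (2 - t) / t" using t by simp
  finally have "\<epsilon> * sqn (stereo_proj A \<sigma> x) = 2 / t - 1" using t by (simp add: field_simps)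
  then have D: "1 + \<epsilon> * sqn (stereo_proj A \<sigma> x) = 2 / t" "1 - \<epsilon> * sqn (stereo_proj A \<sigma> x) = 2 - 2 / t" by simp_all
  then show "stereo_proj A \<sigma> x \<in> conf_dom \<epsilon>" using t by (simp only: conf_dom_def mem_Collect_eq D) simp
  have 3: "\<sigma> * (2 - 2 / t) / (2 / t) = x$3"
  proof -
    have "\<sigma> * (2 - 2 / t) / (2 / t) = \<sigma> * (t - 1)" using t by (simp add: field_simps)
    also have "\<dots> = (\<sigma> * \<sigma>) * x$3" by (simp add: t_def)
    finally show ?thesis using assms(2) by simp
  qed
  have "stereo_proj A \<sigma> x $ 1 = 2 * x$1 / (sqrt A * t)" "stereo_proj A \<sigma> x $ 2 = 2 * x$2 / (sqrt A * t)"
    by (simp_all add: stereo_proj_def t_def)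
  then show "stereo_inv A \<epsilon> \<sigma> (stereo_proj A \<sigma> x) = x"
    unfolding stereo_inv_def D 3 using t A by (simp add: vec_eq_iff forall_3 field_simps)
qed

text \<open>The origin suffices because the curvature of the surface is constant. There the
  Christoffel symbols vanish, so only their first derivatives enter the curvature tensor.\<close>

lemma gauss_curvature_conf_metric:
  assumes "A > 0"
  shows "gauss_curvature (conf_metric A \<epsilon>) 0 = 4 * \<epsilon> / A"
proof -
  let ?D = "\<lambda>u. 1 + \<epsilon> * sqn u"
  have inv: "matrix_inv (conf_metric A \<epsilon> u) = ((?D u)\<^sup>2 / A) *\<^sub>R mat 1" if "u \<in> conf_dom \<epsilon>" for u
  proof -
    have D: "?D u \<noteq> 0" using that by (simp add: conf_dom_def)
    have p: "conf_metric A \<epsilon> u ** (((?D u)\<^sup>2 / A) *\<^sub>R mat 1) = mat 1"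
      using D assms by (simp add: conf_metric_def vec_eq_iff matrix_matrix_mult_def mat_def sum_2 forall_2)
    then have "invertible (conf_metric A \<epsilon> u)" by (auto simp: invertible_right_inverse)
    from matrix_inv_right[OF this] have "matrix_inv (conf_metric A \<epsilon> u) ** conf_metric A \<epsilon> u = mat 1"
      by (simp add: matrix_left_right_inverse)
    then have "matrix_inv (conf_metric A \<epsilon> u) ** conf_metric A \<epsilon> u ** (((?D u)\<^sup>2 / A) *\<^sub>R mat 1) = ((?D u)\<^sup>2 / A) *\<^sub>R mat 1"
      by simp
    then show ?thesis by (simp only: matrix_mul_assoc[symmetric] p matrix_mul_rid)
  qed
  have part: "partial i (\<lambda>v. conf_metric A \<epsilon> v $ j $ l) u = (if j = l then - 4 * A * \<epsilon> * u$i / (?D u)^3 else 0)"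
    if u: "u \<in> conf_dom \<epsilon>" for i j l u
  proof (cases "j = l")
    case True
    have D: "?D u \<noteq> 0" using u by (simp add: conf_dom_def)
    have i: "i = 1 \<or> i = 2" by (rule exhaust_2)
    define d where "d = ?D u"
    have "((\<lambda>v. A / (?D v)\<^sup>2) has_derivative
      (\<lambda>h. - (A * (2 * (\<epsilon> * (2 * (u$1 * h$1 + u$2 * h$2))) * d)) / (d\<^sup>2 * d\<^sup>2))) (at u)"
      using D unfolding d_def by (auto intro!: derivative_eq_intros has_derivative_sqn)
    note p = partial_eq[OF this, of i]
    have "u$1 * axis i 1$1 + u$2 * axis i 1$2 = u$i" using i by (auto simp: axis_def)
    then have "partial i (\<lambda>v. A / (?D v)\<^sup>2) u = - (A * (2 * (\<epsilon> * (2 * u$i)) * d)) / (d\<^sup>2 * d\<^sup>2)"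
      using p by (simp only:)
    also have "\<dots> = - 4 * A * \<epsilon> * u$i / d^3"
      using D by (simp add: d_def[symmetric] power2_eq_square power3_eq_cube field_simps)
    finally have "partial i (\<lambda>v. A / (?D v)\<^sup>2) u = - 4 * A * \<epsilon> * u$i / (?D u)^3" by (simp add: d_def)
    then show ?thesis using True by (simp add: conf_metric_def mat_def)
  next
    case False
    then show ?thesis by (simp add: conf_metric_def mat_def partial_eq[OF has_derivative_const])
  qed
  \<comment> \<open>The Christoffel symbols of a conformal metric are linear in the gradient of the
    conformal factor, which here is radial; up to a scalar factor they are these linear
    forms.\<close>
  define lin where "lin k i j u = (if j = k then u$i else 0) + (if i = k then u$j else 0) - (if i = j then u$k else 0)"
    for k i j :: 2 and u :: "real^2"
  have chr: "christoffel (conf_metric A \<epsilon>) k i j u = - 2 * \<epsilon> * lin k i j u / ?D u" if u: "u \<in> conf_dom \<epsilon>" for k i j u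
  proof -
    have D: "?D u \<noteq> 0" using u by (simp add: conf_dom_def)
    have "christoffel (conf_metric A \<epsilon>) k i j u = (\<Sum>l\<in>UNIV. if l = k then
       ((?D u)\<^sup>2 / A) * ((- 4 * A * \<epsilon> / (?D u)^3) * lin k i j u) else 0) / 2"
      unfolding christoffel_def inv[OF u] part[OF u]
      by (intro arg_cong[of _ _ "\<lambda>x. x / 2"] sum.cong) (auto simp: mat_def lin_def field_simps)
    also have "\<dots> = - 2 * \<epsilon> * lin k i j u / ?D u"
    proof -
      have "d\<^sup>2 / A * (- 4 * A * \<epsilon> / d^3 * x) / 2 = - 2 * \<epsilon> * x / d" if "d \<noteq> 0" for d x
        using that assms by (simp add: power2_eq_square power3_eq_cube field_simps)
      from this[OF D] show ?thesis by simp
    qed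
    finally show ?thesis .
  qed
  have 0: "0 \<in> conf_dom \<epsilon>" by (simp add: conf_dom_def sqn_def)
  have lind: "(lin k i j has_derivative lin k i j) (at 0)" for k i j
  proof -
    have "((\<lambda>x::real^2. if b then x$l else 0) has_derivative (\<lambda>h. if b then h$l else 0)) (at 0)" for b and l :: 2
      by (cases b) (auto intro: has_derivative_nth)
    then show ?thesis unfolding lin_def by (intro has_derivative_add has_derivative_diff)
  qed
  have zero: "lin k i j 0 = 0" "sqn 0 = 0" for k i j by (simp_all add: lin_def sqn_def)
  have chr0: "christoffel (conf_metric A \<epsilon>) k i j 0 = 0" for k i j
    using chr[OF 0] by (simp add: lin_def)
  have dchr: "partial m (christoffel (conf_metric A \<epsilon>) k i j) 0 = - 2 * \<epsilon> * lin k i j (axis m 1)" for k i j m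
  proof -
    have "partial m (christoffel (conf_metric A \<epsilon>) k i j) 0 = partial m (\<lambda>u. - 2 * \<epsilon> * lin k i j u / ?D u) 0"
      by (rule partial_cong[OF open_conf_dom 0 chr])
    also have "\<dots> = - 2 * \<epsilon> * lin k i j (axis m 1)"
    proof -
      have "((\<lambda>u. - 2 * \<epsilon> * lin k i j u / ?D u) has_derivative (\<lambda>h. - 2 * \<epsilon> * lin k i j h)) (at 0)"
        by (auto intro!: derivative_eq_intros lind has_derivative_sqn simp: zero)
      from partial_eq[OF this] show ?thesis .
    qed
    finally show ?thesis .
  qed
  have "riemann (conf_metric A \<epsilon>) 1 1 2 2 0 = 4 * \<epsilon>"
    unfolding riemann_def chr0 dchr by (simp add: lin_def axis_def)
  then show ?thesis
    using assms unfolding gauss_curvature_def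
    by (simp add: sum_2 conf_metric_def mat_def det_2 sqn_def)
qed

section \<open>Atlases of stereographic charts\<close>

lemma pullback_cong:
  assumes "open W" "u \<in> W" "\<And>v. v \<in> W \<Longrightarrow> x v = y v"
  shows "pullback K x u = pullback K y u"
  unfolding pullback_def by (simp add: partial_cong[OF assms])

lemma jacobian_cong:
  assumes "open W" "u \<in> W" "\<And>v. v \<in> W \<Longrightarrow> \<phi> v = \<psi> v"
  shows "jacobian \<phi> u = jacobian \<psi> u"
proof -
  have "jacobian \<phi> u $ j $ i = partial i \<phi> u $ j" "jacobian \<psi> u $ j $ i = partial i \<psi> u $ j" for i j
    by (simp_all add: jacobian_def matrix_def partial_def)
  then show ?thesis by (simp add: vec_eq_iff partial_cong[OF assms])
qed

lemma metric_transition_cong: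
  assumes "metric_transition c d" "overlap c' d' = overlap c d" "cmet c' = cmet c" "cmet d' = cmet d"
    and eq: "\<And>u. u \<in> overlap c d \<Longrightarrow> transition c' d' u = transition c d u"
  shows "metric_transition c' d'"
proof -
  have op: "open (overlap c d)" using assms(1) by (simp add: metric_transition_def)
  have "smooth_on (overlap c d) (transition c' d')"
    using assms(1) C_on_cong[OF op, of "transition c d" "transition c' d'"] eq
    by (auto simp: metric_transition_def smooth_on_def)
  moreover have "jacobian (transition c' d') u = jacobian (transition c d) u" if "u \<in> overlap c d" for u
    by (rule jacobian_cong[OF op that eq])
  ultimately show ?thesis
    using assms by (simp add: metric_transition_def)
qed

lemma overlap_coords:
  "u \<in> overlap c d \<Longrightarrow> transition c d u \<in> cdom d \<and> cmap d (transition c d u) = cmap c u"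
  using coords_inverse[of "cmap c u" d] by (auto simp: overlap_def transition_def)

text \<open>The common shape of the three models: all charts carry the same conformal metric and
  become stereographic after the embedding \<open>Z\<close>. The projection centre may depend on the
  chart, as the sphere uses both poles.\<close>

locale model_atlas =
  fixes P :: "'b set" and As :: "'b chart set" and Z :: "'b \<Rightarrow> real^3" and A \<epsilon> :: real
  assumes A: "A > 0"
    and Z_inj: "inj_on Z P" and Z_image: "Z ` P = quadric (4 * \<epsilon> / A)"
    and covers: "P = (\<Union>e\<in>As. cimage e)"
    and chart: "\<And>e. e \<in> As \<Longrightarrow> \<exists>\<sigma>. \<sigma> * \<sigma> = 1 \<and> (\<epsilon> \<le> 0 \<longrightarrow> \<sigma> = 1) \<and> cdom e = conf_dom \<epsilon> \<and>
      cmet e = conf_metric A \<epsilon> \<and> (\<forall>u\<in>conf_dom \<epsilon>. Z (cmap e u) = stereo_inv A \<epsilon> \<sigma> u)"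
begin

definition sg :: "'b chart \<Rightarrow> real" where
  "sg e = (SOME \<sigma>. \<sigma> * \<sigma> = 1 \<and> (\<epsilon> \<le> 0 \<longrightarrow> \<sigma> = 1) \<and> cdom e = conf_dom \<epsilon> \<and>
      cmet e = conf_metric A \<epsilon> \<and> (\<forall>u\<in>conf_dom \<epsilon>. Z (cmap e u) = stereo_inv A \<epsilon> \<sigma> u))"

lemma chartD:
  assumes "e \<in> As"
  shows "sg e * sg e = 1" "\<epsilon> \<le> 0 \<Longrightarrow> sg e = 1" "cdom e = conf_dom \<epsilon>" "cmet e = conf_metric A \<epsilon>"
    "u \<in> conf_dom \<epsilon> \<Longrightarrow> Z (cmap e u) = stereo_inv A \<epsilon> (sg e) u"
  using someI_ex[OF chart[OF assms], folded sg_def] by blast+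

lemma Z_eq_iff: "p \<in> P \<Longrightarrow> q \<in> P \<Longrightarrow> Z p = Z q \<longleftrightarrow> p = q"
  using Z_inj by (simp add: inj_on_eq_iff)

lemma cimage_sub: "e \<in> As \<Longrightarrow> cimage e \<subseteq> P"
  using covers by blast

lemma cimage_iff:
  assumes e: "e \<in> As" and p: "p \<in> P"
  shows "p \<in> cimage e \<longleftrightarrow> 1 + sg e * Z p $ 3 \<noteq> 0"
    and "p \<in> cimage e \<Longrightarrow> coords e p = stereo_proj A (sg e) (Z p)"
proof -
  note c = chartD[OF e]
  have Zp: "Z p \<in> quadric (4 * \<epsilon> / A)" using Z_image p by blast
  show 1: "p \<in> cimage e \<longleftrightarrow> 1 + sg e * Z p $ 3 \<noteq> 0"
  proof
    assume "p \<in> cimage e"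
    then obtain u where u: "u \<in> conf_dom \<epsilon>" "p = cmap e u" using c(3) by auto
    show "1 + sg e * Z p $ 3 \<noteq> 0"
      using stereo_inv_in_quadric(2)[OF A c(1,2) u(1)] u c(5) by (simp add: conf_dom_def)
  next
    assume n: "1 + sg e * Z p $ 3 \<noteq> 0"
    define u where "u = stereo_proj A (sg e) (Z p)"
    have u: "u \<in> conf_dom \<epsilon>" "stereo_inv A \<epsilon> (sg e) u = Z p"
      using stereo_proj_right_inverse[OF A c(1,2) Zp n] by (auto simp: u_def)
    then have "Z (cmap e u) = Z p" using c(5) by simp
    moreover have "cmap e u \<in> P" using cimage_sub[OF e] u(1) c(3) by auto
    ultimately have "cmap e u = p" using Z_eq_iff p by blast
    then show "p \<in> cimage e" using u(1) c(3) by auto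
  qed
  show "coords e p = stereo_proj A (sg e) (Z p)" if "p \<in> cimage e"
    using coords_inverse[OF that] c(3,5) stereo_inv_in_quadric(3)[OF A c(1,2)] by metis
qed

lemma open_proj_dom: "open {x::real^3. 1 + \<sigma> * x$3 \<noteq> 0}"
  by (intro open_Collect_neq continuous_intros)

text \<open>Seen through \<open>Z\<close> the transition is a projection after an inverse
  projection, a rational map without poles on the overlap. Both metrics are pullbacks of one form,
  so they match by the chain rule.\<close>

lemma chart_transition:
  assumes e: "e \<in> As" "d \<in> As"
  shows "metric_transition e d"
proof -
  note c = chartD[OF e(1)] and c' = chartD[OF e(2)]
  define x where "x = stereo_inv A \<epsilon> (sg e)"
  define W where "W = {u \<in> conf_dom \<epsilon>. 1 + sg d * x u $ 3 \<noteq> 0}"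
  have ov: "overlap e d = W"
  proof -
    have "cmap e u \<in> cimage d \<longleftrightarrow> 1 + sg d * x u $ 3 \<noteq> 0" if "u \<in> conf_dom \<epsilon>" for u
    proof -
      have "cmap e u \<in> P" using cimage_sub[OF e(1)] c(3) that by auto
      then show ?thesis using cimage_iff(1)[OF e(2)] c(5)[OF that] by (simp add: x_def)
    qed
    then show ?thesis unfolding overlap_def W_def c(3) by (intro Collect_cong conj_cong refl)
  qed
  have Csub: "C_on n (conf_dom \<epsilon>) (\<lambda>u. x u $ i)" for n i
    unfolding x_def by (rule C_on_bounded_linear[OF open_conf_dom bounded_linear_vec_nth C_on_stereo_inv])
  have "W = (\<lambda>u. 1 + sg d * x u $ 3) -` (- {0}) \<inter> conf_dom \<epsilon>" by (auto simp: W_def)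
  moreover have "continuous_on (conf_dom \<epsilon>) (\<lambda>u. 1 + sg d * x u $ 3)"
    using Csub[of 0 3] by (auto intro!: continuous_intros)
  ultimately have W: "open W"
    using continuous_on_open_vimage[OF open_conf_dom, where f = "\<lambda>u. 1 + sg d * x u $ 3"] by auto
  have tr: "transition e d u = stereo_proj A (sg d) (x u)" if "u \<in> W" for u
  proof -
    have "u \<in> overlap e d" using that ov by simp
    then have u: "u \<in> conf_dom \<epsilon>" "cmap e u \<in> cimage d" using c(3) by (auto simp: overlap_def)
    have "cmap e u \<in> P" using cimage_sub[OF e(2)] u(2) by blast
    then show ?thesis
      unfolding transition_def using cimage_iff(2)[OF e(2) _ u(2)] c(5)[OF u(1)] by (simp add: x_def)
  qed
  have "C_on n W (\<lambda>u. stereo_proj A (sg d) (x u))" for n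
  proof (rule C_on_vec[OF W])
    fix i :: 2
    have sub: "C_on n W (\<lambda>u. x u $ i)" for i
      using C_on_subset[OF Csub] by (auto simp: W_def)
    have "C_on n W (\<lambda>u. 2 * x u $ k / (sqrt A * (1 + sg d * x u $ 3)))" for k
      by (intro C_on_divide C_on_mult C_on_add C_on_const sub W) (use A in \<open>auto simp: W_def\<close>)
    then show "C_on n W (\<lambda>u. stereo_proj A (sg d) (x u) $ i)"
      using exhaust_2[of i] by (auto simp: stereo_proj_def)
  qed
  then have "C_on n W (transition e d)" for n
    using C_on_cong[OF W, of "\<lambda>u. stereo_proj A (sg d) (x u)" "transition e d" n] tr by simp
  then have sm: "smooth_on W (transition e d)" by (simp add: smooth_on_def)
  have "cmet e u = transpose (jacobian (transition e d) u) ** cmet d (transition e d u) ** jacobian (transition e d) u"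
    if u: "u \<in> W" for u
  proof -
    have dom: "transition e d v \<in> conf_dom \<epsilon>" "stereo_inv A \<epsilon> (sg d) (transition e d v) = x v" if "v \<in> W" for v
    proof -
      have v: "v \<in> overlap e d" "v \<in> conf_dom \<epsilon>" using that ov by (auto simp: W_def)
      have o: "transition e d v \<in> conf_dom \<epsilon>" "cmap d (transition e d v) = cmap e v"
        using overlap_coords[OF v(1)] c'(3) by auto
      then show "transition e d v \<in> conf_dom \<epsilon>" by simp
      show "stereo_inv A \<epsilon> (sg d) (transition e d v) = x v"
        using c'(5)[OF o(1)] c(5)[OF v(2)] o(2) by (simp add: x_def)
    qed
    have "u \<in> conf_dom \<epsilon>" using u by (simp add: W_def)
    then have "cmet e u = pullback (4 * \<epsilon> / A) x u"
      using pullback_stereo_inv[OF A c(1)] c(4) by (simp add: x_def)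
    also have "\<dots> = pullback (4 * \<epsilon> / A) (\<lambda>v. stereo_inv A \<epsilon> (sg d) (transition e d v)) u"
      by (rule pullback_cong[OF W u]) (simp add: dom)
    also have "\<dots> = transpose (jacobian (transition e d) u) **
        pullback (4 * \<epsilon> / A) (stereo_inv A \<epsilon> (sg d)) (transition e d u) ** jacobian (transition e d) u"
    proof (rule pullback_compose)
      show "transition e d differentiable (at u)"
        using sm u by (metis C_on.simps(2) smooth_on_def)
      show "stereo_inv A \<epsilon> (sg d) differentiable (at (transition e d u))"
        using C_on_stereo_inv[of 1 \<epsilon> A "sg d"] dom(1)[OF u] by simp
    qed
    also have "pullback (4 * \<epsilon> / A) (stereo_inv A \<epsilon> (sg d)) (transition e d u) = cmet d (transition e d u)"
      using pullback_stereo_inv[OF A c'(1) dom(1)[OF u]] c'(4) by simp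
    finally show ?thesis .
  qed
  then show ?thesis using W sm by (simp add: metric_transition_def ov)
qed

lemma conf_metric_form: "v \<bullet> (conf_metric A \<epsilon> u *v v) = A / (1 + \<epsilon> * sqn u)\<^sup>2 * (v \<bullet> v)"
  by (simp add: conf_metric_def inner_vec_def matrix_vector_mult_def mat_def sum_2 distrib_left mult_ac)

text \<open>The map \<open>g\<close> is the identity for charts of the model and the inverse
  isometry for charts of \<open>M\<close>.\<close>

lemma chart_riemannian:
  assumes e: "e \<in> As" and inj: "inj_on g P"
  shows "riemannian_chart (Chart (cdom e) (g \<circ> cmap e) (cmet e))"
proof -
  note c = chartD[OF e]
  have "inj_on (g \<circ> cmap e) (cdom e)"
  proof (rule comp_inj_on)
    show "inj_on (cmap e) (cdom e)"
      using c(3,5) stereo_inv_in_quadric(3)[OF A c(1,2)] by (intro inj_onI) metis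
    show "inj_on g (cimage e)" using inj cimage_sub[OF e] by (rule inj_on_subset)
  qed
  moreover have "transpose (conf_metric A \<epsilon> u) = conf_metric A \<epsilon> u" for u
    by (simp add: conf_metric_def vec_eq_iff transpose_def mat_def)
  moreover have "v \<bullet> (conf_metric A \<epsilon> u *v v) > 0" if "u \<in> conf_dom \<epsilon>" "v \<noteq> 0" for u v
    unfolding conf_metric_form using that A by (intro mult_pos_pos) (auto simp: conf_dom_def)
  ultimately show ?thesis
    using c(3,4) open_conf_dom smooth_conf_metric by (simp add: riemannian_chart_def)
qed

lemma atlas_charts: "As \<subseteq> charts (surface_of_atlas P As)"
proof
  fix e assume e: "e \<in> As"
  have "Chart (cdom e) (id \<circ> cmap e) (cmet e) = e" by (cases e) simp
  then have "riemannian_chart e" using chart_riemannian[OF e, of id] by simp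
  then show "e \<in> charts (surface_of_atlas P As)"
    using e cimage_sub chart_transition by (auto simp: surface_of_atlas_def compatible_def)
qed

end

section \<open>Transfer along an isometry to a model\<close>

locale isometric_to_model_atlas = model_atlas P As Z A \<epsilon>
  for P :: "'b set" and As Z A \<epsilon> +
  fixes M :: "'a surface" and f :: "'a \<Rightarrow> 'b"
  assumes M: "riemannian_surface M" and f: "isometry f M (surface_of_atlas P As)"
begin

abbreviation push :: "'a chart \<Rightarrow> 'b chart" where
  "push c \<equiv> Chart (cdom c) (f \<circ> cmap c) (cmet c)"

lemma M_points: "points M = (\<Union>c\<in>charts M. cimage c)"
  and M_chart: "\<forall>c\<in>charts M. riemannian_chart c"
  and M_maximal: "\<forall>c. riemannian_chart c \<and> cimage c \<subseteq> points M \<and> (\<forall>d\<in>charts M. compatible c d) \<longrightarrow> c \<in> charts M"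
  using M unfolding riemannian_surface_def by - (elim conjE, assumption)+

lemma f_bij: "bij_betw f (points M) P"
  using f by (simp add: isometry_def surface_of_atlas_def)

lemma f_in: "p \<in> points M \<Longrightarrow> f p \<in> P"
  using f_bij bij_betwE by blast

lemma f_eq_iff: "p \<in> points M \<Longrightarrow> q \<in> points M \<Longrightarrow> f p = f q \<longleftrightarrow> p = q"
  using inj_on_eq_iff[OF bij_betw_imp_inj_on[OF f_bij]] .

lemma push_compatible:
  "c \<in> charts M \<Longrightarrow> e \<in> As \<Longrightarrow> metric_transition (push c) e \<and> metric_transition e (push c)"
  using f atlas_charts by (auto simp: isometry_def compatible_def)

lemma M_cimage: "c \<in> charts M \<Longrightarrow> u \<in> cdom c \<Longrightarrow> cmap c u \<in> points M"
  using M_points by auto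

lemma coords_push:
  assumes c: "c \<in> charts M" "p \<in> cimage c"
  shows "coords (push c) (f p) = coords c p"
proof -
  have "inj_on (f \<circ> cmap c) (cdom c)"
  proof (rule comp_inj_on)
    show "inj_on (cmap c) (cdom c)" using M_chart c(1) by (simp add: riemannian_chart_def)
    have "cimage c \<subseteq> points M" using M_cimage[OF c(1)] by auto
    then show "inj_on f (cimage c)" using f_bij by (auto simp: bij_betw_def intro: inj_on_subset)
  qed
  then show ?thesis
    using inv_into_f_eq[of "f \<circ> cmap c" "cdom c" "coords c p" "f p"] coords_inverse[OF c(2)]
    by (simp add: coords_def)
qed

lemma cimage_push: "c \<in> charts M \<Longrightarrow> p \<in> points M \<Longrightarrow> f p \<in> cimage (push c) \<longleftrightarrow> p \<in> cimage c"
  using M_cimage f_eq_iff by (auto simp: image_iff)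

lemma through_atlas:
  assumes c: "c \<in> charts M" and e: "e \<in> As" and u: "u \<in> overlap (push c) e"
  shows "transition (push c) e u \<in> conf_dom \<epsilon>"
    "Z (f (cmap c u)) = stereo_inv A \<epsilon> (sg e) (transition (push c) e u)"
proof -
  have t: "transition (push c) e u \<in> conf_dom \<epsilon>" "cmap e (transition (push c) e u) = f (cmap c u)"
    using overlap_coords[OF u] chartD(3)[OF e] by auto
  show "transition (push c) e u \<in> conf_dom \<epsilon>" by (rule t(1))
  show "Z (f (cmap c u)) = stereo_inv A \<epsilon> (sg e) (transition (push c) e u)"
    using chartD(5)[OF e t(1)] unfolding t(2) .
qed

text \<open>A chart of \<open>M\<close> is arbitrary, but the isometry makes its transitions to the
  model charts smooth and metric preserving. Locally the embedding is such a transition followed by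
  \<open>stereo_inv\<close>, and the map \<open>\<Phi>\<close> is \<open>stereo_proj\<close>
  followed by a transition back.\<close>

lemma space_form: "space_form M (4 * \<epsilon> / A) (\<lambda>p. Z (f p))"
proof
  show "riemannian_surface M" by (rule M)
  show "inj_on (\<lambda>p. Z (f p)) (points M)"
    using Z_eq_iff f_in f_eq_iff by (intro inj_onI) metis
  have "(\<lambda>p. Z (f p)) ` points M = Z ` (f ` points M)" by (simp add: image_image)
  then show "(\<lambda>p. Z (f p)) ` points M = quadric (4 * \<epsilon> / A)"
    using f_bij Z_image by (simp add: bij_betw_def)
next
  fix c assume c: "c \<in> charts M"
  have loc: "\<exists>e\<in>As. u \<in> overlap (push c) e" if "u \<in> cdom c" for u
  proof -
    have "f (cmap c u) \<in> P" using f_in M_cimage[OF c that] by blast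
    then show ?thesis using covers that by (auto simp: overlap_def)
  qed
  have trans: "open (overlap (push c) e)" "smooth_on (overlap (push c) e) (transition (push c) e)" if "e \<in> As" for e
    using push_compatible[OF c that] by (auto simp: metric_transition_def)
  show "C_on 2 (cdom c) (\<lambda>u. Z (f (cmap c u)))"
  proof (rule C_on_local)
    fix u assume "u \<in> cdom c"
    then obtain e where e: "e \<in> As" "u \<in> overlap (push c) e" using loc by blast
    have "C_on 2 (overlap (push c) e) (\<lambda>u. stereo_inv A \<epsilon> (sg e) (transition (push c) e u))"
      using trans[OF e(1)] through_atlas(1)[OF c e(1)]
      by (intro C_on_compose[OF _ _ _ C_on_stereo_inv]) (auto simp: smooth_on_def)
    then have "C_on 2 (overlap (push c) e) (\<lambda>u. Z (f (cmap c u)))"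
      by (rule C_on_cong[OF trans(1)[OF e(1)], rotated]) (simp add: through_atlas(2)[OF c e(1)])
    then show "\<exists>V. open V \<and> u \<in> V \<and> C_on 2 V (\<lambda>u. Z (f (cmap c u)))"
      using trans(1)[OF e(1)] e(2) by blast
  qed
  fix u assume "u \<in> cdom c"
  then obtain e where e: "e \<in> As" "u \<in> overlap (push c) e" using loc by blast
  let ?t = "transition (push c) e"
  note dom = through_atlas(1)[OF c e]
  have "cmet (push c) u = transpose (jacobian ?t u) ** cmet e (?t u) ** jacobian ?t u"
    using push_compatible[OF c e(1)] e(2) unfolding metric_transition_def by blast
  also have "cmet e (?t u) = pullback (4 * \<epsilon> / A) (stereo_inv A \<epsilon> (sg e)) (?t u)"
    using pullback_stereo_inv[OF A chartD(1)[OF e(1)] dom] chartD(4)[OF e(1)] by simp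
  also have "transpose (jacobian ?t u) ** \<dots> ** jacobian ?t u
      = pullback (4 * \<epsilon> / A) (\<lambda>v. stereo_inv A \<epsilon> (sg e) (?t v)) u"
  proof (rule pullback_compose[symmetric])
    show "?t differentiable (at u)"
      using trans(2)[OF e(1)] e(2) by (metis C_on.simps(2) smooth_on_def)
    show "stereo_inv A \<epsilon> (sg e) differentiable (at (?t u))"
      using C_on_stereo_inv[of 1 \<epsilon> A "sg e"] dom by simp
  qed
  also have "\<dots> = pullback (4 * \<epsilon> / A) (\<lambda>u. Z (f (cmap c u))) u"
    by (rule pullback_cong[OF trans(1)[OF e(1)] e(2)]) (simp add: through_atlas(2)[OF c e(1)])
  finally show "cmet c u = pullback (4 * \<epsilon> / A) (\<lambda>u. Z (f (cmap c u))) u" by simp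
next
  fix c p assume c: "c \<in> charts M" "p \<in> cimage c"
  then have p: "p \<in> points M" using M_points by blast
  then obtain e where e: "e \<in> As" "f p \<in> cimage e" using f_in covers by blast
  let ?O = "overlap e (push c)" and ?t = "transition e (push c)"
  have trans: "open ?O" "smooth_on ?O ?t"
    using push_compatible[OF c(1) e(1)] by (auto simp: metric_transition_def)
  define U where "U = {x::real^3. 1 + sg e * x$3 \<noteq> 0}"
  have U: "open U" unfolding U_def by (rule open_proj_dom)
  have proj: "stereo_proj A (sg e) differentiable (at x)" if "x \<in> U" for x
  proof -
    have k: "(\<lambda>x::real^3. 2 * x$k / (sqrt A * (1 + sg e * x$3))) differentiable (at x)" for k
      using that A unfolding U_def
      by (intro differentiable_divide differentiable_mult differentiable_add differentiable_const
            bounded_linear_imp_differentiable bounded_linear_vec_nth) auto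
    have "stereo_proj A (sg e) = (\<lambda>x. (2 * x$1 / (sqrt A * (1 + sg e * x$3))) *\<^sub>R axis 1 1
       + (2 * x$2 / (sqrt A * (1 + sg e * x$3))) *\<^sub>R axis 2 1)"
      by (auto simp: stereo_proj_def vec_eq_iff forall_2 axis_def)
    then show ?thesis
      by (simp only:) (intro differentiable_add differentiable_scaleR k differentiable_const)
  qed
  define V where "V = U \<inter> stereo_proj A (sg e) -` ?O"
  have "open V"
  proof -
    have "continuous_on U (stereo_proj A (sg e))"
      using proj by (auto intro!: continuous_at_imp_continuous_on differentiable_imp_continuous_within)
    then show ?thesis
      using continuous_on_open_vimage[OF U] trans(1) by (auto simp: V_def Int_commute)
  qed
  moreover have inV: "Z (f q) \<in> V \<longleftrightarrow> q \<in> cimage c \<and> f q \<in> cimage e" if q: "q \<in> points M" for q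
  proof (cases "f q \<in> cimage e")
    case True
    have "stereo_proj A (sg e) (Z (f q)) = coords e (f q)"
      using cimage_iff(2)[OF e(1) f_in[OF q] True] by simp
    then show ?thesis
      using True coords_inverse[OF True] cimage_push[OF c(1) q] cimage_iff(1)[OF e(1) f_in[OF q]]
      by (auto simp: V_def U_def overlap_def)
  next
    case False
    then show ?thesis using cimage_iff(1)[OF e(1) f_in[OF q]] by (auto simp: V_def U_def)
  qed
  moreover have "(\<lambda>x. ?t (stereo_proj A (sg e) x)) differentiable (at x)" if "x \<in> V" for x
  proof -
    have "?t differentiable (at (stereo_proj A (sg e) x))"
      using trans(2) that unfolding V_def by (metis C_on.simps(2) IntD2 smooth_on_def vimageD)
    then show ?thesis
      using differentiable_chain_at[of "stereo_proj A (sg e)" x ?t] proj that by (auto simp: V_def o_def)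
  qed
  moreover have "coords c q = ?t (stereo_proj A (sg e) (Z (f q)))" if q: "q \<in> points M" "Z (f q) \<in> V" for q
  proof -
    have q': "q \<in> cimage c" "f q \<in> cimage e" using inV[OF q(1)] q(2) by auto
    have "stereo_proj A (sg e) (Z (f q)) = coords e (f q)"
      using cimage_iff(2)[OF e(1) f_in[OF q(1)] q'(2)] by simp
    then show ?thesis
      using coords_inverse(2)[OF q'(2)] coords_push[OF c(1) q'(1)] by (simp add: transition_def)
  qed
  ultimately show "\<exists>V (\<Phi> :: real^3 \<Rightarrow> real^2). open V \<and> Z (f p) \<in> V \<and> (\<forall>y\<in>V. \<Phi> differentiable (at y)) \<and>
        (\<forall>q\<in>points M. Z (f q) \<in> V \<longrightarrow> q \<in> cimage c \<and> coords c q = \<Phi> (Z (f q)))"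
    using c(2) e(2) p by (intro exI[of _ V] exI[of _ "\<lambda>x. ?t (stereo_proj A (sg e) x)"]) blast
qed

text \<open>Maximality of the atlas admits the model chart on \<open>M\<close>. It serves to compute
  the curvature of \<open>M\<close>.\<close>

lemma pulled_back_chart:
  assumes e: "e \<in> As"
  shows "Chart (cdom e) (inv_into (points M) f \<circ> cmap e) (cmet e) \<in> charts M" (is "?e \<in> _")
proof -
  let ?g = "inv_into (points M) f"
  have gf: "?g (f p) = p" if "p \<in> points M" for p
    using f_bij that by (simp add: bij_betw_def)
  have g: "?g y \<in> points M" "f (?g y) = y" if "y \<in> P" for y
    using f_bij that by (auto simp: bij_betw_def inv_into_into f_inv_into_f)
  have inj: "inj_on ?g P" by (metis g(2) inj_onI)
  have eP: "cmap e u \<in> P" if "u \<in> cdom e" for u using cimage_sub[OF e] that by auto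
  have sub: "cimage ?e \<subseteq> points M" using g eP by auto
  have im: "?g y \<in> cimage c \<longleftrightarrow> y \<in> cimage (push c)" if "y \<in> P" "c \<in> charts M" for y c
    using cimage_push[OF that(2) g(1)[OF that(1)]] g(2)[OF that(1)] by simp
  have im': "p \<in> cimage ?e \<longleftrightarrow> f p \<in> cimage e" if "p \<in> points M" for p
  proof
    assume "p \<in> cimage ?e"
    then obtain u where "u \<in> cdom e" "p = ?g (cmap e u)" by auto
    then show "f p \<in> cimage e" using g(2) eP by auto
  next
    assume "f p \<in> cimage e"
    then obtain u where "u \<in> cdom e" "f p = cmap e u" by auto
    then show "p \<in> cimage ?e" using gf[OF that] by (auto simp: image_iff intro!: bexI[of _ u])
  qed
  have "compatible ?e c" if c: "c \<in> charts M" for c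
    unfolding compatible_def
  proof
    show "metric_transition ?e c"
    proof (rule metric_transition_cong)
      show "metric_transition e (push c)" using push_compatible[OF c e] by blast
      show "overlap ?e c = overlap e (push c)"
        using im[OF eP c] by (auto simp: overlap_def)
      fix u assume u: "u \<in> overlap e (push c)"
      then have y: "cmap e u \<in> P" "?g (cmap e u) \<in> cimage c" using im[OF eP c] eP by (auto simp: overlap_def)
      show "transition ?e c u = transition e (push c) u"
        using coords_push[OF c y(2)] g(2)[OF y(1)] by (simp add: transition_def)
    qed simp_all
    show "metric_transition c ?e"
    proof (rule metric_transition_cong)
      show "metric_transition (push c) e" using push_compatible[OF c e] by blast
      show "overlap c ?e = overlap (push c) e"
        using im'[OF M_cimage[OF c]] by (auto simp: overlap_def)
      fix u assume u: "u \<in> overlap (push c) e"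
      then have u': "u \<in> cdom c" "f (cmap c u) \<in> cimage e" by (auto simp: overlap_def)
      have p: "cmap c u \<in> points M" using M_cimage[OF c u'(1)] .
      have "inj_on (cmap ?e) (cdom ?e)"
        using chart_riemannian[OF e inj] by (simp add: riemannian_chart_def)
      moreover have "coords e (f (cmap c u)) \<in> cdom ?e" "cmap ?e (coords e (f (cmap c u))) = cmap c u"
        using coords_inverse[OF u'(2)] gf[OF p] by auto
      ultimately have "coords ?e (cmap c u) = coords e (f (cmap c u))"
        unfolding coords_def[of ?e] by (intro inv_into_f_eq)
      then show "transition c ?e u = transition (push c) e u" by (simp add: transition_def)
    qed simp_all
  qed
  then show ?thesis using M_maximal chart_riemannian[OF e inj] sub by blast
qed

lemma curvature:
  assumes "constant_curvature M \<kappa>"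
  shows "\<kappa> = 4 * \<epsilon> / A"
proof -
  have "(stereo_inv A \<epsilon> 1 0) \<in> quadric (4 * \<epsilon> / A)"
    by (rule stereo_inv_in_quadric(1)[OF A]) (auto simp: conf_dom_def sqn_def)
  then have "P \<noteq> {}" using Z_image by blast
  then obtain e where e: "e \<in> As" using covers by blast
  have "0 \<in> cdom e" using chartD(3)[OF e] by (simp add: conf_dom_def sqn_def)
  then have "gauss_curvature (cmet e) 0 = \<kappa>"
    using assms pulled_back_chart[OF e] unfolding constant_curvature_def by force
  then show ?thesis using gauss_curvature_conf_metric[OF A] chartD(4)[OF e] by simp
qed

end

text \<open>\<open>S\<close> stands for the set of admissible values. For positive curvature the
  second condition says that half a great circle has length \<open>2 * n * L\<close>.\<close>

lemma (in isometric_to_model_atlas) buffon_limit: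
  fixes \<gamma> :: "real \<Rightarrow> real \<Rightarrow> 'a" and G :: "real \<Rightarrow> 'a set set" and a :: "real \<Rightarrow> real"
  assumes \<kappa>: "constant_curvature M \<kappa>"
    and S: "\<And>L. L \<in> S \<Longrightarrow> L > 0"
      "\<And>L. L \<in> S \<Longrightarrow> \<epsilon> > 0 \<Longrightarrow> \<exists>n::nat. n > 1 \<and> 2 * real n * sqrt (4 * \<epsilon> / A) * L = pi"
    and eq: "\<And>L. L \<in> S \<Longrightarrow> equator M (\<gamma> L)" and gr: "\<And>L. L \<in> S \<Longrightarrow> grating M (\<gamma> L) L (G L)"
    and pt: "\<And>L. L \<in> S \<Longrightarrow> \<gamma> L (a L) \<in> \<Union>(G L)"
  shows "((\<lambda>L. 9 * pi / 2 * ((buffon_probability M (\<gamma> L) (G L) (a L) L - 2 / pi) / L\<^sup>2)) \<longlongrightarrow> \<kappa>) (at 0 within S)"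
proof -
  interpret space_form M "4 * \<epsilon> / A" "\<lambda>p. Z (f p)" by (rule space_form)
  have k: "\<kappa> = 4 * \<epsilon> / A" by (rule curvature[OF \<kappa>])
  have \<epsilon>: "\<epsilon> > 0" if "\<kappa> > 0" using that A unfolding k by (simp add: zero_less_divide_iff)
  have "buffon_probability M (\<gamma> L) (G L) (a L) L = 2 / (pi * L) * angle_integral \<kappa> L" if L: "L \<in> S" for L
  proof -
    have adm: "\<exists>n::nat. n > 1 \<and> 2 * real n * sqrt \<kappa> * L = pi" if "\<kappa> > 0"
      using S(2)[OF L \<epsilon>[OF that]] k by simp
    have "small \<kappa> L"
      unfolding small_def
    proof (intro conjI impI)
      assume "\<kappa> > 0"
      then obtain n :: nat where n: "n > 1" "2 * real n * sqrt \<kappa> * L = pi" using adm by blast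
      have "sqrt \<kappa> * L > 0" using \<open>\<kappa> > 0\<close> S(1)[OF L] by simp
      moreover have "real n * (sqrt \<kappa> * L) = pi / 2" using n(2) by simp
      \<comment> \<open>Here \<open>n > 1\<close> enters: for \<open>n = 1\<close> the half-length
        would be a full quarter of a great circle.\<close>
      moreover have "1 * (sqrt \<kappa> * L) < real n * (sqrt \<kappa> * L)"
        using n(1) \<open>sqrt \<kappa> * L > 0\<close> by (intro mult_strict_right_mono) auto
      ultimately show "sqrt \<kappa> * L < pi / 2" by simp
    qed (rule S(1)[OF L])
    then show ?thesis
      using buffon_probability_eq[of L "\<gamma> L" "G L" "a L"] adm eq[OF L] gr[OF L] pt[OF L]
      by (simp add: equator_def k)
  qed
  then have "eventually (\<lambda>L. 9 * pi / 2 * ((2 / (pi * L) * angle_integral \<kappa> L - 2 / pi) / L\<^sup>2) =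
      9 * pi / 2 * ((buffon_probability M (\<gamma> L) (G L) (a L) L - 2 / pi) / L\<^sup>2)) (at 0 within S)"
    by (simp add: eventually_at_filter)
  moreover have "at 0 within S \<le> at_right 0" using S(1) by (intro at_le) auto
  then have "((\<lambda>L. 9 * pi / 2 * ((2 / (pi * L) * angle_integral \<kappa> L - 2 / pi) / L\<^sup>2)) \<longlongrightarrow> \<kappa>) (at 0 within S)"
    using angle_integral_limit by (rule tendsto_mono)
  ultimately show ?thesis by (rule Lim_transform_eventually[rotated])
qed

section \<open>The plane, the disk and the sphere as instances\<close>

lemma model_atlas_single:
  assumes "A > 0" "\<epsilon> \<le> 0"
  shows "model_atlas (conf_dom \<epsilon>) {Chart (conf_dom \<epsilon>) id (conf_metric A \<epsilon>)} (stereo_inv A \<epsilon> 1) A \<epsilon>"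
proof
  have one: "(1::real) * 1 = 1" by simp
  show "inj_on (stereo_inv A \<epsilon> 1) (conf_dom \<epsilon>)"
    using stereo_inv_in_quadric(3)[OF assms(1) one] by (intro inj_onI) (metis mult_1)
  show "stereo_inv A \<epsilon> 1 ` conf_dom \<epsilon> = quadric (4 * \<epsilon> / A)"
  proof (intro equalityI subsetI)
    fix x assume "x \<in> stereo_inv A \<epsilon> 1 ` conf_dom \<epsilon>"
    then show "x \<in> quadric (4 * \<epsilon> / A)" using stereo_inv_in_quadric(1)[OF assms(1) one] by blast
  next
    fix x assume x: "x \<in> quadric (4 * \<epsilon> / A)"
    \<comment> \<open>On the upper sheet the third component is positive, so one chart reaches every
      point.\<close>
    then have "1 + 1 * x$3 \<noteq> 0" using assms by (auto simp: quadric_def divide_le_0_iff)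
    from stereo_proj_right_inverse[OF assms(1) one _ x this]
    show "x \<in> stereo_inv A \<epsilon> 1 ` conf_dom \<epsilon>" by (metis image_eqI)
  qed
qed (use assms in auto)

lemma sqn_norm: "sqn u = (norm u)\<^sup>2"
  by (simp add: sqn_def norm_eq_sqrt_inner inner_vec_def sum_2 power2_eq_square)

lemma plane_eq: "plane = surface_of_atlas (conf_dom 0) {Chart (conf_dom 0) id (conf_metric 1 0)}"
  by (simp add: plane_def conf_dom_def conf_metric_def[abs_def])

lemma hyperbolic_disk_eq:
  "hyperbolic_disk k = surface_of_atlas (conf_dom (-1)) {Chart (conf_dom (-1)) id (conf_metric (4 * k\<^sup>2) (-1))}"
proof -
  have "ball 0 1 = conf_dom (-1)"
    by (auto simp: conf_dom_def sqn_norm power_less_one_iff abs_square_less_1)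
  moreover have "(\<lambda>u. (4 * k\<^sup>2 / (1 - ((u$1)\<^sup>2 + (u$2)\<^sup>2))\<^sup>2) *\<^sub>R mat 1) = conf_metric (4 * k\<^sup>2) (-1)"
  proof
    fix u :: "real^2"
    have "1 + - 1 * sqn u = 1 - ((u$1)\<^sup>2 + (u$2)\<^sup>2)" by (simp add: sqn_def)
    then show "(4 * k\<^sup>2 / (1 - ((u$1)\<^sup>2 + (u$2)\<^sup>2))\<^sup>2) *\<^sub>R mat 1 = conf_metric (4 * k\<^sup>2) (-1) u"
      by (simp only: conf_metric_def)
  qed
  ultimately show ?thesis by (simp add: hyperbolic_disk_def)
qed

definition sphere_emb :: "real \<Rightarrow> real^3 \<Rightarrow> real^3" where
  "sphere_emb r p = vector [p$1, p$2, p$3 / r]"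

text \<open>The sign changes because \<open>stereo r s\<close> projects from height
  \<open>s * r\<close>, while the parameter of \<open>stereo_inv\<close> is opposite to the height
  of its centre. The value \<open>4 * r\<^sup>2\<close> of \<open>A\<close> gives curvature
  \<open>1 / r\<^sup>2\<close>.\<close>

lemma sphere_emb_stereo:
  assumes "r > 0"
  shows "sphere_emb r (stereo r s u) = stereo_inv (4 * r\<^sup>2) 1 (- s) u"
proof -
  have "r / D * (s * (q - 1)) / r = - s * (1 - q) / D" for D q
  proof -
    have "- s * (1 - q) = s * (q - 1)" by (simp add: algebra_simps)
    then show ?thesis using assms by simp
  qed
  from this[of "1 + (norm u)\<^sup>2" "(norm u)\<^sup>2"] show ?thesis
    using assms by (simp add: sphere_emb_def stereo_def stereo_inv_def sqn_norm vec_eq_iff forall_3 real_sqrt_mult)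
qed

lemma conf_dom_1: "conf_dom 1 = UNIV"
proof -
  have "1 + (norm u)\<^sup>2 > 0" for u :: "real^2" by (simp add: add_pos_nonneg)
  then show ?thesis by (simp add: conf_dom_def sqn_norm)
qed

text \<open>The map \<open>T\<close> undoes the scaling of the third coordinate and turns
  \<open>form\<close> into the Euclidean inner product, so the computation for
  \<open>stereo_inv\<close> applies.\<close>

lemma induced_metric_stereo:
  assumes "r > 0" "s * s = 1"
  shows "induced_metric (stereo r s) = conf_metric (4 * r\<^sup>2) 1"
proof
  fix u
  have u: "u \<in> conf_dom 1" by (simp add: conf_dom_1)
  define T where "T x = (vector [x$1, x$2, r * x$3] :: real^3)" for x :: "real^3"
  have "linear T" by (rule linearI) (auto simp: T_def vec_eq_iff forall_3 algebra_simps)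
  then have T: "bounded_linear T" by (simp add: linear_conv_bounded_linear)
  have "stereo r s v = T (stereo_inv (4 * r\<^sup>2) 1 (- s) v)" for v
    using assms(1) unfolding sphere_emb_stereo[OF assms(1), symmetric]
    by (simp add: T_def sphere_emb_def vec_eq_iff forall_3)
  then have eq: "stereo r s = (\<lambda>v. T (stereo_inv (4 * r\<^sup>2) 1 (- s) v))" by (rule ext)
  have diff: "stereo_inv (4 * r\<^sup>2) 1 (- s) differentiable (at u)"
    using C_on_stereo_inv[of 1 1 "4 * r\<^sup>2" "- s"] u by simp
  have "partial i (stereo r s) u = T (partial i (stereo_inv (4 * r\<^sup>2) 1 (- s)) u)" for i
    unfolding eq by (rule partial_bounded_linear[OF T diff])
  moreover have "T x \<bullet> T y = form (4 * 1 / (4 * r\<^sup>2)) x y" for x y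
    using assms(1) by (simp add: T_def form_def inner_vec_def sum_3 power2_eq_square)
  ultimately have "induced_metric (stereo r s) u = pullback (4 * 1 / (4 * r\<^sup>2)) (stereo_inv (4 * r\<^sup>2) 1 (- s)) u"
    by (simp add: induced_metric_def pullback_def)
  also have "\<dots> = conf_metric (4 * r\<^sup>2) 1 u"
    by (rule pullback_stereo_inv) (use assms u in auto)
  finally show "induced_metric (stereo r s) u = conf_metric (4 * r\<^sup>2) 1 u" .
qed

lemma model_atlas_sphere:
  assumes r: "r > 0"
  shows "model_atlas (sphere 0 r) ((\<lambda>\<epsilon>. Chart UNIV (stereo r \<epsilon>) (induced_metric (stereo r \<epsilon>))) ` {1, -1})
    (sphere_emb r) (4 * r\<^sup>2) 1"
proof -
  have A: "4 * r\<^sup>2 > 0" using r by simp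
  have mem: "p \<in> sphere 0 r \<longleftrightarrow> sphere_emb r p \<in> quadric (4 * 1 / (4 * r\<^sup>2))" for p
  proof -
    have "p \<in> sphere 0 r \<longleftrightarrow> p \<bullet> p = r\<^sup>2"
      using r by (simp add: dot_square_norm power2_eq_iff_nonneg)
    moreover have "dual_form (4 * 1 / (4 * r\<^sup>2)) (sphere_emb r p) (sphere_emb r p) = (p \<bullet> p) / r\<^sup>2"
      using r by (simp add: dual_form_def sphere_emb_def inner_vec_def sum_3 power2_eq_square field_simps)
    moreover have "(p \<bullet> p) / r\<^sup>2 = 1 \<longleftrightarrow> p \<bullet> p = r\<^sup>2" "\<not> 4 * 1 / (4 * r\<^sup>2) \<le> 0"
      using r by (auto simp: field_simps)
    ultimately show ?thesis by (simp only: quadric_def mem_Collect_eq) simp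
  qed
  have emb_eq: "sphere_emb r p = sphere_emb r q \<longleftrightarrow> p = q" for p q
    using r by (auto simp: sphere_emb_def vec_eq_iff forall_3)
  have surj: "sphere_emb r (vector [x$1, x$2, r * x$3]) = x" for x
    using r by (simp add: sphere_emb_def vec_eq_iff forall_3)
  have on_sphere: "stereo r s u \<in> sphere 0 r" if "s = 1 \<or> s = -1" for s u
    unfolding mem sphere_emb_stereo[OF r]
    by (rule stereo_inv_in_quadric(1)[OF A]) (use that in \<open>auto simp: conf_dom_1\<close>)
  have cover: "\<exists>s\<in>{1,-1}. p \<in> range (stereo r s)" if p: "p \<in> sphere 0 r" for p
  proof -
    \<comment> \<open>One of the two poles differs from \<open>p\<close> and can serve as projection
      centre.\<close>
    obtain s :: real where s: "s = 1 \<or> s = -1" "1 + (- s) * sphere_emb r p $ 3 \<noteq> 0"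
    proof (cases "sphere_emb r p $ 3 = 1")
      case True
      then show ?thesis using that[of "-1"] by simp
    next
      case False
      then show ?thesis using that[of 1] by simp
    qed
    have "stereo_inv (4 * r\<^sup>2) 1 (- s) (stereo_proj (4 * r\<^sup>2) (- s) (sphere_emb r p)) = sphere_emb r p"
      by (rule stereo_proj_right_inverse(2)[OF A _ _ _ s(2)]) (use s(1) p mem in auto)
    then have "stereo r s (stereo_proj (4 * r\<^sup>2) (- s) (sphere_emb r p)) = p"
      unfolding sphere_emb_stereo[OF r, symmetric] emb_eq .
    then show ?thesis using s(1) by (metis insertCI rangeI)
  qed
  show ?thesis
  proof
    show "inj_on (sphere_emb r) (sphere 0 r)" using emb_eq by (intro inj_onI) blast
    show "sphere_emb r ` sphere 0 r = quadric (4 * 1 / (4 * r\<^sup>2))"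
      using mem surj by (metis (no_types, lifting) image_eqI image_subsetI subsetI subset_antisym)
    show "sphere 0 r = (\<Union>e\<in>(\<lambda>\<epsilon>. Chart UNIV (stereo r \<epsilon>) (induced_metric (stereo r \<epsilon>))) ` {1, -1}. cimage e)"
    proof -
      have "sphere 0 r = (\<Union>s\<in>{1,-1}. range (stereo r s))"
      proof (intro equalityI subsetI)
        fix x :: "real^3" assume "x \<in> sphere 0 r"
        from cover[OF this] obtain s where "s \<in> {1,-1}" "x \<in> range (stereo r s)" ..
        then show "x \<in> (\<Union>s\<in>{1,-1}. range (stereo r s))" by (rule UN_I)
      next
        fix x assume "x \<in> (\<Union>s\<in>{1,-1}. range (stereo r s))"
        then obtain s u where "s \<in> {1,-1}" "x = stereo r s u" by (elim UN_E rangeE)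
        then show "x \<in> sphere 0 r" using on_sphere[of s u] by (simp only: insert_iff empty_iff) blast
      qed
      then show ?thesis by simp
    qed
    fix e assume "e \<in> (\<lambda>\<epsilon>. Chart UNIV (stereo r \<epsilon>) (induced_metric (stereo r \<epsilon>))) ` {1, -1}"
    then obtain s where "s \<in> {1, -1}" and "e = Chart UNIV (stereo r s) (induced_metric (stereo r s))"
      by (elim imageE)
    then have s: "s * s = 1" "e = Chart UNIV (stereo r s) (induced_metric (stereo r s))" by auto
    show "\<exists>\<sigma>. \<sigma> * \<sigma> = 1 \<and> (1 \<le> (0::real) \<longrightarrow> \<sigma> = 1) \<and> cdom e = conf_dom 1 \<and>
      cmet e = conf_metric (4 * r\<^sup>2) 1 \<and> (\<forall>u\<in>conf_dom 1. sphere_emb r (cmap e u) = stereo_inv (4 * r\<^sup>2) 1 \<sigma> u)"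
      using s sphere_emb_stereo[OF r, of s] induced_metric_stereo[OF r s(1)]
      by (intro exI[of _ "- s"]) (simp add: conf_dom_1)
  qed (rule A)
qed

text \<open>The pairs of \<open>A\<close> and \<open>\<epsilon>\<close> are 1 and 0,
  \<open>4 * r\<^sup>2\<close> and 1, \<open>4 * k\<^sup>2\<close> and -1, with curvatures 0,
  \<open>1 / r\<^sup>2\<close> and \<open>- 1 / k\<^sup>2\<close>.\<close>

theorem theorem1p2:
  fixes M :: "'a surface" and \<kappa> :: real and model :: model
    and \<gamma> :: "real \<Rightarrow> real \<Rightarrow> 'a" and G :: "real \<Rightarrow> 'a set set" and a :: "real \<Rightarrow> real"
  assumes "riemannian_surface M"
    and "constant_curvature M \<kappa>"
    and "isometric_to_model M model"
    and "\<And>L. admissible model L \<Longrightarrow> equator M (\<gamma> L)"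
    and "\<And>L. admissible model L \<Longrightarrow> grating M (\<gamma> L) L (G L)"
    and "\<And>L. admissible model L \<Longrightarrow> \<gamma> L (a L) \<in> \<Union>(G L)"
  shows "((\<lambda>L. 9 * pi / 2 *
            ((buffon_probability M (\<gamma> L) (G L) (a L) L - 2 / pi) / L\<^sup>2))
          \<longlongrightarrow> \<kappa>) (at 0 within {L. admissible model L})"
proof (cases model)
  case Plane
  then obtain f where "isometry f M (surface_of_atlas (conf_dom 0) {Chart (conf_dom 0) id (conf_metric 1 0)})"
    using assms(3) by (auto simp: isometric_def plane_eq)
  then interpret isometric_to_model_atlas "conf_dom 0" "{Chart (conf_dom 0) id (conf_metric 1 0)}"
    "stereo_inv 1 0 1" 1 0 M f
    using assms(1) model_atlas_single[of 1 0]
    by (intro isometric_to_model_atlas.intro isometric_to_model_atlas_axioms.intro) auto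
  show ?thesis
    by (rule buffon_limit[OF assms(2)]) (use assms(4-6) Plane in auto)
next
  case (Sphere r)
  then obtain f where r: "r > 0" and f: "isometry f M (surface_of_atlas (sphere 0 r)
      ((\<lambda>\<epsilon>. Chart UNIV (stereo r \<epsilon>) (induced_metric (stereo r \<epsilon>))) ` {1, -1}))"
    using assms(3) by (auto simp: isometric_def round_sphere_def)
  interpret isometric_to_model_atlas "sphere 0 r"
    "(\<lambda>\<epsilon>. Chart UNIV (stereo r \<epsilon>) (induced_metric (stereo r \<epsilon>))) ` {1, -1}"
    "sphere_emb r" "4 * r\<^sup>2" 1 M f
    using assms(1) model_atlas_sphere[OF r] f
    by (intro isometric_to_model_atlas.intro isometric_to_model_atlas_axioms.intro)
  have K: "sqrt (4 * 1 / (4 * r\<^sup>2)) = 1 / r" using r by (simp add: real_sqrt_divide)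
  show ?thesis
  proof (rule buffon_limit[OF assms(2)])
    fix L assume "L \<in> {L. admissible model L}"
    then obtain n :: nat where n: "n > 1" "L = pi * r / (2 * real n)" using Sphere by auto
    then show "L > 0" using r by simp
    show "\<exists>n::nat. n > 1 \<and> 2 * real n * sqrt (4 * 1 / (4 * r\<^sup>2)) * L = pi"
      unfolding K using n r by (intro exI[of _ n]) simp
  qed (use assms(4-6) in auto)
next
  case (Disk k)
  then obtain f where k: "k > 0" and f: "isometry f M (surface_of_atlas (conf_dom (-1))
      {Chart (conf_dom (-1)) id (conf_metric (4 * k\<^sup>2) (-1))})"
    using assms(3) by (auto simp: isometric_def hyperbolic_disk_eq)
  interpret isometric_to_model_atlas "conf_dom (-1)" "{Chart (conf_dom (-1)) id (conf_metric (4 * k\<^sup>2) (-1))}"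
    "stereo_inv (4 * k\<^sup>2) (-1) 1" "4 * k\<^sup>2" "-1" M f
    using assms(1) model_atlas_single[of "4 * k\<^sup>2" "-1"] k f
    by (intro isometric_to_model_atlas.intro isometric_to_model_atlas_axioms.intro) auto
  show ?thesis
    by (rule buffon_limit[OF assms(2)]) (use assms(4-6) Disk in auto)
qed

end
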